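(* The category $\mathbf{Comp}_3$ of $3$-computads is not cartesian closed.
   Context: All $n$-categories are small and strict; $n\mathbf{Cat}$ is the category of $n$-categories and (strict) $n$-functors. The truncation functor $tr_n:(n+1)\mathbf{Cat}\to n\mathbf{Cat}$ forgets the $(n+1)$-cells. For an $n$-category $A$, $A_n$ is its set of $n$-cells, and $d$, $c$ denote domain and codomain. A computad is a levelwise free higher category. The categories $\mathbf{Comp}_n$ of $n$-computads are defined inductively as (in general non-full) subcategories of $n\mathbf{Cat}$. - $\mathbf{Comp}_0=\mathbf{Set}$, the category of sets. - Suppose $\mathbf{Comp}_n$ is defined. For an $n$-computad $A$, let $\Pi_n(A)=\{\langle a,b\rangle \mid a,b\in A_n,\ d(a)=d(b),\ c(a)=c(b)\}$ be the set of parallel pairs of $n$-cells (for $n=0$ there is no condition and $\Pi_0(A)=A\times A$). This gives a functor $\Pi_n:\mathbf{Comp}_n\to\mathbf{Set}$. - Let $\mathbf{Com}_{n+1}=\mathbf{Set}\downarrow\Pi_n$ be the comma category. An object is an $n$-computad $A$ together with a set $X$ (of "$(n+1)$-indets", i.e. indeterminates or generators) and a function $\langle d,c\rangle:X\to\Pi_n(A)$. A morphism is a morphism of $n$-computads together with a function between the sets of $(n+1)$-indets, compatible with the structure functions. - Let $\mathbf{CCat}_{n+1}$ be the category whose objects are the $(n+1)$-categories $B$ with $tr_n(B)$ an $n$-computad, and whose morphisms are the $(n+1)$-functors $f$ with $tr_n(f)$ a morphism of $\mathbf{Comp}_n$. - The forgetful functor $U_{n+1}:\mathbf{CCat}_{n+1}\to\mathbf{Com}_{n+1}$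 sends $B$ to $tr_n(B)$ together with the set $B_{n+1}$ and its domain and codomain functions (it forgets compositions and identities at level $n+1$). It has a left adjoint $F_{n+1}$, the free $(n+1)$-category functor. - $\mathbf{Comp}_{n+1}$ is the essential (non-full) image of $F_{n+1}$ in $\mathbf{CCat}_{n+1}$. That is, the $(n+1)$-computads are the $(n+1)$-categories isomorphic in $\mathbf{CCat}_{n+1}$ to one of the form $F_{n+1}(A,X\to\Pi_n(A))$, and the morphisms of $(n+1)$-computads are the $(n+1)$-functors sending indets to indets (in every dimension). After restricting its codomain, $F_{n+1}$ becomes an equivalence of categories $\mathbf{Com}_{n+1}\simeq\mathbf{Comp}_{n+1}$. *)

theory Defs
  imports "HOL-Library.FuncSet" "HOL-Library.Equipollence"
begin

section \<open>Categories, products and exponentials\<close>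

text \<open>\<open>Cmp C X Y Z g f\<close> is the composite of \<open>f : X \<rightarrow> Y\<close> and \<open>g : Y \<rightarrow> Z\<close>.\<close>

record ('o, 'm) cat =
  Obj :: "'o set"
  Hom :: "'o \<Rightarrow> 'o \<Rightarrow> 'm set"
  Idt :: "'o \<Rightarrow> 'm"
  Cmp :: "'o \<Rightarrow> 'o \<Rightarrow> 'o \<Rightarrow> 'm \<Rightarrow> 'm \<Rightarrow> 'm"

definition category :: "('o, 'm) cat \<Rightarrow> bool" where
  "category C \<longleftrightarrow>
     (\<forall>X\<in>Obj C. Idt C X \<in> Hom C X X) \<and>
     (\<forall>X\<in>Obj C. \<forall>Y\<in>Obj C. \<forall>Z\<in>Obj C. \<forall>f\<in>Hom C X Y. \<forall>g\<in>Hom C Y Z.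
        Cmp C X Y Z g f \<in> Hom C X Z) \<and>
     (\<forall>X\<in>Obj C. \<forall>Y\<in>Obj C. \<forall>f\<in>Hom C X Y.
        Cmp C X X Y f (Idt C X) = f \<and> Cmp C X Y Y (Idt C Y) f = f) \<and>
     (\<forall>W\<in>Obj C. \<forall>X\<in>Obj C. \<forall>Y\<in>Obj C. \<forall>Z\<in>Obj C.
        \<forall>f\<in>Hom C W X. \<forall>g\<in>Hom C X Y. \<forall>h\<in>Hom C Y Z.
        Cmp C W X Z (Cmp C X Y Z h g) f = Cmp C W Y Z h (Cmp C W X Y g f))"

definition full_subcat :: "('o, 'm) cat \<Rightarrow> 'o set \<Rightarrow> ('o, 'm) cat" where
  "full_subcat C S = C\<lparr>Obj := Obj C \<inter> S\<rparr>"

definition is_terminal :: "('o, 'm) cat \<Rightarrow> 'o \<Rightarrow> bool" where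
  "is_terminal C T \<longleftrightarrow> T \<in> Obj C \<and> (\<forall>X\<in>Obj C. \<exists>!f. f \<in> Hom C X T)"

definition is_product :: "('o, 'm) cat \<Rightarrow> 'o \<Rightarrow> 'o \<Rightarrow> 'o \<Rightarrow> 'm \<Rightarrow> 'm \<Rightarrow> bool" where
  "is_product C A B P p q \<longleftrightarrow>
     P \<in> Obj C \<and> p \<in> Hom C P A \<and> q \<in> Hom C P B \<and>
     (\<forall>Z\<in>Obj C. \<forall>f\<in>Hom C Z A. \<forall>g\<in>Hom C Z B.
        \<exists>!h. h \<in> Hom C Z P \<and> Cmp C Z P A p h = f \<and> Cmp C Z P B q h = g)"

text \<open>\<open>E\<close> is the exponential \<open>B\<^sup>A\<close>, with evaluation \<open>ev : P \<rightarrow> B\<close>, where \<open>P = E \<times> A\<close> with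
  projections \<open>p\<close>, \<open>q\<close>.  The arrow \<open>h : Z \<times> A \<rightarrow> E \<times> A\<close> below is \<open>g \<times> A\<close>.\<close>

definition is_exponential ::
  "('o, 'm) cat \<Rightarrow> 'o \<Rightarrow> 'o \<Rightarrow> 'o \<Rightarrow> 'o \<Rightarrow> 'm \<Rightarrow> 'm \<Rightarrow> 'm \<Rightarrow> bool" where
  "is_exponential C A B E P p q ev \<longleftrightarrow>
     E \<in> Obj C \<and> is_product C E A P p q \<and> ev \<in> Hom C P B \<and>
     (\<forall>Z\<in>Obj C. \<forall>Q r s. is_product C Z A Q r s \<longrightarrow>
        (\<forall>f\<in>Hom C Q B. \<exists>!g. g \<in> Hom C Z E \<and>
           (\<exists>h\<in>Hom C Q P. Cmp C Q P E p h = Cmp C Q Z E g r \<and> Cmp C Q P A q h = s \<and>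
                Cmp C Q P B ev h = f)))"

text \<open>\<open>C\<close> has finite products, and every two objects from \<open>S\<close> have an exponential in \<open>C\<close>.
  For \<open>S = Obj C\<close> this says that \<open>C\<close> is cartesian closed.  The relative form is needed
  because of size, see the end of this theory.\<close>

definition cartesian_closed_on :: "('o, 'm) cat \<Rightarrow> 'o set \<Rightarrow> bool" where
  "cartesian_closed_on C S \<longleftrightarrow>
     (\<exists>T. is_terminal C T) \<and>
     (\<forall>A\<in>Obj C. \<forall>B\<in>Obj C. \<exists>P p q. is_product C A B P p q) \<and>
     (\<forall>A\<in>S. \<forall>B\<in>S. \<exists>E P p q ev. is_exponential C A B E P p q ev)"

abbreviation cartesian_closed :: "('o, 'm) cat \<Rightarrow> bool" where
  "cartesian_closed C \<equiv> cartesian_closed_on C (Obj C)"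

text \<open>A universal arrow from the object \<open>P\<close> of \<open>D\<close> to the functor \<open>(Uo, Um) : C \<rightarrow> D\<close>; that is,
  \<open>B\<close> is (isomorphic to) the value at \<open>P\<close> of the left adjoint, and \<open>e\<close> is the unit.\<close>

definition universal_arrow ::
  "('o, 'm) cat \<Rightarrow> ('p, 'l) cat \<Rightarrow> ('o \<Rightarrow> 'p) \<Rightarrow> ('m \<Rightarrow> 'l) \<Rightarrow> 'p \<Rightarrow> 'o \<Rightarrow> 'l \<Rightarrow> bool" where
  "universal_arrow C D Uo Um P B e \<longleftrightarrow>
     P \<in> Obj D \<and> B \<in> Obj C \<and> e \<in> Hom D P (Uo B) \<and>
     (\<forall>Z\<in>Obj C. \<forall>f\<in>Hom D P (Uo Z).
        \<exists>!g. g \<in> Hom C B Z \<and> Cmp D P (Uo B) (Uo Z) (Um g) e = f)"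


section \<open>Strict \<open>n\<close>-categories\<close>

text \<open>\<open>Cells A k\<close> is the set of \<open>k\<close>-cells; \<open>dm A k\<close> and \<open>cd A k\<close> give the domain and codomain
  of a \<open>(k+1)\<close>-cell; \<open>idn A k\<close> gives the identity \<open>(k+1)\<close>-cell of a \<open>k\<close>-cell;
  \<open>cmp A k j y x\<close> is the composite of the \<open>k\<close>-cells \<open>x\<close> and \<open>y\<close> (first \<open>x\<close>, then \<open>y\<close>) along
  their common \<open>j\<close>-dimensional boundary, \<open>j < k\<close>.  The sets \<open>Cells A k\<close> need not be disjoint
  for different \<open>k\<close>; the dimension is always given explicitly.\<close>

record 'u ncat =
  Cells :: "nat \<Rightarrow> 'u set"
  dm :: "nat \<Rightarrow> 'u \<Rightarrow> 'u"
  cd :: "nat \<Rightarrow> 'u \<Rightarrow> 'u"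
  idn :: "nat \<Rightarrow> 'u \<Rightarrow> 'u"
  cmp :: "nat \<Rightarrow> nat \<Rightarrow> 'u \<Rightarrow> 'u \<Rightarrow> 'u"

text \<open>Iterated domain and codomain of a \<open>k\<close>-cell in dimension \<open>j \<le> k\<close>, and the iterated identity
  \<open>k\<close>-cell of a \<open>j\<close>-cell.\<close>

primrec sdom :: "'u ncat \<Rightarrow> nat \<Rightarrow> nat \<Rightarrow> 'u \<Rightarrow> 'u" where
  "sdom A j 0 x = x"
| "sdom A j (Suc k) x = (if Suc k \<le> j then x else sdom A j k (dm A k x))"

primrec scod :: "'u ncat \<Rightarrow> nat \<Rightarrow> nat \<Rightarrow> 'u \<Rightarrow> 'u" where
  "scod A j 0 x = x"
| "scod A j (Suc k) x = (if Suc k \<le> j then x else scod A j k (cd A k x))"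

primrec iidn :: "'u ncat \<Rightarrow> nat \<Rightarrow> nat \<Rightarrow> 'u \<Rightarrow> 'u" where
  "iidn A j 0 x = x"
| "iidn A j (Suc k) x = (if Suc k \<le> j then x else idn A k (iidn A j k x))"

definition composable :: "'u ncat \<Rightarrow> nat \<Rightarrow> nat \<Rightarrow> 'u \<Rightarrow> 'u \<Rightarrow> bool" where
  "composable A k j y x \<longleftrightarrow>
     j < k \<and> x \<in> Cells A k \<and> y \<in> Cells A k \<and> sdom A j k y = scod A j k x"

locale n_category =
  fixes n :: nat and A :: "'u ncat"
  assumes no_cells: "n < k \<Longrightarrow> Cells A k = {}"
    and dm_in: "x \<in> Cells A (Suc k) \<Longrightarrow> dm A k x \<in> Cells A k"
    and cd_in: "x \<in> Cells A (Suc k) \<Longrightarrow> cd A k x \<in> Cells A k"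
    and dm_glob: "x \<in> Cells A (Suc (Suc k)) \<Longrightarrow> dm A k (dm A (Suc k) x) = dm A k (cd A (Suc k) x)"
    and cd_glob: "x \<in> Cells A (Suc (Suc k)) \<Longrightarrow> cd A k (dm A (Suc k) x) = cd A k (cd A (Suc k) x)"
    and idn_in: "\<lbrakk>k < n; x \<in> Cells A k\<rbrakk> \<Longrightarrow> idn A k x \<in> Cells A (Suc k)"
    and dm_idn: "\<lbrakk>k < n; x \<in> Cells A k\<rbrakk> \<Longrightarrow> dm A k (idn A k x) = x"
    and cd_idn: "\<lbrakk>k < n; x \<in> Cells A k\<rbrakk> \<Longrightarrow> cd A k (idn A k x) = x"
    and comp_in: "composable A k j y x \<Longrightarrow> cmp A k j y x \<in> Cells A k"
    and dm_comp: "composable A (Suc k) j y x \<Longrightarrow>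
          dm A k (cmp A (Suc k) j y x) = (if j = k then dm A k x else cmp A k j (dm A k y) (dm A k x))"
    and cd_comp: "composable A (Suc k) j y x \<Longrightarrow>
          cd A k (cmp A (Suc k) j y x) = (if j = k then cd A k y else cmp A k j (cd A k y) (cd A k x))"
    and assoc: "\<lbrakk>composable A k j z y; composable A k j y x\<rbrakk> \<Longrightarrow>
          cmp A k j (cmp A k j z y) x = cmp A k j z (cmp A k j y x)"
    and unit_right: "\<lbrakk>j < k; x \<in> Cells A k\<rbrakk> \<Longrightarrow> cmp A k j x (iidn A j k (sdom A j k x)) = x"
    and unit_left: "\<lbrakk>j < k; x \<in> Cells A k\<rbrakk> \<Longrightarrow> cmp A k j (iidn A j k (scod A j k x)) x = x"
    and idn_comp: "\<lbrakk>k < n; composable A k j y x\<rbrakk> \<Longrightarrow>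
          idn A k (cmp A k j y x) = cmp A (Suc k) j (idn A k y) (idn A k x)"
    and interchange: "\<lbrakk>i < j; composable A k j y' y; composable A k j x' x;
            composable A k i y' x'; composable A k i y x\<rbrakk> \<Longrightarrow>
          cmp A k i (cmp A k j y' y) (cmp A k j x' x) = cmp A k j (cmp A k i y' x') (cmp A k i y x)"

text \<open>Functors are extensional functions in each dimension, so that equality of functors is
  equality in HOL.\<close>

type_synonym 'u nmap = "nat \<Rightarrow> 'u \<Rightarrow> 'u"

definition n_functors :: "'u ncat \<Rightarrow> 'u ncat \<Rightarrow> 'u nmap set" where
  "n_functors A B = {f.
     (\<forall>k. f k \<in> Cells A k \<rightarrow>\<^sub>E Cells B k) \<and>
     (\<forall>k. \<forall>x\<in>Cells A (Suc k). f k (dm A k x) = dm B k (f (Suc k) x)) \<and>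
     (\<forall>k. \<forall>x\<in>Cells A (Suc k). f k (cd A k x) = cd B k (f (Suc k) x)) \<and>
     (\<forall>k. \<forall>x\<in>Cells A k. idn A k x \<in> Cells A (Suc k) \<longrightarrow> f (Suc k) (idn A k x) = idn B k (f k x)) \<and>
     (\<forall>k j y x. composable A k j y x \<longrightarrow> f k (cmp A k j y x) = cmp B k j (f k y) (f k x))}"

definition nmap_id :: "'u ncat \<Rightarrow> 'u nmap" where
  "nmap_id A = (\<lambda>k. \<lambda>x\<in>Cells A k. x)"

definition nmap_comp :: "'u ncat \<Rightarrow> 'u ncat \<Rightarrow> 'u ncat \<Rightarrow> 'u nmap \<Rightarrow> 'u nmap \<Rightarrow> 'u nmap" where
  "nmap_comp A B C g f = (\<lambda>k. compose (Cells A k) (g k) (f k))"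

definition NCat :: "nat \<Rightarrow> ('u ncat, 'u nmap) cat" where
  "NCat n = \<lparr>Obj = {A. n_category n A}, Hom = n_functors, Idt = nmap_id, Cmp = nmap_comp\<rparr>"

definition trunc :: "nat \<Rightarrow> 'u ncat \<Rightarrow> 'u ncat" where
  "trunc n A = A\<lparr>Cells := \<lambda>k. if k \<le> n then Cells A k else {}\<rparr>"

definition trunc_map :: "nat \<Rightarrow> 'u nmap \<Rightarrow> 'u nmap" where
  "trunc_map n f = (\<lambda>k. if k \<le> n then f k else (\<lambda>_. undefined))"


section \<open>Computads\<close>

text \<open>In this section \<open>K\<close> stands for the category of \<open>n\<close>-computads, from which the category of
  \<open>(n+1)\<close>-computads is constructed.\<close>

definition parallel_pairs :: "nat \<Rightarrow> 'u ncat \<Rightarrow> ('u \<times> 'u) set" where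
  "parallel_pairs n A = {(a, b). a \<in> Cells A n \<and> b \<in> Cells A n \<and>
     (case n of 0 \<Rightarrow> True | Suc m \<Rightarrow> dm A m a = dm A m b \<and> cd A m a = cd A m b)}"

record 'u com =
  base :: "'u ncat"
  indets :: "'u set"
  bdry :: "'u \<Rightarrow> 'u \<times> 'u"

definition Com :: "nat \<Rightarrow> ('u ncat, 'u nmap) cat \<Rightarrow> ('u com, 'u nmap \<times> ('u \<Rightarrow> 'u)) cat" where
  "Com n K = \<lparr>
     Obj = {P. base P \<in> Obj K \<and> bdry P \<in> indets P \<rightarrow> parallel_pairs n (base P)},
     Hom = (\<lambda>P Q. {(f, h). f \<in> Hom K (base P) (base Q) \<and> h \<in> indets P \<rightarrow>\<^sub>E indets Q \<and>
              (\<forall>x\<in>indets P. bdry Q (h x) = map_prod (f n) (f n) (bdry P x))}),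
     Idt = (\<lambda>P. (Idt K (base P), \<lambda>x\<in>indets P. x)),
     Cmp = (\<lambda>P Q R (f', h') (f, h).
              (Cmp K (base P) (base Q) (base R) f' f, compose (indets P) h' h))\<rparr>"

definition CCat :: "nat \<Rightarrow> ('u ncat, 'u nmap) cat \<Rightarrow> ('u ncat, 'u nmap) cat" where
  "CCat n K = \<lparr>
     Obj = {B. n_category (Suc n) B \<and> trunc n B \<in> Obj K},
     Hom = (\<lambda>B B'. {f \<in> n_functors B B'. trunc_map n f \<in> Hom K (trunc n B) (trunc n B')}),
     Idt = nmap_id, Cmp = nmap_comp\<rparr>"

definition forget :: "nat \<Rightarrow> 'u ncat \<Rightarrow> 'u com" where
  "forget n B = \<lparr>base = trunc n B, indets = Cells B (Suc n), bdry = (\<lambda>x. (dm B n x, cd B n x))\<rparr>"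

definition forget_map :: "nat \<Rightarrow> 'u nmap \<Rightarrow> 'u nmap \<times> ('u \<Rightarrow> 'u)" where
  "forget_map n f = (trunc_map n f, f (Suc n))"

definition is_free :: "nat \<Rightarrow> ('u ncat, 'u nmap) cat \<Rightarrow> 'u com \<Rightarrow> 'u ncat \<Rightarrow> 'u nmap \<times> ('u \<Rightarrow> 'u) \<Rightarrow> bool"
  where "is_free n K = universal_arrow (CCat n K) (Com n K) (forget n) (forget_map n)"

text \<open>The generating \<open>(n+1)\<close>-cells of a free \<open>(n+1)\<close>-category \<open>B\<close>.  They do not depend on the way
  in which \<open>B\<close> is presented as a free \<open>(n+1)\<close>-category, so the union over all presentations is
  the set of generators of any one of them.\<close>

definition top_indets :: "nat \<Rightarrow> ('u ncat, 'u nmap) cat \<Rightarrow> 'u ncat \<Rightarrow> 'u set" where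
  "top_indets n K B = {e x | P f e x. is_free n K P B (f, e) \<and> x \<in> indets P}"

text \<open>A set is identified with the \<open>0\<close>-category having it as its set of \<open>0\<close>-cells.  For infinite
  \<open>'u\<close>, all free \<open>(n+1)\<close>-categories over data in \<open>'u\<close> exist in \<open>'u\<close>, since they have at most
  \<open>|'u|\<close> cells; the universal property with respect to \<open>(n+1)\<close>-categories in \<open>'u\<close> therefore
  describes the free \<open>(n+1)\<close>-categories.\<close>

primrec Comp :: "nat \<Rightarrow> ('u ncat, 'u nmap) cat" where
  "Comp 0 = NCat 0"
| "Comp (Suc n) = \<lparr>
     Obj = {B. \<exists>P e. is_free n (Comp n) P B e},
     Hom = (\<lambda>B B'. {f \<in> Hom (CCat n (Comp n)) B B'.
              f (Suc n) ` top_indets n (Comp n) B \<subseteq> top_indets n (Comp n) B'}),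
     Idt = nmap_id, Cmp = nmap_comp\<rparr>"

text \<open>The computads and their morphisms form a category (\<open>category_Comp\<close>).\<close>

lemma sdom_functor:
  assumes A: "n_category n A" and f: "f \<in> n_functors A B" and "x \<in> Cells A k" "j \<le> k"
  shows "f j (sdom A j k x) = sdom B j k (f k x) \<and> f j (scod A j k x) = scod B j k (f k x)"
  using assms(3,4)
proof (induction k arbitrary: x)
  case (Suc k)
  then show ?case using f
    by (auto simp: n_functors_def le_Suc_eq n_category.dm_in[OF A] n_category.cd_in[OF A])
qed auto

lemma composable_functor:
  assumes A: "n_category n A" and f: "f \<in> n_functors A B" and "composable A k j y x"
  shows "composable B k j (f k y) (f k x)"
  using assms sdom_functor[OF A f, of x k j] sdom_functor[OF A f, of y k j]
  unfolding composable_def n_functors_def by auto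

lemma nmap_comp_functor:
  assumes A: "n_category n A" and f: "f \<in> n_functors A B" and g: "g \<in> n_functors B C"
  shows "nmap_comp A B C g f \<in> n_functors A C"
proof -
  have m: "\<And>k x. x \<in> Cells A k \<Longrightarrow> f k x \<in> Cells B k"
    using f unfolding n_functors_def by auto
  have m': "\<And>k x. x \<in> Cells B k \<Longrightarrow> g k x \<in> Cells C k"
    using g unfolding n_functors_def by auto
  have c: "\<And>k j y x. composable A k j y x \<Longrightarrow> cmp A k j y x \<in> Cells A k"
    using n_category.comp_in[OF A] .
  have d: "\<And>k x. x \<in> Cells A (Suc k) \<Longrightarrow> dm A k x \<in> Cells A k \<and> cd A k x \<in> Cells A k"
    using n_category.dm_in[OF A] n_category.cd_in[OF A] by blast
  have fi: "\<And>k x. x \<in> Cells A k \<Longrightarrow> idn A k x \<in> Cells A (Suc k) \<Longrightarrow>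
      f (Suc k) (idn A k x) = idn B k (f k x)"
    using f unfolding n_functors_def by blast
  have gi: "\<And>k x. x \<in> Cells B k \<Longrightarrow> idn B k x \<in> Cells B (Suc k) \<Longrightarrow>
      g (Suc k) (idn B k x) = idn C k (g k x)"
    using g unfolding n_functors_def by blast
  have i: "g (Suc k) (f (Suc k) (idn A k x)) = idn C k (g k (f k x))"
    if "x \<in> Cells A k" "idn A k x \<in> Cells A (Suc k)" for k x
    using fi[OF that] gi[OF m[OF that(1)]] m[OF that(2)] by simp
  have fc: "\<And>k j y x. composable A k j y x \<Longrightarrow> f k (cmp A k j y x) = cmp B k j (f k y) (f k x)"
    using f unfolding n_functors_def by blast
  have gc: "\<And>k j y x. composable B k j y x \<Longrightarrow> g k (cmp B k j y x) = cmp C k j (g k y) (g k x)"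
    using g unfolding n_functors_def by blast
  have fd: "\<And>k x. x \<in> Cells A (Suc k) \<Longrightarrow>
      f k (dm A k x) = dm B k (f (Suc k) x) \<and> f k (cd A k x) = cd B k (f (Suc k) x)"
    using f unfolding n_functors_def by blast
  have gd: "\<And>k x. x \<in> Cells B (Suc k) \<Longrightarrow>
      g k (dm B k x) = dm C k (g (Suc k) x) \<and> g k (cd B k x) = cd C k (g (Suc k) x)"
    using g unfolding n_functors_def by blast
  have xy: "\<And>k j y x. composable A k j y x \<Longrightarrow> x \<in> Cells A k \<and> y \<in> Cells A k"
    by (simp add: composable_def)
  show ?thesis
    unfolding n_functors_def nmap_comp_def
    by (simp add: compose_def m m' c d i fc gc fd gd xy composable_functor[OF A f])
qed

lemma nmap_id_functor: "n_category n A \<Longrightarrow> nmap_id A \<in> n_functors A A"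
  by (auto simp: nmap_id_def n_functors_def n_category.dm_in n_category.cd_in
      n_category.comp_in composable_def)

lemma nmap_comp_id:
  assumes "f \<in> n_functors A B"
  shows "nmap_comp A A B f (nmap_id A) = f" "nmap_comp A B B (nmap_id B) f = f"
  using assms by (auto simp: nmap_comp_def nmap_id_def fun_eq_iff compose_def n_functors_def
      PiE_def extensional_def Pi_def)

lemma nmap_comp_assoc:
  assumes "f \<in> n_functors A B"
  shows "nmap_comp A B D (nmap_comp B C D h g) f = nmap_comp A C D h (nmap_comp A B C g f)"
  using assms by (auto simp: nmap_comp_def fun_eq_iff compose_def n_functors_def
      PiE_def extensional_def Pi_def)

lemma Comp_simps [simp]: "Idt (Comp n) = nmap_id" "Cmp (Comp n) = nmap_comp"
  by (cases n; simp add: NCat_def)+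

lemma Comp_n_category: "A \<in> Obj (Comp n) \<Longrightarrow> n_category n A"
  by (cases n) (auto simp: NCat_def is_free_def universal_arrow_def CCat_def)

lemma Comp_n_functor: "f \<in> Hom (Comp n) A B \<Longrightarrow> f \<in> n_functors A B"
  by (cases n) (auto simp: NCat_def CCat_def)

lemma top_indets_subset: "top_indets n K B \<subseteq> Cells B (Suc n)"
  by (auto simp: top_indets_def is_free_def universal_arrow_def Com_def forget_def)

lemma trunc_map_id: "trunc_map n (nmap_id A) = nmap_id (trunc n A)"
  by (auto simp: trunc_map_def nmap_id_def trunc_def fun_eq_iff)

lemma trunc_map_comp:
  "trunc_map n (nmap_comp A B C g f) =
     nmap_comp (trunc n A) (trunc n B) (trunc n C) (trunc_map n g) (trunc_map n f)"
  by (auto simp: trunc_map_def nmap_comp_def trunc_def compose_def fun_eq_iff)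

lemma Comp_trunc: "A \<in> Obj (Comp (Suc n)) \<Longrightarrow> trunc n A \<in> Obj (Comp n)"
  by (auto simp: is_free_def universal_arrow_def CCat_def)

lemma Comp_id_closed: "A \<in> Obj (Comp n) \<Longrightarrow> nmap_id A \<in> Hom (Comp n) A A"
proof (induction n arbitrary: A)
  case 0
  then show ?case by (simp add: NCat_def nmap_id_functor)
next
  case (Suc n)
  have "nmap_id A (Suc n) ` top_indets n (Comp n) A \<subseteq> top_indets n (Comp n) A"
    using top_indets_subset[of n "Comp n" A] by (auto simp: nmap_id_def subset_iff)
  then show ?case
    using Suc.IH[OF Comp_trunc[OF Suc.prems]] nmap_id_functor[OF Comp_n_category[OF Suc.prems]]
    by (simp add: CCat_def trunc_map_id)
qed

lemma Comp_comp_closed: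
  assumes "A \<in> Obj (Comp n)" "B \<in> Obj (Comp n)" "C \<in> Obj (Comp n)"
    and "f \<in> Hom (Comp n) A B" "g \<in> Hom (Comp n) B C"
  shows "nmap_comp A B C g f \<in> Hom (Comp n) A C"
  using assms
proof (induction n arbitrary: A B C f g)
  case 0
  then show ?case by (auto simp: NCat_def intro: nmap_comp_functor)
next
  case (Suc n)
  have "nmap_comp A B C g f (Suc n) ` top_indets n (Comp n) A \<subseteq> top_indets n (Comp n) C"
    using top_indets_subset[of n "Comp n" A] Suc.prems(4,5)
    by (auto simp: nmap_comp_def compose_def subset_iff image_subset_iff)
  moreover have "trunc_map n (nmap_comp A B C g f) \<in> Hom (Comp n) (trunc n A) (trunc n C)"
    unfolding trunc_map_comp using Suc.prems(4,5)
    by (intro Suc.IH Comp_trunc Suc.prems) (auto simp: CCat_def)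
  moreover have "nmap_comp A B C g f \<in> n_functors A C"
    using nmap_comp_functor[OF Comp_n_category[OF Suc.prems(1)]] Suc.prems(4,5)
    by (blast dest: Comp_n_functor)
  ultimately show ?case by (simp add: CCat_def)
qed

lemma category_Comp: "category (Comp n)"
  unfolding category_def Comp_simps
proof (intro conjI ballI)
  fix A B C D f g h
  assume "f \<in> Hom (Comp n) A B"
  then show "nmap_comp A B D (nmap_comp B C D h g) f = nmap_comp A C D h (nmap_comp A B C g f)"
    by (rule nmap_comp_assoc[OF Comp_n_functor])
next
  fix A B f
  assume "f \<in> Hom (Comp n) A B"
  then have f: "f \<in> n_functors A B"
    by (rule Comp_n_functor)
  show "nmap_comp A A B f (nmap_id A) = f" and "nmap_comp A B B (nmap_id B) f = f"
    using f by (rule nmap_comp_id)+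
qed (simp_all add: Comp_id_closed Comp_comp_closed del: Comp.simps)


section \<open>Size\<close>

text \<open>A size family consists of the subsets of \<open>'u\<close> up to some infinite size: all of them, or
  those of cardinality less than (or at most) some given cardinal.\<close>

definition size_family :: "'u set set \<Rightarrow> bool" where
  "size_family \<U> \<longleftrightarrow> (\<exists>X\<in>\<U>. infinite X) \<and> (\<forall>X\<in>\<U>. \<forall>Y. lepoll Y X \<longrightarrow> Y \<in> \<U>)"

definition Computads :: "nat \<Rightarrow> 'u set set \<Rightarrow> ('u ncat, 'u nmap) cat" where
  "Computads n \<U> = full_subcat (Comp n) {A. \<forall>k. Cells A k \<in> \<U>}"

text \<open>The category of small computads is \<open>Computads n \<U>\<close> if \<open>\<U>\<close> consists of the sets of
  cardinality less than an inaccessible cardinal (a Grothendieck universe).  HOL does not prove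
  that any type is large enough for this, and for other \<open>\<U>\<close>, such as \<open>\<U> = UNIV\<close>, the category may
  fail to be cartesian closed merely because the exponentials are too large: by Cantor's theorem
  the same happens for the category of sets in \<open>\<U>\<close>.  Failure of cartesian closedness is therefore
  expressed with two size families \<open>\<V> \<subseteq> \<U>\<close>: there are computads \<open>A\<close>, \<open>B\<close> in \<open>\<V>\<close> without an
  exponential in \<open>\<U>\<close>, i.e. \<open>\<not> cartesian_closed_on (Computads n \<U>) (Obj (Computads n \<V>))\<close>.
  Here \<open>\<U>\<close> may exceed \<open>\<V>\<close> by as much as one likes (e.g. \<open>\<V>\<close> the countable sets, \<open>\<U>\<close> all subsets
  of a type as large as desired), which rules out obstructions of size; and for \<open>\<V> = \<U>\<close> this is
  \<open>\<not> cartesian_closed (Computads n \<U>)\<close>, in particular for a Grothendieck universe \<open>\<U>\<close>.  Terminal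
  objects and binary products are not affected by size, as they exist in \<open>Computads n \<U>\<close> for
  every size family \<open>\<U>\<close>.\<close>

end

theory Submission
  imports Defs "HOL-Library.Multiset" "HOL-Library.Countable"
begin

text \<open>By the Eckmann-Hilton argument the 2-cells whose boundary is the identity of a 0-cell commute under
composition.  In a computad with one 0-generator, no 1-generators and a set \<open>X\<close> of 2-generators the
2-cells are therefore the finite multisets over \<open>X\<close>.  A multiset over \<open>X\<close> and a multiset over \<open>Y\<close> of
the same size may be the projections of several multisets over \<open>X \<times> Y\<close>, and how many of them there
are changes when elements of \<open>X\<close> are identified.  The 3-generators of a product of two 3-computads
correspond to such lifts of their boundaries, and this makes \<open>- \<times> A\<close> incompatible with identifying
2-generators.

Let \<open>Z\<close> have 2-generators \<open>x\<^sub>0\<close>, \<open>x\<^sub>1\<close> and one 3-generator \<open>\<zeta> : x\<^sub>0 + x\<^sub>1 \<rightarrow> 0\<close>.  Then \<open>Z \<times> Z\<close> has two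
3-generators, with domains \<open>(x\<^sub>0, x\<^sub>0) + (x\<^sub>1, x\<^sub>1)\<close> and \<open>(x\<^sub>0, x\<^sub>1) + (x\<^sub>1, x\<^sub>0)\<close>.  Let \<open>B\<close> have one
2-generator \<open>t\<close> and two 3-generators \<open>t + t \<rightarrow> 0\<close>; a map \<open>f : Z \<times> Z \<rightarrow> B\<close> separates the two
3-generators.  The swap \<open>\<sigma>\<close> of \<open>x\<^sub>0\<close> and \<open>x\<^sub>1\<close> is an automorphism of \<open>Z\<close> that fixes \<open>\<zeta>\<close>, while \<open>\<sigma> \<times> Z\<close>
exchanges the two 3-generators of \<open>Z \<times> Z\<close>, so \<open>f \<circ> (\<sigma> \<times> Z) \<noteq> f\<close>.  Suppose that \<open>B\<^sup>Z\<close> exists, and let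
\<open>g : Z \<rightarrow> B\<^sup>Z\<close> be the transpose of \<open>f\<close>.  Let \<open>Z\<^sub>0\<close> be \<open>Z\<close> without \<open>\<zeta>\<close>.  The product \<open>Z\<^sub>0 \<times> Z\<close> has no
3-generators, and on it \<open>f\<close> and \<open>f \<circ> (\<sigma> \<times> Z)\<close> agree because both send every 2-generator to \<open>t\<close>.
Hence \<open>g\<close> and \<open>g \<circ> \<sigma>\<close> agree on \<open>Z\<^sub>0\<close>; they also agree on \<open>\<zeta>\<close>, since \<open>\<sigma>\<close> fixes it; so \<open>g \<circ> \<sigma> = g\<close>
and \<open>f \<circ> (\<sigma> \<times> Z) = f\<close>, a contradiction (\<open>no_exponential\<close>).

All these computads belong to one family that can be written down because every 3-generator has
codomain 0: such generators only consume 2-generators, so they can all be fired at once, and a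
3-cell is just a multiset \<open>w\<close> of 3-generators together with the multiset \<open>b\<close> of 2-generators that is
left over.  The universal property is \<open>is_free_level2\<close> and \<open>is_free_level3\<close>.  A morphism of computads
must preserve the generators of every presentation of its source, so the generators have to be
recognised intrinsically (\<open>top_indets_subsetI\<close>).  Products are computed one dimension at a time
(\<open>product_lift\<close>).  All the computads used are countable, so they belong to every size family, and
the missing exponential does not depend on size.\<close>

section \<open>Truncations\<close>

lemma sdom_trunc [simp]: "sdom (trunc m A) j k x = sdom A j k x"
  by (induction k arbitrary: x) (auto simp: trunc_def)

lemma scod_trunc [simp]: "scod (trunc m A) j k x = scod A j k x"
  by (induction k arbitrary: x) (auto simp: trunc_def)

lemma iidn_trunc [simp]: "iidn (trunc m A) j k x = iidn A j k x"
  by (induction k arbitrary: x) (auto simp: trunc_def)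

lemma trunc_simps [simp]:
  "Cells (trunc m A) k = (if k \<le> m then Cells A k else {})"
  "dm (trunc m A) = dm A" "cd (trunc m A) = cd A" "idn (trunc m A) = idn A"
  "cmp (trunc m A) = cmp A"
  by (auto simp: trunc_def)

lemma composable_trunc [simp]:
  "composable (trunc m A) k j y x \<longleftrightarrow> k \<le> m \<and> composable A k j y x"
  by (auto simp: composable_def)

lemma trunc_trunc [simp]: "trunc m (trunc n A) = trunc (min m n) A"
  by (auto simp: trunc_def fun_eq_iff)

lemma n_category_trunc:
  assumes "n_category n A" "m \<le> n"
  shows "n_category m (trunc m A)"
proof -
  interpret n_category n A by fact
  show ?thesis
  proof
    fix i j k x x' y y'
    assume *: "i < j" "composable (trunc m A) k j y' y" "composable (trunc m A) k j x' x"
      "composable (trunc m A) k i y' x'" "composable (trunc m A) k i y x"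
    show "cmp (trunc m A) k i (cmp (trunc m A) k j y' y) (cmp (trunc m A) k j x' x) =
        cmp (trunc m A) k j (cmp (trunc m A) k i y' x') (cmp (trunc m A) k i y x)"
      using interchange[OF *(1)] * by auto
  qed (use assms(2) in \<open>auto simp: dm_in cd_in dm_glob cd_glob idn_in dm_idn cd_idn comp_in
        dm_comp cd_comp assoc unit_right unit_left idn_comp split: if_splits\<close>)
qed

lemma trunc_map_functor: "f \<in> n_functors A B \<Longrightarrow> trunc_map m f \<in> n_functors (trunc m A) (trunc m B)"
  unfolding n_functors_def trunc_map_def
  by (auto simp: PiE_iff extensional_def split: if_splits)

lemma trunc_map_trunc_map [simp]: "trunc_map m (trunc_map n f) = trunc_map (min m n) f"
  by (auto simp: trunc_map_def fun_eq_iff)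

lemma trunc_map_eqD: "trunc_map n f = trunc_map n g \<Longrightarrow> k \<le> n \<Longrightarrow> f k = g k"
  by (metis trunc_map_def)

section \<open>Functors\<close>

lemma n_functors_cell: "f \<in> n_functors A B \<Longrightarrow> x \<in> Cells A k \<Longrightarrow> f k x \<in> Cells B k"
  by (auto simp: n_functors_def)

lemma n_functors_dm: "f \<in> n_functors A B \<Longrightarrow> x \<in> Cells A (Suc k) \<Longrightarrow> dm B k (f (Suc k) x) = f k (dm A k x)"
  by (auto simp: n_functors_def)

lemma n_functors_cd: "f \<in> n_functors A B \<Longrightarrow> x \<in> Cells A (Suc k) \<Longrightarrow> cd B k (f (Suc k) x) = f k (cd A k x)"
  by (auto simp: n_functors_def)

lemma n_functors_idn: "f \<in> n_functors A B \<Longrightarrow> x \<in> Cells A k \<Longrightarrow> idn A k x \<in> Cells A (Suc k) \<Longrightarrow>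
    f (Suc k) (idn A k x) = idn B k (f k x)"
  by (auto simp: n_functors_def)

lemma n_functors_cmp: "f \<in> n_functors A B \<Longrightarrow> composable A k j y x \<Longrightarrow>
    f k (cmp A k j y x) = cmp B k j (f k y) (f k x)"
  by (auto simp: n_functors_def)

lemma n_functors_eqI:
  assumes "f \<in> n_functors A B" "g \<in> n_functors A B" "\<And>k x. x \<in> Cells A k \<Longrightarrow> f k x = g k x"
  shows "f = g"
proof
  fix k show "f k = g k"
    using assms by (intro extensionalityI[of _ "Cells A k"]) (auto simp: n_functors_def PiE_iff)
qed

lemma nmap_comp_apply: "x \<in> Cells A k \<Longrightarrow> nmap_comp A B C g f k x = g k (f k x)"
  by (simp add: nmap_comp_def compose_def)

text \<open>An \<open>(n+1)\<close>-functor is assembled from its truncation \<open>t\<close> and its action \<open>h\<close> on the \<open>(n+1)\<close>-cells.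
Above dimension \<open>n+1\<close> the value is \<open>\<lambda>_. undefined\<close>, the only extensional function on the empty set.\<close>

definition ext_map :: "nat \<Rightarrow> 'u nmap \<Rightarrow> ('u \<Rightarrow> 'u) \<Rightarrow> 'u nmap" where
  "ext_map n t h = (\<lambda>k. if k \<le> n then t k else if k = Suc n then h else (\<lambda>_. undefined))"

lemma trunc_ext_map:
  assumes "t \<in> n_functors (trunc n B) C"
  shows "trunc_map n (ext_map n t h) = t"
  using assms by (auto simp: trunc_map_def ext_map_def fun_eq_iff n_functors_def PiE_iff extensional_def)

lemma ext_map_functor:
  assumes B: "n_category (Suc n) B"
    and t: "t \<in> n_functors (trunc n B) (trunc n Y)"
    and h: "h \<in> Cells B (Suc n) \<rightarrow>\<^sub>E Cells Y (Suc n)"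
    and d: "\<And>x. x \<in> Cells B (Suc n) \<Longrightarrow> dm Y n (h x) = t n (dm B n x)"
    and c: "\<And>x. x \<in> Cells B (Suc n) \<Longrightarrow> cd Y n (h x) = t n (cd B n x)"
    and i: "\<And>x. x \<in> Cells B n \<Longrightarrow> h (idn B n x) = idn Y n (t n x)"
    and m: "\<And>j y x. composable B (Suc n) j y x \<Longrightarrow> h (cmp B (Suc n) j y x) = cmp Y (Suc n) j (h y) (h x)"
  shows "ext_map n t h \<in> n_functors B Y"
proof -
  interpret n_category "Suc n" B by fact
  have E: "Cells B k = {}" if "Suc n < k" for k using no_cells that .
  show ?thesis unfolding n_functors_def mem_Collect_eq
  proof (intro conjI allI ballI impI)
    fix k
    consider "k \<le> n" | "k = Suc n" | "k > Suc n" by linarith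
    then show "ext_map n t h k \<in> Cells B k \<rightarrow>\<^sub>E Cells Y k"
    proof cases
      case 1 with t show ?thesis by (auto simp: n_functors_def ext_map_def dest!: spec[of _ k] split: if_splits)
    next
      case 2 with h show ?thesis by (simp add: ext_map_def)
    next
      case 3 with E show ?thesis by (auto simp: ext_map_def)
    qed
  next
    fix k x assume x: "x \<in> Cells B (Suc k)"
    then have "k \<le> n" using E[of "Suc k"] by (cases "k \<le> n") auto
    then show "ext_map n t h k (dm B k x) = dm Y k (ext_map n t h (Suc k) x)"
      "ext_map n t h k (cd B k x) = cd Y k (ext_map n t h (Suc k) x)"
      using x d c n_functors_dm[OF t, of x k] n_functors_cd[OF t, of x k]
      by (cases "k = n"; simp add: ext_map_def)+
  next
    fix k x assume x: "x \<in> Cells B k" "idn B k x \<in> Cells B (Suc k)"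
    then have "k \<le> n" using E[of "Suc k"] by (cases "k \<le> n") auto
    then show "ext_map n t h (Suc k) (idn B k x) = idn Y k (ext_map n t h k x)"
      using x i n_functors_idn[OF t, of x k] by (cases "k = n") (simp_all add: ext_map_def)
  next
    fix k j y x assume xy: "composable B k j y x"
    then have "k \<le> Suc n" using E[of k] by (cases "k \<le> Suc n") (auto simp: composable_def)
    then show "ext_map n t h k (cmp B k j y x) = cmp Y k j (ext_map n t h k y) (ext_map n t h k x)"
      using xy m n_functors_cmp[OF t, of k j y x] by (cases "k = Suc n") (simp_all add: ext_map_def)
  qed
qed

lemma n_functors_eq_top:
  assumes B: "n_category (Suc n) B" and g: "g \<in> n_functors B Y" and g': "g' \<in> n_functors B Y"
    and tr: "trunc_map n g = trunc_map n g'"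
    and top: "\<And>x. x \<in> Cells B (Suc n) \<Longrightarrow> g (Suc n) x = g' (Suc n) x"
  shows "g = g'"
proof (rule n_functors_eqI[OF g g'])
  fix k x assume x: "x \<in> Cells B k"
  have "k \<le> Suc n" using n_category.no_cells[OF B, of k] x by (cases "k \<le> Suc n") auto
  then show "g k x = g' k x"
    using x top trunc_map_eqD[OF tr, of k] by (cases "k = Suc n") auto
qed

section \<open>Presentations of free categories\<close>

text \<open>The presentation of \<open>B\<close> by a subset \<open>G\<close> of its own top cells; the unit is the inclusion.\<close>

definition gen_com :: "nat \<Rightarrow> 'u ncat \<Rightarrow> 'u set \<Rightarrow> 'u com" where
  "gen_com n B G = \<lparr>base = trunc n B, indets = G, bdry = (\<lambda>x. (dm B n x, cd B n x))\<rparr>"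

definition gen_unit :: "nat \<Rightarrow> 'u ncat \<Rightarrow> 'u set \<Rightarrow> 'u nmap \<times> ('u \<Rightarrow> 'u)" where
  "gen_unit n B G = (nmap_id (trunc n B), \<lambda>x\<in>G. x)"

lemma CCat_simps [simp]:
  "B \<in> Obj (CCat n K) \<longleftrightarrow> n_category (Suc n) B \<and> trunc n B \<in> Obj K"
  "f \<in> Hom (CCat n K) B B' \<longleftrightarrow> f \<in> n_functors B B' \<and> trunc_map n f \<in> Hom K (trunc n B) (trunc n B')"
  by (auto simp: CCat_def)

lemma is_freeI:
  assumes B: "B \<in> Obj (CCat n (Comp n))" and G: "G \<subseteq> Cells B (Suc n)"
    and ex: "\<And>Y t h. n_category (Suc n) Y \<Longrightarrow> trunc n Y \<in> Obj (Comp n) \<Longrightarrow>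
      t \<in> Hom (Comp n) (trunc n B) (trunc n Y) \<Longrightarrow>
      (\<And>x. x \<in> G \<Longrightarrow> h x \<in> Cells Y (Suc n)) \<Longrightarrow>
      (\<And>x. x \<in> G \<Longrightarrow> dm Y n (h x) = t n (dm B n x)) \<Longrightarrow>
      (\<And>x. x \<in> G \<Longrightarrow> cd Y n (h x) = t n (cd B n x)) \<Longrightarrow>
      \<exists>g\<in>n_functors B Y. trunc_map n g = t \<and> (\<forall>x\<in>G. g (Suc n) x = h x)"
    and uniq: "\<And>Y g g'. n_category (Suc n) Y \<Longrightarrow> g \<in> n_functors B Y \<Longrightarrow> g' \<in> n_functors B Y \<Longrightarrow>
      trunc_map n g = trunc_map n g' \<Longrightarrow> (\<And>x. x \<in> G \<Longrightarrow> g (Suc n) x = g' (Suc n) x) \<Longrightarrow> g = g'"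
  shows "is_free n (Comp n) (gen_com n B G) B (gen_unit n B G)"
proof -
  interpret n_category "Suc n" B using B by simp
  have tB: "trunc n B \<in> Obj (Comp n)" using B by simp
  have bd: "(dm B n x, cd B n x) \<in> parallel_pairs n (trunc n B)" if "x \<in> G" for x
    using that G dm_in[of x n] cd_in[of x n] dm_glob cd_glob
    by (auto simp: parallel_pairs_def split: nat.split)
  have P: "gen_com n B G \<in> Obj (Com n (Comp n))"
    using tB bd by (auto simp: Com_def gen_com_def)
  have e: "gen_unit n B G \<in> Hom (Com n (Comp n)) (gen_com n B G) (forget n B)"
    using Comp_id_closed[OF tB] G bd
    by (auto simp: Com_def gen_com_def gen_unit_def forget_def nmap_id_def parallel_pairs_def)
  show ?thesis unfolding is_free_def universal_arrow_def
  proof (intro conjI P B e ballI)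
    fix Y f assume Y: "Y \<in> Obj (CCat n (Comp n))"
      and f: "f \<in> Hom (Com n (Comp n)) (gen_com n B G) (forget n Y)"
    obtain t h where f_eq: "f = (t, h)" by (cases f)
    from f f_eq have t: "t \<in> Hom (Comp n) (trunc n B) (trunc n Y)"
      and h: "h \<in> G \<rightarrow>\<^sub>E Cells Y (Suc n)"
      and hb: "\<And>x. x \<in> G \<Longrightarrow> dm Y n (h x) = t n (dm B n x) \<and> cd Y n (h x) = t n (cd B n x)"
      by (auto simp: Com_def gen_com_def forget_def)
    have char: "Cmp (Com n (Comp n)) (gen_com n B G) (forget n B) (forget n Y) (forget_map n g)
         (gen_unit n B G) = f \<longleftrightarrow> trunc_map n g = t \<and> (\<forall>x\<in>G. g (Suc n) x = h x)"
      if "g \<in> n_functors B Y" for g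
    proof -
      have "nmap_comp (trunc n B) (trunc n B) (trunc n Y) (trunc_map n g) (nmap_id (trunc n B)) = trunc_map n g"
        using nmap_comp_id(1)[OF trunc_map_functor[OF that]] .
      moreover have "compose G (g (Suc n)) (\<lambda>x\<in>G. x) = h \<longleftrightarrow> (\<forall>x\<in>G. g (Suc n) x = h x)"
        using h by (auto simp: compose_def fun_eq_iff PiE_iff extensional_def)
      ultimately show ?thesis
        by (simp add: Com_def gen_com_def forget_def forget_map_def gen_unit_def f_eq)
    qed
    obtain g where g: "g \<in> n_functors B Y" "trunc_map n g = t" "\<forall>x\<in>G. g (Suc n) x = h x"
      using ex[of Y t h] Y t h hb by (auto simp: PiE_iff)
    show "\<exists>!g. g \<in> Hom (CCat n (Comp n)) B Y \<and>
        Cmp (Com n (Comp n)) (gen_com n B G) (forget n B) (forget n Y) (forget_map n g) (gen_unit n B G) = f"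
    proof (rule ex1I[of _ g])
      show "g \<in> Hom (CCat n (Comp n)) B Y \<and>
        Cmp (Com n (Comp n)) (gen_com n B G) (forget n B) (forget n Y) (forget_map n g) (gen_unit n B G) = f"
        using g t char by simp
      fix g' assume g': "g' \<in> Hom (CCat n (Comp n)) B Y \<and>
        Cmp (Com n (Comp n)) (gen_com n B G) (forget n B) (forget n Y) (forget_map n g') (gen_unit n B G) = f"
      then have "g' \<in> n_functors B Y" by simp
      moreover from this g' have "trunc_map n g' = t \<and> (\<forall>x\<in>G. g' (Suc n) x = h x)"
        using char by blast
      ultimately show "g' = g" using g Y by - (rule uniq[of Y], simp_all)
    qed
  qed
qed

text \<open>The universal property in terms of cells, for an arbitrary presentation \<open>e : R \<rightarrow> U C\<close>.  That
\<open>fst e\<close> is invertible is true but harder to show; all constructions of maps out of \<open>C\<close> below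
therefore start from a map out of \<open>base R\<close> and are compared after composition with \<open>fst e\<close>.\<close>

lemma
  assumes free: "is_free n (Comp n) R C e"
  shows is_free_base: "base R \<in> Obj (Comp n)"
    and is_free_obj: "C \<in> Obj (CCat n (Comp n))"
    and is_free_base_map: "fst e \<in> Hom (Comp n) (base R) (trunc n C)"
    and is_free_cell: "\<And>x. x \<in> indets R \<Longrightarrow> snd e x \<in> Cells C (Suc n)"
    and is_free_bdry: "\<And>x. x \<in> indets R \<Longrightarrow> fst (bdry R x) \<in> Cells (base R) n \<and> snd (bdry R x) \<in> Cells (base R) n"
    and is_free_dm: "\<And>x. x \<in> indets R \<Longrightarrow> dm C n (snd e x) = fst e n (fst (bdry R x))"
    and is_free_cd: "\<And>x. x \<in> indets R \<Longrightarrow> cd C n (snd e x) = fst e n (snd (bdry R x))"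
    and is_free_extend: "\<And>Y t h. n_category (Suc n) Y \<Longrightarrow> trunc n Y \<in> Obj (Comp n) \<Longrightarrow>
      t \<in> Hom (Comp n) (base R) (trunc n Y) \<Longrightarrow>
      (\<And>x. x \<in> indets R \<Longrightarrow> h x \<in> Cells Y (Suc n) \<and> dm Y n (h x) = t n (fst (bdry R x)) \<and>
         cd Y n (h x) = t n (snd (bdry R x))) \<Longrightarrow>
      \<exists>g\<in>Hom (CCat n (Comp n)) C Y. 
        nmap_comp (base R) (trunc n C) (trunc n Y) (trunc_map n g) (fst e) = t \<and>
        (\<forall>x\<in>indets R. g (Suc n) (snd e x) = h x)"
    and is_free_unique: "\<And>Y g g'. n_category (Suc n) Y \<Longrightarrow> trunc n Y \<in> Obj (Comp n) \<Longrightarrow>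
      g \<in> Hom (CCat n (Comp n)) C Y \<Longrightarrow> g' \<in> Hom (CCat n (Comp n)) C Y \<Longrightarrow>
      nmap_comp (base R) (trunc n C) (trunc n Y) (trunc_map n g) (fst e) =
      nmap_comp (base R) (trunc n C) (trunc n Y) (trunc_map n g') (fst e) \<Longrightarrow>
      (\<And>x. x \<in> indets R \<Longrightarrow> g (Suc n) (snd e x) = g' (Suc n) (snd e x)) \<Longrightarrow> g = g'"
proof -
  obtain e1 e2 where e_eq: "e = (e1, e2)" by (cases e)
  have R: "base R \<in> Obj (Comp n)" and bR: "\<And>x. x \<in> indets R \<Longrightarrow> bdry R x \<in> parallel_pairs n (base R)"
    and C: "C \<in> Obj (CCat n (Comp n))"
    and e: "e \<in> Hom (Com n (Comp n)) R (forget n C)"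
    and univ: "\<And>Z f. Z \<in> Obj (CCat n (Comp n)) \<Longrightarrow> f \<in> Hom (Com n (Comp n)) R (forget n Z) \<Longrightarrow>
        \<exists>!g. g \<in> Hom (CCat n (Comp n)) C Z \<and>
          Cmp (Com n (Comp n)) R (forget n C) (forget n Z) (forget_map n g) e = f"
  proof -
    note a = free[unfolded is_free_def universal_arrow_def]
    show "C \<in> Obj (CCat n (Comp n))" "e \<in> Hom (Com n (Comp n)) R (forget n C)" using a by blast+
    show "base R \<in> Obj (Comp n)" "\<And>x. x \<in> indets R \<Longrightarrow> bdry R x \<in> parallel_pairs n (base R)"
      using a by (auto simp: Com_def)
    show "\<exists>!g. g \<in> Hom (CCat n (Comp n)) C Z \<and>
          Cmp (Com n (Comp n)) R (forget n C) (forget n Z) (forget_map n g) e = f"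
      if "Z \<in> Obj (CCat n (Comp n))" "f \<in> Hom (Com n (Comp n)) R (forget n Z)" for Z f
      using a that by blast
  qed
  have e1: "e1 \<in> Hom (Comp n) (base R) (trunc n C)" and e2: "e2 \<in> indets R \<rightarrow>\<^sub>E Cells C (Suc n)"
    and e3: "\<And>x. x \<in> indets R \<Longrightarrow> dm C n (e2 x) = e1 n (fst (bdry R x)) \<and> cd C n (e2 x) = e1 n (snd (bdry R x))"
    using e by (auto simp: Com_def forget_def e_eq case_prod_unfold prod_eq_iff)
  have comp: "Cmp (Com n (Comp n)) R (forget n C) (forget n Z) (forget_map n g) e =
     (nmap_comp (base R) (trunc n C) (trunc n Z) (trunc_map n g) e1, compose (indets R) (g (Suc n)) e2)" for Z g
    by (simp add: Com_def forget_def forget_map_def e_eq)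
  show "base R \<in> Obj (Comp n)" "C \<in> Obj (CCat n (Comp n))" "fst e \<in> Hom (Comp n) (base R) (trunc n C)"
    using R C e1 by (simp_all add: e_eq)
  show "snd e x \<in> Cells C (Suc n)" "dm C n (snd e x) = fst e n (fst (bdry R x))"
    "cd C n (snd e x) = fst e n (snd (bdry R x))" if "x \<in> indets R" for x
    using e2 e3[OF that] that by (auto simp: e_eq)
  show "fst (bdry R x) \<in> Cells (base R) n \<and> snd (bdry R x) \<in> Cells (base R) n" if "x \<in> indets R" for x
    using bR[OF that] by (auto simp: parallel_pairs_def)
  {
    fix Y t h assume Y: "n_category (Suc n) Y" "trunc n Y \<in> Obj (Comp n)"
     and t: "t \<in> Hom (Comp n) (base R) (trunc n Y)"
     and h: "\<And>x. x \<in> indets R \<Longrightarrow> h x \<in> Cells Y (Suc n) \<and> dm Y n (h x) = t n (fst (bdry R x)) \<and>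
         cd Y n (h x) = t n (snd (bdry R x))"
    have "(t, restrict h (indets R)) \<in> Hom (Com n (Comp n)) R (forget n Y)"
      using t h by (auto simp: Com_def forget_def map_prod_def split: prod.splits)
    from univ[OF _ this] Y obtain g where "g \<in> Hom (CCat n (Comp n)) C Y"
      "nmap_comp (base R) (trunc n C) (trunc n Y) (trunc_map n g) e1 = t" 
      "compose (indets R) (g (Suc n)) e2 = restrict h (indets R)"
      by (auto simp: comp)
    then show "\<exists>g\<in>Hom (CCat n (Comp n)) C Y. 
        nmap_comp (base R) (trunc n C) (trunc n Y) (trunc_map n g) (fst e) = t \<and>
        (\<forall>x\<in>indets R. g (Suc n) (snd e x) = h x)"
      by (intro bexI[of _ g]) (auto simp: e_eq compose_def fun_eq_iff restrict_def split: if_splits)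
  }
  {
    fix Y g g' assume Y: "n_category (Suc n) Y" "trunc n Y \<in> Obj (Comp n)"
      and g: "g \<in> Hom (CCat n (Comp n)) C Y" and g': "g' \<in> Hom (CCat n (Comp n)) C Y"
      and eq: "nmap_comp (base R) (trunc n C) (trunc n Y) (trunc_map n g) (fst e) =
      nmap_comp (base R) (trunc n C) (trunc n Y) (trunc_map n g') (fst e)"
      "\<And>x. x \<in> indets R \<Longrightarrow> g (Suc n) (snd e x) = g' (Suc n) (snd e x)"
    define f where "f = (nmap_comp (base R) (trunc n C) (trunc n Y) (trunc_map n g) e1, compose (indets R) (g (Suc n)) e2)"
    have "f \<in> Hom (Com n (Comp n)) R (forget n Y)"
    proof -
      have "nmap_comp (base R) (trunc n C) (trunc n Y) (trunc_map n g) e1 \<in> Hom (Comp n) (base R) (trunc n Y)"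
        using Comp_comp_closed[OF R _ Y(2) e1] C g by simp
      moreover have "compose (indets R) (g (Suc n)) e2 \<in> indets R \<rightarrow>\<^sub>E Cells Y (Suc n)"
        using e2 g by (auto simp: compose_def PiE_iff n_functors_cell)
      moreover have "dm Y n (g (Suc n) (e2 x)) = trunc_map n g n (e1 n (fst (bdry R x))) \<and>
          cd Y n (g (Suc n) (e2 x)) = trunc_map n g n (e1 n (snd (bdry R x)))" if "x \<in> indets R" for x
        using e3[OF that] g n_functors_dm[of g C Y "e2 x" n] n_functors_cd[of g C Y "e2 x" n] e2 that
        by (auto simp: trunc_map_def PiE_iff)
      moreover have "bdry (forget n Y) (compose (indets R) (g (Suc n)) e2 x) =
          map_prod (nmap_comp (base R) (trunc n C) (trunc n Y) (trunc_map n g) e1 n)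
            (nmap_comp (base R) (trunc n C) (trunc n Y) (trunc_map n g) e1 n) (bdry R x)"
        if "x \<in> indets R" for x
        using calculation(3)[OF that] bR[OF that] that
        by (cases "bdry R x") (simp add: forget_def compose_eq nmap_comp_apply parallel_pairs_def)
      ultimately show ?thesis
        unfolding f_def by (simp add: Com_def forget_def)
    qed
    from univ[OF _ this] Y have u: "\<exists>!g. g \<in> Hom (CCat n (Comp n)) C Y \<and>
       (nmap_comp (base R) (trunc n C) (trunc n Y) (trunc_map n g) e1, compose (indets R) (g (Suc n)) e2) = f"
      by (simp only: comp CCat_simps simp_thms)
    have 2: "(nmap_comp (base R) (trunc n C) (trunc n Y) (trunc_map n g') e1, compose (indets R) (g' (Suc n)) e2) = f"
      using eq by (auto simp: f_def e_eq compose_def restrict_def fun_eq_iff)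
    show "g = g'"
      by (rule Uniq_D[OF ex1_iff_ex_Uniq[THEN iffD1, OF u, THEN conjunct2]])
        (intro conjI g g' 2 f_def[symmetric])+
  }
qed

lemma Comp_SucI: "is_free n (Comp n) R C e \<Longrightarrow> C \<in> Obj (Comp (Suc n))"
  unfolding Comp.simps(2) by (auto simp del: split_paired_Ex)

lemma top_indetsI: "is_free n (Comp n) R C e \<Longrightarrow> x \<in> indets R \<Longrightarrow> snd e x \<in> top_indets n (Comp n) C"
  unfolding top_indets_def by (cases e) auto

section \<open>The Eckmann-Hilton argument\<close>

text \<open>The \<open>k\<close>-cells over the 0-cell \<open>p\<close> with both 1-dimensional boundaries the identity of \<open>p\<close>.  These
are the cells to which Eckmann-Hilton applies, for \<open>k = 2\<close> and, with compositions along dimensions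
0 and 1, again for \<open>k = 3\<close>.\<close>

definition loops :: "'u ncat \<Rightarrow> 'u \<Rightarrow> nat \<Rightarrow> 'u set" where
  "loops A p k = {x \<in> Cells A k. sdom A (Suc 0) k x = idn A 0 p \<and> scod A (Suc 0) k x = idn A 0 p}"

context n_category begin

lemma
  assumes p: "p \<in> Cells A 0" and k: "k = Suc (Suc 0) \<or> k = Suc (Suc (Suc 0))" and kn: "k \<le> n"
    and j: "j \<le> Suc 0"
  shows loops_composable: "x \<in> loops A p k \<Longrightarrow> y \<in> loops A p k \<Longrightarrow> composable A k j y x"
    and loops_comp: "x \<in> loops A p k \<Longrightarrow> y \<in> loops A p k \<Longrightarrow> cmp A k j y x \<in> loops A p k"
    and loops_unit: "iidn A 0 k p \<in> loops A p k"
    and loops_unit_right: "x \<in> loops A p k \<Longrightarrow> cmp A k j x (iidn A 0 k p) = x"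
    and loops_unit_left: "x \<in> loops A p k \<Longrightarrow> cmp A k j (iidn A 0 k p) x = x"
proof -
  have u: "idn A 0 p \<in> Cells A (Suc 0)" "dm A 0 (idn A 0 p) = p" "cd A 0 (idn A 0 p) = p"
    using p k kn by (auto intro!: idn_in dm_idn cd_idn)
  have uc: "composable A (Suc 0) 0 (idn A 0 p) (idn A 0 p)"
    using u by (simp add: composable_def)
  have uu: "cmp A (Suc 0) 0 (idn A 0 p) (idn A 0 p) = idn A 0 p"
    using unit_right[of 0 "Suc 0" "idn A 0 p"] u by simp
  have d: "sdom A 0 k x = p \<and> scod A 0 k x = p" if "x \<in> loops A p k" for x
    using that k u dm_glob[of x 0] cd_glob[of x 0] dm_glob[of "dm A (Suc (Suc 0)) x" 0]
      cd_glob[of "cd A (Suc (Suc 0)) x" 0] dm_in[of x "Suc (Suc 0)"] cd_in[of x "Suc (Suc 0)"]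
    by (auto simp: loops_def)
  show comp: "composable A k j y x" if "x \<in> loops A p k" "y \<in> loops A p k" for x y
    using that d[OF that(1)] d[OF that(2)] j k by (auto simp: composable_def loops_def le_Suc_eq)
  have comp2: "composable A (Suc (Suc 0)) j y x"
    "cmp A (Suc (Suc 0)) j y x \<in> loops A p (Suc (Suc 0))"
    if "x \<in> loops A p (Suc (Suc 0))" "y \<in> loops A p (Suc (Suc 0))" for x y
  proof -
    show c: "composable A (Suc (Suc 0)) j y x"
      using that j u by (auto simp: composable_def loops_def le_Suc_eq)
    show "cmp A (Suc (Suc 0)) j y x \<in> loops A p (Suc (Suc 0))"
      using that j comp_in[OF c] dm_comp[OF c] cd_comp[OF c] uu by (auto simp: loops_def le_Suc_eq)
  qed
  have bd: "dm A (Suc (Suc 0)) x \<in> loops A p (Suc (Suc 0))" "cd A (Suc (Suc 0)) x \<in> loops A p (Suc (Suc 0))"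
    if "x \<in> loops A p (Suc (Suc (Suc 0)))" for x
    using that dm_in[of x "Suc (Suc 0)"] cd_in[of x "Suc (Suc 0)"] dm_glob[of x "Suc 0"] cd_glob[of x "Suc 0"]
    by (auto simp: loops_def)
  show "cmp A k j y x \<in> loops A p k" if xy: "x \<in> loops A p k" "y \<in> loops A p k" for x y
    using k
  proof
    assume "k = Suc (Suc 0)" with xy comp2 show ?thesis by simp
  next
    assume k3: "k = Suc (Suc (Suc 0))"
    note c = comp[OF xy, unfolded k3]
    from k3 xy bd have "dm A (Suc (Suc 0)) (cmp A k j y x) \<in> loops A p (Suc (Suc 0))"
      "cd A (Suc (Suc 0)) (cmp A k j y x) \<in> loops A p (Suc (Suc 0))"
      using dm_comp[OF c] cd_comp[OF c] j comp2(2) by simp_all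
    then show ?thesis using comp_in[OF c] k3 by (auto simp: loops_def)
  qed
  show "iidn A 0 k p \<in> loops A p k"
    using k kn p u by (auto simp: loops_def idn_in dm_idn cd_idn)
  show "cmp A k j x (iidn A 0 k p) = x" "cmp A k j (iidn A 0 k p) x = x" if "x \<in> loops A p k" for x
  proof -
    have "iidn A j k (sdom A j k x) = iidn A 0 k p" "iidn A j k (scod A j k x) = iidn A 0 k p"
      using that d[OF that] j k by (auto simp: loops_def le_Suc_eq)
    then show "cmp A k j x (iidn A 0 k p) = x" "cmp A k j (iidn A 0 k p) x = x"
      using unit_right[of j k x] unit_left[of j k x] that j k by (auto simp: loops_def)
  qed
qed

text \<open>Both compositions have the same unit, and interchange with units in two of the four places turns one
composition into the other, in either order of the factors.\<close>

lemma
  assumes p: "p \<in> Cells A 0" and k: "k = Suc (Suc 0) \<or> k = Suc (Suc (Suc 0))" and kn: "k \<le> n"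
    and x: "x \<in> loops A p k" and y: "y \<in> loops A p k"
  shows Eckmann_Hilton: "cmp A k (Suc 0) y x = cmp A k 0 y x"
    and loops_commute: "cmp A k 0 y x = cmp A k 0 x y"
proof -
  note u = loops_unit[OF p k kn le_refl] and c = loops_composable[OF p k kn]
  note ul = loops_unit_left[OF p k kn] and ur = loops_unit_right[OF p k kn]
  have *: "cmp A k (Suc 0) y x = cmp A k 0 y x"
    if x: "x \<in> loops A p k" and y: "y \<in> loops A p k" for x y
    using interchange[of 0 "Suc 0" k y "iidn A 0 k p" "iidn A 0 k p" x] u x y c ul ur by simp
  show "cmp A k 0 y x = cmp A k 0 x y"
    using interchange[of 0 "Suc 0" k "iidn A 0 k p" y x "iidn A 0 k p"] u x y c ul ur *[OF y x] by simp
  show "cmp A k (Suc 0) y x = cmp A k 0 y x" using * x y by blast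
qed

end

section \<open>Products of multisets in a commutative monoid\<close>

text \<open>The guard makes the folded function commute with itself on all of \<open>'a\<close>, although \<open>f\<close> is commutative
only on \<open>S\<close>.\<close>

definition mfold :: "('a \<Rightarrow> 'a \<Rightarrow> 'a) \<Rightarrow> 'a set \<Rightarrow> ('b \<Rightarrow> 'a) \<Rightarrow> 'a \<Rightarrow> 'b multiset \<Rightarrow> 'a" where
  "mfold f S g = fold_mset (\<lambda>j a. if a \<in> S \<and> g j \<in> S then f (g j) a else a)"

locale comm_on =
  fixes f :: "'a \<Rightarrow> 'a \<Rightarrow> 'a" and S :: "'a set"
  assumes f_closed: "a \<in> S \<Longrightarrow> b \<in> S \<Longrightarrow> f a b \<in> S"
    and f_assoc: "a \<in> S \<Longrightarrow> b \<in> S \<Longrightarrow> c \<in> S \<Longrightarrow> f (f a b) c = f a (f b c)"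
    and f_commute: "a \<in> S \<Longrightarrow> b \<in> S \<Longrightarrow> f a b = f b a"
begin

lemma f_left_commute: "a \<in> S \<Longrightarrow> b \<in> S \<Longrightarrow> c \<in> S \<Longrightarrow> f a (f b c) = f b (f a c)"
  by (metis f_assoc f_commute)

lemma mfold_empty [simp]: "mfold f S g u {#} = u"
  by (simp add: mfold_def)

lemma mfold_add_aux: "mfold f S g u (add_mset j w) =
    (if mfold f S g u w \<in> S \<and> g j \<in> S then f (g j) (mfold f S g u w) else mfold f S g u w)"
proof -
  interpret comp_fun_commute "\<lambda>j a. if a \<in> S \<and> g j \<in> S then f (g j) a else a"
    by unfold_locales (auto simp: fun_eq_iff f_closed intro!: f_left_commute)
  show ?thesis by (simp add: mfold_def)
qed

lemma mfold_in: "u \<in> S \<Longrightarrow> mfold f S g u w \<in> S"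
  by (induction w) (auto simp: mfold_add_aux f_closed)

lemma mfold_add: "u \<in> S \<Longrightarrow> g j \<in> S \<Longrightarrow> mfold f S g u (add_mset j w) = f (g j) (mfold f S g u w)"
  by (simp add: mfold_add_aux mfold_in)

text \<open>The fold with initial value \<open>u\<close> is a product with an extra factor \<open>u\<close>, so that initial values multiply.\<close>

lemma mfold_plus:
  assumes "u \<in> S" "v \<in> S" "g ` set_mset (a + b) \<subseteq> S"
  shows "mfold f S g (f u v) (a + b) = f (mfold f S g u a) (mfold f S g v b)"
  using assms(3)
proof (induction a)
  case empty
  then show ?case using assms(1,2)
    by (induction b) (auto simp: mfold_add mfold_in f_closed intro: f_left_commute)
next
  case (add j a)
  then show ?case using assms(1,2) by (simp add: mfold_add mfold_in f_closed f_assoc)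
qed

end

lemma (in n_category) comm_on_loops:
  assumes p: "p \<in> Cells A 0" and k: "k = Suc (Suc 0) \<or> k = Suc (Suc (Suc 0))" and kn: "k \<le> n"
  shows "comm_on (cmp A k 0) (loops A p k)"
  using loops_comp[OF p k kn] loops_commute[OF p k kn] assoc[OF loops_composable[OF p k kn] loops_composable[OF p k kn]]
  by unfold_locales blast+

section \<open>Multisets as cells\<close>

lemma set_mset_sum: "set_mset w \<subseteq> J \<Longrightarrow> (\<And>j. j \<in> J \<Longrightarrow> set_mset (m j) \<subseteq> X) \<Longrightarrow> set_mset (\<Sum>j\<in>#w. m j) \<subseteq> (X::nat set)"
  by (induction w) auto

lemma image_mset_eq_single: "image_mset f a = {#x#} \<longleftrightarrow> (\<exists>i. a = {#i#} \<and> f i = x)"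
proof
  assume a: "image_mset f a = {#x#}"
  then have "size a = 1" by (metis size_image_mset size_single)
  with a show "\<exists>i. a = {#i#} \<and> f i = x" using size_1_singleton_mset by fastforce
qed auto

lemma image_mset_sum: "set_mset w \<subseteq> J \<Longrightarrow> (\<And>j. j \<in> J \<Longrightarrow> m' (\<beta> j) = image_mset \<alpha> (m j)) \<Longrightarrow>
   image_mset \<alpha> (\<Sum>j\<in>#w. m j) = (\<Sum>j\<in>#image_mset \<beta> w. m' j)" for m' :: "nat \<Rightarrow> nat multiset" and J :: "nat set"
  by (induction w) auto

text \<open>A 3-cell is coded by the triple of its domain \<open>a\<close>, the multiset \<open>w\<close> of 3-generators occurring in it
and its codomain \<open>b\<close>; a 2-cell \<open>a\<close> is coded like its identity, by \<open>(a, {#}, a)\<close>.  The domain is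
recorded, although it is determined by \<open>w\<close> and \<open>b\<close> and the domains of the generators, in order that
the operations be the same for all computads considered.  Two of them with the same low-dimensional
cells then have literally the same truncation.\<close>

type_synonym cell = "nat multiset \<times> nat multiset \<times> nat multiset"

locale coding =
  fixes enc :: "cell \<Rightarrow> 'u"
  assumes inj_enc: "inj enc"
begin

lemma enc_eq [simp]: "enc s = enc t \<longleftrightarrow> s = t"
  using inj_enc by (rule inj_eq)

definition dec :: "'u \<Rightarrow> cell" where "dec = inv enc"

lemma dec_enc [simp]: "dec (enc t) = t"
  unfolding dec_def using inj_enc by simp

definition pt :: 'u where "pt = enc ({#}, {#}, {#})"

text \<open>Sub-3-categories of one large 3-category: 2-cells are added, and 3-cells are added along dimensions
0 and 1 and concatenated along dimension 2, where only the multiset of generators accumulates.\<close>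

definition cells_ncat :: "nat multiset set \<Rightarrow> cell set \<Rightarrow> 'u ncat" where
  "cells_ncat S T = \<lparr>
     Cells = (\<lambda>k. if k \<le> Suc 0 then {pt} else if k = Suc (Suc 0) then (\<lambda>a. enc (a, {#}, a)) ` S
        else if k = Suc (Suc (Suc 0)) then enc ` T else {}),
     dm = (\<lambda>k z. case dec z of (a, w, b) \<Rightarrow> if k = Suc (Suc 0) then enc (a, {#}, a) else pt),
     cd = (\<lambda>k z. case dec z of (a, w, b) \<Rightarrow> if k = Suc (Suc 0) then enc (b, {#}, b) else pt),
     idn = (\<lambda>k z. z),
     cmp = (\<lambda>k j z' z. case dec z' of (a', w', b') \<Rightarrow> case dec z of (a, w, b) \<Rightarrow>
        if j = Suc (Suc 0) then enc (a, w' + w, b') else enc (a' + a, w' + w, b' + b))\<rparr>"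

lemma cells_ncat_simps [simp]:
  "Cells (cells_ncat S T) 0 = {pt}"
  "Cells (cells_ncat S T) (Suc 0) = {pt}"
  "Cells (cells_ncat S T) (Suc (Suc 0)) = (\<lambda>a. enc (a, {#}, a)) ` S"
  "Cells (cells_ncat S T) (Suc (Suc (Suc 0))) = enc ` T"
  "Cells (cells_ncat S T) (Suc (Suc (Suc (Suc k)))) = {}"
  "dm (cells_ncat S T) k (enc (a, w, b)) = (if k = Suc (Suc 0) then enc (a, {#}, a) else pt)"
  "cd (cells_ncat S T) k (enc (a, w, b)) = (if k = Suc (Suc 0) then enc (b, {#}, b) else pt)"
  "idn (cells_ncat S T) k z = z"
  "cmp (cells_ncat S T) k j (enc (a', w', b')) (enc (a, w, b)) =
     (if j = Suc (Suc 0) then enc (a, w' + w, b') else enc (a' + a, w' + w, b' + b))"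
  by (auto simp: cells_ncat_def)

lemma iidn_cells_ncat [simp]: "iidn (cells_ncat S T) j k z = z"
  by (induction k) auto

lemma pt_simps [simp]:
  "dm (cells_ncat S T) k pt = pt" "cd (cells_ncat S T) k pt = pt"
  "cmp (cells_ncat S T) k j pt (enc (a, w, b)) = (if j = Suc (Suc 0) then enc (a, w, {#}) else enc (a, w, b))"
  "cmp (cells_ncat S T) k j (enc (a, w, b)) pt = (if j = Suc (Suc 0) then enc ({#}, w, b) else enc (a, w, b))"
  "cmp (cells_ncat S T) k j pt pt = pt"
  by (auto simp: pt_def)

lemma cells_cases [consumes 1, case_names 0 1 2 3]:
  assumes "z \<in> Cells (cells_ncat S T) k"
  obtains "k = 0" "z = pt" | "k = Suc 0" "z = pt"
  | a where "k = Suc (Suc 0)" "z = enc (a, {#}, a)" "a \<in> S"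
  | a w b where "k = Suc (Suc (Suc 0))" "z = enc (a, w, b)" "(a, w, b) \<in> T"
  using assms by (auto simp: cells_ncat_def le_Suc_eq split: if_splits)

lemma composable_cases [consumes 1, case_names 1 2 3 4]:
  assumes "composable (cells_ncat S T) k j y x"
  obtains "k = Suc 0" "j = 0" "x = pt" "y = pt"
  | a a' where "k = Suc (Suc 0)" "j \<le> Suc 0" "x = enc (a, {#}, a)" "y = enc (a', {#}, a')" "a \<in> S" "a' \<in> S"
  | a w b a' w' b' where "k = Suc (Suc (Suc 0))" "j \<le> Suc 0" "x = enc (a, w, b)" "y = enc (a', w', b')"
     "(a, w, b) \<in> T" "(a', w', b') \<in> T"
  | a w b w' c where "k = Suc (Suc (Suc 0))" "j = Suc (Suc 0)" "x = enc (a, w, b)" "y = enc (b, w', c)"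
     "(a, w, b) \<in> T" "(b, w', c) \<in> T"
proof -
  have x: "x \<in> Cells (cells_ncat S T) k" and y: "y \<in> Cells (cells_ncat S T) k" and "j < k"
    and eq: "sdom (cells_ncat S T) j k y = scod (cells_ncat S T) j k x"
    using assms by (auto simp: composable_def)
  show thesis
    using x
  proof (cases rule: cells_cases)
    case 0 with \<open>j < k\<close> show ?thesis by simp
  next
    case 1
    with y \<open>j < k\<close> show ?thesis by (intro that(1)) auto
  next
    case (2 a)
    with y \<open>j < k\<close> that(2)[of a] show ?thesis by auto
  next
    case (3 a w b)
    with y obtain a' w' b' where y': "y = enc (a', w', b')" "(a', w', b') \<in> T" by auto
    show ?thesis
    proof (cases "j \<le> Suc 0")
      case True
      with 3 y' show ?thesis by (intro that(3)[of a w b a' w' b']) auto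
    next
      case False
      with \<open>j < k\<close> 3 have "j = Suc (Suc 0)" by simp
      with eq 3 y' show ?thesis by (intro that(4)[of a w b w' b']) auto
    qed
  qed
qed

lemma composableI:
  "a \<in> S \<Longrightarrow> a' \<in> S \<Longrightarrow> j \<le> Suc 0 \<Longrightarrow>
    composable (cells_ncat S T) (Suc (Suc 0)) j (enc (a', {#}, a')) (enc (a, {#}, a))"
  "(a, w, b) \<in> T \<Longrightarrow> (a', w', b') \<in> T \<Longrightarrow> j \<le> Suc 0 \<Longrightarrow>
    composable (cells_ncat S T) (Suc (Suc (Suc 0))) j (enc (a', w', b')) (enc (a, w, b))"
  "(a, w, b) \<in> T \<Longrightarrow> (b, w', c) \<in> T \<Longrightarrow>
    composable (cells_ncat S T) (Suc (Suc (Suc 0))) (Suc (Suc 0)) (enc (b, w', c)) (enc (a, w, b))"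
  by (auto simp: composable_def)

text \<open>Closure of the chosen cells under the operations of the ambient 3-category.\<close>

definition closed_cells :: "nat multiset set \<Rightarrow> cell set \<Rightarrow> bool" where
  "closed_cells S T \<longleftrightarrow> {#} \<in> S \<and> (\<forall>a\<in>S. \<forall>b\<in>S. a + b \<in> S) \<and>
     (\<forall>a w b. (a, w, b) \<in> T \<longrightarrow> a \<in> S \<and> b \<in> S) \<and> (\<forall>a\<in>S. (a, {#}, a) \<in> T) \<and>
     (\<forall>a w b a' w' b'. (a, w, b) \<in> T \<longrightarrow> (a', w', b') \<in> T \<longrightarrow> (a + a', w + w', b + b') \<in> T) \<and>
     (\<forall>a w b w' c. (a, w, b) \<in> T \<longrightarrow> (b, w', c) \<in> T \<longrightarrow> (a, w + w', c) \<in> T)"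

lemma n_category_cells_ncat:
  assumes "closed_cells S T"
  shows "n_category (Suc (Suc (Suc 0))) (cells_ncat S T)"
proof -
  have S0: "{#} \<in> S" and Sp: "\<And>a b. a \<in> S \<Longrightarrow> b \<in> S \<Longrightarrow> a + b \<in> S"
    and TS: "\<And>a w b. (a, w, b) \<in> T \<Longrightarrow> a \<in> S" "\<And>a w b. (a, w, b) \<in> T \<Longrightarrow> b \<in> S"
    and T0: "\<And>a. a \<in> S \<Longrightarrow> (a, {#}, a) \<in> T"
    and Tp: "\<And>a w b a' w' b'. (a, w, b) \<in> T \<Longrightarrow> (a', w', b') \<in> T \<Longrightarrow> (a + a', w + w', b + b') \<in> T"
    and Tc: "\<And>a w b w' c. (a, w, b) \<in> T \<Longrightarrow> (b, w', c) \<in> T \<Longrightarrow> (a, w + w', c) \<in> T"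
    using assms unfolding closed_cells_def by blast+
  have Tc': "\<And>a w b w' c. (a, w, b) \<in> T \<Longrightarrow> (b, w', c) \<in> T \<Longrightarrow> (a, w' + w, c) \<in> T"
    using Tc by (metis add.commute)
  note [simp] = S0 Sp TS T0 Tp Tc'
  show ?thesis
  proof
    show "Cells (cells_ncat S T) k = {}" if "Suc (Suc (Suc 0)) < k" for k
      using that by (auto simp: cells_ncat_def)
    show "dm (cells_ncat S T) k x \<in> Cells (cells_ncat S T) k" "cd (cells_ncat S T) k x \<in> Cells (cells_ncat S T) k"
      if "x \<in> Cells (cells_ncat S T) (Suc k)" for k x
      using that by (cases rule: cells_cases; auto)+
    show "dm (cells_ncat S T) k (dm (cells_ncat S T) (Suc k) x) = dm (cells_ncat S T) k (cd (cells_ncat S T) (Suc k) x)"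
      "cd (cells_ncat S T) k (dm (cells_ncat S T) (Suc k) x) = cd (cells_ncat S T) k (cd (cells_ncat S T) (Suc k) x)"
      if "x \<in> Cells (cells_ncat S T) (Suc (Suc k))" for k x
      using that by (cases rule: cells_cases; auto)+
    show "idn (cells_ncat S T) k x \<in> Cells (cells_ncat S T) (Suc k)"
      "dm (cells_ncat S T) k (idn (cells_ncat S T) k x) = x" "cd (cells_ncat S T) k (idn (cells_ncat S T) k x) = x"
      if "k < Suc (Suc (Suc 0))" "x \<in> Cells (cells_ncat S T) k" for k x
      using that(2,1) by (cases rule: cells_cases; auto simp: image_iff pt_def; fail)+
    show "cmp (cells_ncat S T) k j y x \<in> Cells (cells_ncat S T) k" if "composable (cells_ncat S T) k j y x" for k j y x
      using that by (cases rule: composable_cases) auto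
    show "dm (cells_ncat S T) k (cmp (cells_ncat S T) (Suc k) j y x) = (if j = k then dm (cells_ncat S T) k x
         else cmp (cells_ncat S T) k j (dm (cells_ncat S T) k y) (dm (cells_ncat S T) k x))"
      "cd (cells_ncat S T) k (cmp (cells_ncat S T) (Suc k) j y x) = (if j = k then cd (cells_ncat S T) k y
         else cmp (cells_ncat S T) k j (cd (cells_ncat S T) k y) (cd (cells_ncat S T) k x))"
      if "composable (cells_ncat S T) (Suc k) j y x" for k j y x
      using that by (cases rule: composable_cases; auto)+
    show "cmp (cells_ncat S T) k j (cmp (cells_ncat S T) k j z y) x = cmp (cells_ncat S T) k j z (cmp (cells_ncat S T) k j y x)"
      if "composable (cells_ncat S T) k j z y" "composable (cells_ncat S T) k j y x" for k j z y x
      using that by (elim composable_cases; auto simp: ac_simps)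
    show "cmp (cells_ncat S T) k j x (iidn (cells_ncat S T) j k (sdom (cells_ncat S T) j k x)) = x"
      "cmp (cells_ncat S T) k j (iidn (cells_ncat S T) j k (scod (cells_ncat S T) j k x)) x = x"
      if "j < k" "x \<in> Cells (cells_ncat S T) k" for j k x
      using that(2,1) by (cases rule: cells_cases; auto simp: less_Suc_eq)+
    show "idn (cells_ncat S T) k (cmp (cells_ncat S T) k j y x) = cmp (cells_ncat S T) (Suc k) j (idn (cells_ncat S T) k y) (idn (cells_ncat S T) k x)"
      if "k < Suc (Suc (Suc 0))" "composable (cells_ncat S T) k j y x" for k j x y
      using that(2,1) by (cases rule: composable_cases) auto
    show "cmp (cells_ncat S T) k i (cmp (cells_ncat S T) k j y' y) (cmp (cells_ncat S T) k j x' x) =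
        cmp (cells_ncat S T) k j (cmp (cells_ncat S T) k i y' x') (cmp (cells_ncat S T) k i y x)"
      if "i < j" "composable (cells_ncat S T) k j y' y" "composable (cells_ncat S T) k j x' x"
      for k i j x x' y y'
      using that by (elim composable_cases; auto simp: ac_simps)
  qed
qed

text \<open>The 3-cells generated by \<open>\<zeta>\<^sub>j : m j \<rightarrow> 0\<close> for \<open>j \<in> J\<close>: the cell coded by \<open>w\<close> and \<open>b\<close> is the sum of all
generators in \<open>w\<close> and the identity of \<open>b\<close>.\<close>

definition free_cells :: "nat set \<Rightarrow> nat set \<Rightarrow> (nat \<Rightarrow> nat multiset) \<Rightarrow> cell set" where
  "free_cells X J m = {(b + (\<Sum>j\<in>#w. m j), w, b) |b w. set_mset b \<subseteq> X \<and> set_mset w \<subseteq> J}"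

definition computad :: "nat set \<Rightarrow> nat set \<Rightarrow> (nat \<Rightarrow> nat multiset) \<Rightarrow> 'u ncat" where
  "computad X J m = cells_ncat {a. set_mset a \<subseteq> X} (free_cells X J m)"

lemma free_cells_iff [simp]:
  "(a, w, b) \<in> free_cells X J m \<longleftrightarrow>
     a = b + (\<Sum>j\<in>#w. m j) \<and> set_mset b \<subseteq> X \<and> set_mset w \<subseteq> J"
  by (auto simp: free_cells_def)

lemma closed_free_cells:
  assumes "\<And>j. j \<in> J \<Longrightarrow> set_mset (m j) \<subseteq> X"
  shows "closed_cells {a. set_mset a \<subseteq> X} (free_cells X J m)"
proof -
  have "set_mset (\<Sum>j\<in>#w. m j) \<subseteq> X" if "set_mset w \<subseteq> J" for w
    using that by (rule set_mset_sum) (rule assms)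
  then show ?thesis
    unfolding closed_cells_def free_cells_iff by (simp add: ac_simps)
qed

lemma n_category_computad:
  assumes "\<And>j. j \<in> J \<Longrightarrow> set_mset (m j) \<subseteq> X"
  shows "n_category (Suc (Suc (Suc 0))) (computad X J m)"
  unfolding computad_def by (intro n_category_cells_ncat closed_free_cells assms)

section \<open>Freeness\<close>

abbreviation gen2 :: "nat \<Rightarrow> 'u" where "gen2 x \<equiv> enc ({#x#}, {#}, {#x#})"
abbreviation gen3 :: "(nat \<Rightarrow> nat multiset) \<Rightarrow> nat \<Rightarrow> 'u" where "gen3 m j \<equiv> enc (m j, {#j#}, {#})"

text \<open>In dimensions 0 and 1 there are only the vertex and its identity, whatever the higher cells are.\<close>

lemma trunc1_cells_ncat: "trunc (Suc 0) (cells_ncat S T) = trunc (Suc 0) (cells_ncat S' T')"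
  by (auto simp: trunc_def cells_ncat_def fun_eq_iff)

lemma is_free_level1:
  assumes "closed_cells S T"
  defines "B \<equiv> trunc (Suc 0) (cells_ncat S T)"
  shows "is_free 0 (Comp 0) (gen_com 0 B {}) B (gen_unit 0 B {})"
proof (rule is_freeI)
  have B1: "n_category (Suc 0) B" 
    unfolding B_def by (rule n_category_trunc[OF n_category_cells_ncat[OF assms(1)]]) simp
  then show "B \<in> Obj (CCat 0 (Comp 0))"
    using n_category_trunc[OF B1, of 0] by (simp add: NCat_def)
  have cmp: "j = 0 \<and> x = pt \<and> y = pt" if "composable B (Suc 0) j y x" for j x y
    using that by (simp add: B_def composable_def)
  have idn: "x = pt" if "x \<in> Cells B 0" for x using that by (simp add: B_def)
  { fix Y t h assume Y: "n_category (Suc 0) (Y::'u ncat)" "t \<in> Hom (Comp 0) (trunc 0 B) (trunc 0 Y)"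
    interpret Y: n_category "Suc 0" Y by fact
    from Y have t: "t \<in> n_functors (trunc 0 B) (trunc 0 Y)" by (simp add: NCat_def)
    have tp: "t 0 pt \<in> Cells Y 0" using n_functors_cell[OF t, of pt 0] by (simp add: B_def)
    have tp1: "idn Y 0 (t 0 pt) \<in> Cells Y (Suc 0)" using Y.idn_in[OF _ tp] by simp
    define g where "g = ext_map 0 t (\<lambda>x\<in>{pt}. idn Y 0 (t 0 pt))"
    have "g \<in> n_functors B Y" unfolding g_def
    proof (rule ext_map_functor[OF B1 t])
      fix j y x assume "composable B (Suc 0) j y x"
      then have "j = 0 \<and> x = pt \<and> y = pt" by (rule cmp)
      then show "(\<lambda>x\<in>{pt}. idn Y 0 (t 0 pt)) (cmp B (Suc 0) j y x) =
          cmp Y (Suc 0) j ((\<lambda>x\<in>{pt}. idn Y 0 (t 0 pt)) y) ((\<lambda>x\<in>{pt}. idn Y 0 (t 0 pt)) x)"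
        using tp tp1 Y.unit_right[OF _ tp1, of 0] by (simp add: B_def Y.dm_idn)
    qed (use tp tp1 in \<open>auto simp: B_def Y.dm_idn Y.cd_idn\<close>)
    then show "\<exists>g\<in>n_functors B Y. trunc_map 0 g = t \<and> (\<forall>x\<in>{}. g (Suc 0) x = h x)"
      using trunc_ext_map[OF t] by (auto simp: g_def) }
  { fix Y g g' assume g: "g \<in> n_functors B Y" "g' \<in> n_functors B Y" "trunc_map 0 g = trunc_map 0 g'"
    show "g = g'"
    proof (rule n_functors_eq_top[OF B1 g])
      fix x assume "x \<in> Cells B (Suc 0)"
      then have x: "x = idn B 0 pt" by (simp add: B_def)
      have "pt \<in> Cells B 0" "idn B 0 pt \<in> Cells B (Suc 0)" by (simp_all add: B_def)
      then show "g (Suc 0) x = g' (Suc 0) x"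
        using n_functors_idn[OF g(1)] n_functors_idn[OF g(2)] x trunc_map_eqD[OF g(3), of 0] by simp
    qed }
qed simp

lemma trunc1_Comp:
  assumes "closed_cells S T" shows "trunc (Suc 0) (cells_ncat S T) \<in> Obj (Comp (Suc 0))"
  by (rule Comp_SucI[OF is_free_level1[OF assms]])

text \<open>A 2-functor out of the multisets has to send a multiset to the product of the images of its elements
in the commutative monoid of loops, and Eckmann-Hilton makes this product functorial for both
compositions.\<close>

lemma is_free_level2:
  assumes "closed_cells {a. set_mset a \<subseteq> X} T"
  defines "B \<equiv> trunc (Suc (Suc 0)) (cells_ncat {a. set_mset a \<subseteq> X} T)"
  shows "is_free (Suc 0) (Comp (Suc 0)) (gen_com (Suc 0) B (gen2 ` X)) B (gen_unit (Suc 0) B (gen2 ` X))"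
proof (rule is_freeI)
  have B2: "n_category (Suc (Suc 0)) B" 
    unfolding B_def by (rule n_category_trunc[OF n_category_cells_ncat[OF assms(1)]]) simp
  then show "B \<in> Obj (CCat (Suc 0) (Comp (Suc 0)))"
    using trunc1_Comp[OF assms(1)] by (simp add: B_def del: Comp.simps)
  have cmp: thesis if "composable B (Suc (Suc 0)) j y x"
    "\<And>a a'. \<lbrakk>j \<le> Suc 0; x = enc (a, {#}, a); y = enc (a', {#}, a'); set_mset a \<subseteq> X; set_mset a' \<subseteq> X\<rbrakk> \<Longrightarrow> thesis" 
    for j x y thesis
    using that by (auto simp: B_def elim!: composable_cases)
  have cells: thesis if "z \<in> Cells B (Suc (Suc 0))" "\<And>a. z = enc (a, {#}, a) \<Longrightarrow> set_mset a \<subseteq> X \<Longrightarrow> thesis" for z thesis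
    using that by (auto simp: B_def)
  show "gen2 ` X \<subseteq> Cells B (Suc (Suc 0))" by (auto simp: B_def)
  { fix Y t h assume Y: "n_category (Suc (Suc 0)) (Y::'u ncat)"
      and "t \<in> Hom (Comp (Suc 0)) (trunc (Suc 0) B) (trunc (Suc 0) Y)"
      and h: "\<And>x. x \<in> gen2 ` X \<Longrightarrow> h x \<in> Cells Y (Suc (Suc 0))"
        "\<And>x. x \<in> gen2 ` X \<Longrightarrow> dm Y (Suc 0) (h x) = t (Suc 0) (dm B (Suc 0) x)"
        "\<And>x. x \<in> gen2 ` X \<Longrightarrow> cd Y (Suc 0) (h x) = t (Suc 0) (cd B (Suc 0) x)"
    then have t: "t \<in> n_functors (trunc (Suc 0) B) (trunc (Suc 0) Y)" by (intro Comp_n_functor)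
    interpret Y: n_category "Suc (Suc 0)" Y by fact
    define p where "p = t 0 pt"
    have p: "p \<in> Cells Y 0" using n_functors_cell[OF t, of pt 0] by (simp add: B_def p_def)
    have t1: "t (Suc 0) pt = idn Y 0 p"
      using n_functors_idn[OF t, of pt 0] by (simp add: B_def p_def)
    define L where "L = loops Y p (Suc (Suc 0))"
    interpret comm_on "cmp Y (Suc (Suc 0)) 0" L
      unfolding L_def by (rule Y.comm_on_loops[OF p]) simp_all
    define U where "U = iidn Y 0 (Suc (Suc 0)) p"
    have U: "U \<in> L" "\<And>x. x \<in> L \<Longrightarrow> cmp Y (Suc (Suc 0)) 0 U x = x"
      unfolding U_def L_def using Y.loops_unit[OF p, of "Suc (Suc 0)" 0] Y.loops_unit_left[OF p, of "Suc (Suc 0)" 0] by auto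
    have hL: "h (gen2 x) \<in> L" if "x \<in> X" for x
      using h(1)[of "gen2 x"] h(2)[of "gen2 x"] h(3)[of "gen2 x"] that t1 by (auto simp: L_def loops_def B_def)
    define F where "F = mfold (cmp Y (Suc (Suc 0)) 0) L (h \<circ> gen2) U"
    have FL: "F a \<in> L" for a unfolding F_def by (rule mfold_in[OF U(1)])
    have FC: "F a \<in> Cells Y (Suc (Suc 0))" "dm Y (Suc 0) (F a) = idn Y 0 p" "cd Y (Suc 0) (F a) = idn Y 0 p" for a
      using FL[of a] by (auto simp: L_def loops_def)
    define H where "H = restrict (\<lambda>z. case dec z of (a, w, b) \<Rightarrow> F a) (Cells B (Suc (Suc 0)))"
    have H: "H (enc (a, {#}, a)) = F a" if "set_mset a \<subseteq> X" for a
      using that by (simp add: H_def B_def)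
    define g where "g = ext_map (Suc 0) t H"
    have "g \<in> n_functors B Y" unfolding g_def
    proof (rule ext_map_functor[OF B2 t])
      show "H \<in> Cells B (Suc (Suc 0)) \<rightarrow>\<^sub>E Cells Y (Suc (Suc 0))"
        using FC by (auto simp: H_def split: prod.splits)
      show "dm Y (Suc 0) (H z) = t (Suc 0) (dm B (Suc 0) z)" "cd Y (Suc 0) (H z) = t (Suc 0) (cd B (Suc 0) z)"
        if "z \<in> Cells B (Suc (Suc 0))" for z
        using that by (rule cells; simp add: H FC B_def t1)+
      show "H (idn B (Suc 0) z) = idn Y (Suc 0) (t (Suc 0) z)" if "z \<in> Cells B (Suc 0)" for z
      proof -
        from that have "z = pt" by (simp add: B_def)
        then show ?thesis using H[of "{#}"] by (simp add: B_def pt_def[symmetric] t1 F_def U_def)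
      qed
      show "H (cmp B (Suc (Suc 0)) j y x) = cmp Y (Suc (Suc 0)) j (H y) (H x)" if "composable B (Suc (Suc 0)) j y x" for j y x
        using that
      proof (rule cmp)
        fix a a' assume *: "j \<le> Suc 0" "x = enc (a, {#}, a)" "y = enc (a', {#}, a')" "set_mset a \<subseteq> X" "set_mset a' \<subseteq> X"
        have "F (a' + a) = cmp Y (Suc (Suc 0)) 0 (F a') (F a)"
          unfolding F_def using mfold_plus[OF U(1) U(1), of "h \<circ> gen2" a' a] * hL U by auto
        also have "\<dots> = cmp Y (Suc (Suc 0)) j (F a') (F a)"
          using Y.Eckmann_Hilton[OF p _ _ FL[of a, unfolded L_def] FL[of a', unfolded L_def]] *(1)
          by (auto simp: le_Suc_eq)
        finally show "H (cmp B (Suc (Suc 0)) j y x) = cmp Y (Suc (Suc 0)) j (H y) (H x)"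
          using * by (simp add: B_def H)
      qed
    qed
    moreover have "g (Suc (Suc 0)) x = h x" if "x \<in> gen2 ` X" for x
    proof -
      from that obtain i where i: "x = gen2 i" "i \<in> X" by auto
      have "F {#i#} = cmp Y (Suc (Suc 0)) 0 (h (gen2 i)) U"
        unfolding F_def using mfold_add[OF U(1), of "h \<circ> gen2" i "{#}"] hL[OF i(2)] by simp
      also have "\<dots> = h x" using U hL[OF i(2)] i f_commute by metis
      finally show ?thesis using i by (simp add: g_def ext_map_def H)
    qed
    ultimately show "\<exists>g\<in>n_functors B Y. trunc_map (Suc 0) g = t \<and> (\<forall>x\<in>gen2 ` X. g (Suc (Suc 0)) x = h x)"
      using trunc_ext_map[OF t] by (intro bexI[of _ g]) (auto simp: g_def) }
  { fix Y g g' assume g: "g \<in> n_functors B Y" "g' \<in> n_functors B Y" "trunc_map (Suc 0) g = trunc_map (Suc 0) g'"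
     and gen: "\<And>x. x \<in> gen2 ` X \<Longrightarrow> g (Suc (Suc 0)) x = g' (Suc (Suc 0)) x"
    show "g = g'"
    proof (rule n_functors_eq_top[OF B2 g])
      fix z assume "z \<in> Cells B (Suc (Suc 0))"
      then show "g (Suc (Suc 0)) z = g' (Suc (Suc 0)) z"
      proof (rule cells)
        fix a assume "z = enc (a, {#}, a)" "set_mset a \<subseteq> X"
        moreover have "g (Suc (Suc 0)) (enc (a, {#}, a)) = g' (Suc (Suc 0)) (enc (a, {#}, a))" if "set_mset a \<subseteq> X"
          using that
        proof (induction a)
          case empty
          have "pt \<in> Cells B (Suc 0)" "idn B (Suc 0) pt \<in> Cells B (Suc (Suc 0))" 
            "idn B (Suc 0) pt = enc ({#}, {#}, {#})" by (simp_all add: B_def pt_def)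
          then show ?case
            using n_functors_idn[OF g(1), of pt "Suc 0"] n_functors_idn[OF g(2), of pt "Suc 0"]
             trunc_map_eqD[OF g(3), of "Suc 0"] by simp
        next
          case (add x a)
          then have c: "composable B (Suc (Suc 0)) 0 (gen2 x) (enc (a, {#}, a))"
            by (simp add: B_def composableI)
          have "cmp B (Suc (Suc 0)) 0 (gen2 x) (enc (a, {#}, a)) = enc (add_mset x a, {#}, add_mset x a)"
            by (simp add: B_def)
          then show ?case using add n_functors_cmp[OF g(1) c] n_functors_cmp[OF g(2) c] gen by simp
        qed
        ultimately show ?thesis by simp
      qed
    qed }
qed

lemma trunc2_Comp:
  assumes "closed_cells {a. set_mset a \<subseteq> X} T"
  shows "trunc (Suc (Suc 0)) (cells_ncat {a. set_mset a \<subseteq> X} T) \<in> Obj (Comp (Suc (Suc 0)))"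
  by (rule Comp_SucI[OF is_free_level2[OF assms]])

text \<open>The extension \<open>F w b\<close> of a map on generators is the product, in the commutative monoid of 3-dimensional
loops, of the images of the generators in \<open>w\<close> and the identity of the image of \<open>b\<close>.  Compatibility
with composition along dimension 2 depends on the shape of the generators: since their codomain is 0,
interchange allows a generator fired later to be moved to the side of everything
fired before it (\<open>Fcomp\<close>).\<close>

lemma is_free_level3:
  assumes m: "\<And>j. j \<in> J \<Longrightarrow> set_mset (m j) \<subseteq> X"
  defines "B \<equiv> computad X J m"
  shows "is_free (Suc (Suc 0)) (Comp (Suc (Suc 0))) (gen_com (Suc (Suc 0)) B (gen3 m ` J)) B
    (gen_unit (Suc (Suc 0)) B (gen3 m ` J))"
proof (rule is_freeI)
  have msum: "set_mset (\<Sum>j\<in>#w. m j) \<subseteq> X" if "set_mset w \<subseteq> J" for w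
    using that by (rule set_mset_sum) (rule m)
  have B3: "n_category (Suc (Suc (Suc 0))) B" unfolding B_def by (rule n_category_computad[OF m])
  then show "B \<in> Obj (CCat (Suc (Suc 0)) (Comp (Suc (Suc 0))))"
    using trunc2_Comp[OF closed_free_cells[of J m X, OF m]] by (simp add: B_def computad_def del: Comp.simps)
  have cells: thesis if "z \<in> Cells B (Suc (Suc (Suc 0)))"
    "\<And>w b. z = enc (b + (\<Sum>j\<in>#w. m j), w, b) \<Longrightarrow> set_mset b \<subseteq> X \<Longrightarrow> set_mset w \<subseteq> J \<Longrightarrow> thesis" for z thesis
    using that by (auto simp: B_def computad_def)
  have in3: "enc (b + (\<Sum>j\<in>#w. m j), w, b) \<in> Cells B (Suc (Suc (Suc 0)))" if "set_mset b \<subseteq> X" "set_mset w \<subseteq> J" for w b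
    using that by (auto simp: B_def computad_def)
  show "gen3 m ` J \<subseteq> Cells B (Suc (Suc (Suc 0)))" using in3[of "{#}" "{#_#}"] by auto
  { fix Y t h assume Y: "n_category (Suc (Suc (Suc 0))) (Y::'u ncat)"
      and "t \<in> Hom (Comp (Suc (Suc 0))) (trunc (Suc (Suc 0)) B) (trunc (Suc (Suc 0)) Y)"
      and h: "\<And>x. x \<in> gen3 m ` J \<Longrightarrow> h x \<in> Cells Y (Suc (Suc (Suc 0)))"
        "\<And>x. x \<in> gen3 m ` J \<Longrightarrow> dm Y (Suc (Suc 0)) (h x) = t (Suc (Suc 0)) (dm B (Suc (Suc 0)) x)"
        "\<And>x. x \<in> gen3 m ` J \<Longrightarrow> cd Y (Suc (Suc 0)) (h x) = t (Suc (Suc 0)) (cd B (Suc (Suc 0)) x)"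
    then have t: "t \<in> n_functors (trunc (Suc (Suc 0)) B) (trunc (Suc (Suc 0)) Y)" by (intro Comp_n_functor)
    interpret Y: n_category "Suc (Suc (Suc 0))" Y by fact
    define p where "p = t 0 pt"
    have p: "p \<in> Cells Y 0" using n_functors_cell[OF t, of pt 0] by (simp add: B_def computad_def p_def)
    have t1: "t (Suc 0) pt = idn Y 0 p"
      using n_functors_idn[OF t, of pt 0] by (simp add: B_def computad_def p_def)
    define L where "L = loops Y p (Suc (Suc (Suc 0)))"
    define L2 where "L2 = loops Y p (Suc (Suc 0))"
    interpret comm_on "cmp Y (Suc (Suc (Suc 0))) 0" L
      unfolding L_def by (rule Y.comm_on_loops[OF p]) simp_all
    define I where "I b = idn Y (Suc (Suc 0)) (t (Suc (Suc 0)) (enc (b, {#}, b)))" for b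
    have t2L: "t (Suc (Suc 0)) (enc (b, {#}, b)) \<in> L2" if "set_mset b \<subseteq> X" for b
      using that n_functors_cell[OF t, of "enc (b, {#}, b)" "Suc (Suc 0)"]
        n_functors_dm[OF t, of "enc (b, {#}, b)" "Suc 0"] n_functors_cd[OF t, of "enc (b, {#}, b)" "Suc 0"] t1
      by (simp add: L2_def loops_def B_def computad_def)
    have IL: "I b \<in> L" if "set_mset b \<subseteq> X" for b
      using t2L[OF that] by (simp add: I_def L2_def L_def loops_def Y.idn_in Y.dm_idn Y.cd_idn)
    have t2add: "t (Suc (Suc 0)) (enc (b' + b, {#}, b' + b)) =
       cmp Y (Suc (Suc 0)) 0 (t (Suc (Suc 0)) (enc (b', {#}, b'))) (t (Suc (Suc 0)) (enc (b, {#}, b)))"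
      if "set_mset b \<subseteq> X" "set_mset b' \<subseteq> X" for b b'
      using that n_functors_cmp[OF t, of "Suc (Suc 0)" 0 "enc (b', {#}, b')" "enc (b, {#}, b)"]
      by (simp add: B_def computad_def composableI)
    have Iadd: "I (b' + b) = cmp Y (Suc (Suc (Suc 0))) 0 (I b') (I b)" if "set_mset b \<subseteq> X" "set_mset b' \<subseteq> X" for b b'
      unfolding I_def t2add[OF that]
      by (intro Y.idn_comp Y.loops_composable[OF p] t2L[unfolded L2_def] that) simp_all
    have U: "t (Suc (Suc 0)) (enc ({#}, {#}, {#})) = iidn Y 0 (Suc (Suc 0)) p"
      using n_functors_idn[OF t, of pt "Suc 0"] t1 by (simp add: B_def computad_def pt_def)
    have I0: "I {#} = iidn Y 0 (Suc (Suc (Suc 0))) p" by (simp add: I_def U)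
    have hL: "h (gen3 m j) \<in> L" "dm Y (Suc (Suc 0)) (h (gen3 m j)) = t (Suc (Suc 0)) (enc (m j, {#}, m j))"
      "cd Y (Suc (Suc 0)) (h (gen3 m j)) = t (Suc (Suc 0)) (enc ({#}, {#}, {#}))" if "j \<in> J" for j
    proof -
      show 1: "dm Y (Suc (Suc 0)) (h (gen3 m j)) = t (Suc (Suc 0)) (enc (m j, {#}, m j))"
        "cd Y (Suc (Suc 0)) (h (gen3 m j)) = t (Suc (Suc 0)) (enc ({#}, {#}, {#}))"
        using h(2)[of "gen3 m j"] h(3)[of "gen3 m j"] that by (simp_all add: B_def computad_def)
      show "h (gen3 m j) \<in> L"
        using h(1)[of "gen3 m j"] that 1 t2L[OF m[OF that]] t2L[of "{#}"] by (simp add: L_def L2_def loops_def)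
    qed
    define F where "F w b = mfold (cmp Y (Suc (Suc (Suc 0))) 0) L (h \<circ> gen3 m) (I b) w" for w b
    have FL: "F w b \<in> L" if "set_mset b \<subseteq> X" for w b unfolding F_def by (rule mfold_in[OF IL[OF that]])
    have F0: "F {#} b = I b" for b by (simp add: F_def)
    have Fadd: "F (add_mset j w) b = cmp Y (Suc (Suc (Suc 0))) 0 (h (gen3 m j)) (F w b)"
      if "set_mset b \<subseteq> X" "j \<in> J" for j w b
      unfolding F_def using mfold_add[OF IL[OF that(1)], of "h \<circ> gen3 m" j w] hL(1)[OF that(2)] by simp
    have Fplus: "F (w' + w) (b' + b) = cmp Y (Suc (Suc (Suc 0))) 0 (F w' b') (F w b)"
      if "set_mset b \<subseteq> X" "set_mset b' \<subseteq> X" "set_mset w \<subseteq> J" "set_mset w' \<subseteq> J" for w' w b b'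
    proof -
      have "(h \<circ> gen3 m) ` set_mset (w' + w) \<subseteq> L" using hL(1) that by auto
      from mfold_plus[OF IL[OF that(2)] IL[OF that(1)] this] show ?thesis
        unfolding F_def Iadd[OF that(1,2)] .
    qed
    have cL: "composable Y (Suc (Suc (Suc 0))) j y x" if "x \<in> L" "y \<in> L" "j \<le> Suc 0" for x y j
      using Y.loops_composable[OF p, of "Suc (Suc (Suc 0))"] that by (simp add: L_def)
    have Fbd: "dm Y (Suc (Suc 0)) (F w b) = t (Suc (Suc 0)) (enc (b + (\<Sum>j\<in>#w. m j), {#}, b + (\<Sum>j\<in>#w. m j))) \<and>
       cd Y (Suc (Suc 0)) (F w b) = t (Suc (Suc 0)) (enc (b, {#}, b))" if "set_mset b \<subseteq> X" "set_mset w \<subseteq> J" for w b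
      using that(2)
    proof (induction w)
      case empty
      have "t (Suc (Suc 0)) (enc (b, {#}, b)) \<in> Cells Y (Suc (Suc 0))" using t2L[OF that(1)] by (simp add: L2_def loops_def)
      then show ?case by (simp add: F0 I_def Y.dm_idn Y.cd_idn)
    next
      case (add j w)
      then have j: "j \<in> J" and w: "set_mset w \<subseteq> J" by auto
      have bw: "set_mset (b + (\<Sum>j\<in>#w. m j)) \<subseteq> X" using msum[OF w] that(1) by simp
      note c = cL[OF FL[OF that(1), of w] hL(1)[OF j], of 0]
      have "cmp Y (Suc (Suc 0)) 0 (iidn Y 0 (Suc (Suc 0)) p) (t (Suc (Suc 0)) (enc (b, {#}, b))) = t (Suc (Suc 0)) (enc (b, {#}, b))"
        by (rule Y.loops_unit_left[OF p]) (use t2L[OF that(1)] in \<open>simp_all add: L2_def\<close>)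
      then show ?case
        using Y.dm_comp[OF c] Y.cd_comp[OF c] add.IH[OF w] Fadd[OF that(1) j] hL(2,3)[OF j] t2add[OF bw m[OF j]] U
        by (simp add: ac_simps)
    qed
    (* Firing w first and w' afterwards is firing both at once. *)
    have Fcomp: "F (w' + w) b' = cmp Y (Suc (Suc (Suc 0))) (Suc (Suc 0)) (F w' b') (F w (b' + (\<Sum>j\<in>#w'. m j)))"
      if b: "set_mset b' \<subseteq> X" and w: "set_mset w \<subseteq> J" and w': "set_mset w' \<subseteq> J" for w w' b'
      using w'
    proof (induction w')
      case empty
      have "F w b' \<in> Cells Y (Suc (Suc (Suc 0)))" using FL[OF b] by (simp add: L_def loops_def)
      from Y.unit_left[OF _ this, of "Suc (Suc 0)"] show ?case
        using Fbd[OF b w] by (simp add: F0 I_def)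
    next
      case (add j w')
      then have j: "j \<in> J" and w': "set_mset w' \<subseteq> J" by auto
      define c where "c = b' + (\<Sum>j\<in>#w'. m j)"
      have cX: "set_mset c \<subseteq> X" unfolding c_def using msum[OF w'] b by simp
      (* The generator j to be fired last leaves its domain untouched until then. *)
      have 1: "F w (m j + c) = cmp Y (Suc (Suc (Suc 0))) 0 (I (m j)) (F w c)"
        using Fplus[of c "m j" w "{#}"] cX m[OF j] w F0 by simp
      have mc: "set_mset (m j) \<subseteq> X" using m[OF j] .
      have A: "composable Y (Suc (Suc (Suc 0))) (Suc (Suc 0)) (h (gen3 m j)) (I (m j))"
        using hL[OF j] Fbd[OF mc, of "{#}"] IL[OF mc] by (simp add: composable_def F0 L_def loops_def)
      have C: "composable Y (Suc (Suc (Suc 0))) (Suc (Suc 0)) (F w' b') (F w c)"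
        using FL[OF b, of w'] FL[OF cX, of w] Fbd[OF b w'] Fbd[OF cX w]
        by (simp add: composable_def L_def loops_def c_def)
      have "h (gen3 m j) = cmp Y (Suc (Suc (Suc 0))) (Suc (Suc 0)) (h (gen3 m j)) (I (m j))"
        using Y.unit_right[of "Suc (Suc 0)" "Suc (Suc (Suc 0))" "h (gen3 m j)"] hL[OF j] 
        by (simp add: I_def L_def loops_def)
      then have "F (add_mset j w' + w) b' = cmp Y (Suc (Suc (Suc 0))) 0
          (cmp Y (Suc (Suc (Suc 0))) (Suc (Suc 0)) (h (gen3 m j)) (I (m j)))
          (cmp Y (Suc (Suc (Suc 0))) (Suc (Suc 0)) (F w' b') (F w c))"
        using Fadd[OF b j, of "w' + w"] add.IH[OF w'] by (simp add: c_def)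
      also have "\<dots> = cmp Y (Suc (Suc (Suc 0))) (Suc (Suc 0)) (F (add_mset j w') b') (F w (m j + c))"
        unfolding 1 Fadd[OF b j]
        by (rule Y.interchange[OF _ A C]) (simp_all add: cL FL b cX IL mc hL[OF j])
      finally show ?case by (simp add: c_def ac_simps)
    qed
    define H where "H = restrict (\<lambda>z. case dec z of (a, w, b) \<Rightarrow> F w b) (Cells B (Suc (Suc (Suc 0))))"
    have H: "H (enc (b + (\<Sum>j\<in>#w. m j), w, b)) = F w b" if "set_mset b \<subseteq> X" "set_mset w \<subseteq> J" for w b
      using in3[OF that] by (simp add: H_def)
    define g where "g = ext_map (Suc (Suc 0)) t H"
    have "g \<in> n_functors B Y" unfolding g_def
    proof (rule ext_map_functor[OF B3 t])
      show "H \<in> Cells B (Suc (Suc (Suc 0))) \<rightarrow>\<^sub>E Cells Y (Suc (Suc (Suc 0)))"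
        using FL by (auto simp: H_def L_def loops_def elim!: cells)
      show "dm Y (Suc (Suc 0)) (H z) = t (Suc (Suc 0)) (dm B (Suc (Suc 0)) z)"
        "cd Y (Suc (Suc 0)) (H z) = t (Suc (Suc 0)) (cd B (Suc (Suc 0)) z)"
        if "z \<in> Cells B (Suc (Suc (Suc 0)))" for z
        using that by (rule cells; simp add: H Fbd; simp add: B_def computad_def)+
      show "H (idn B (Suc (Suc 0)) z) = idn Y (Suc (Suc 0)) (t (Suc (Suc 0)) z)" if "z \<in> Cells B (Suc (Suc 0))" for z
      proof -
        from that obtain a where a: "z = enc (a, {#}, a)" "set_mset a \<subseteq> X" by (auto simp: B_def computad_def)
        then have "H z = F {#} a" using H[of a "{#}"] by simp
        then show ?thesis using a by (simp add: B_def computad_def F0 I_def)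
      qed
      show "H (cmp B (Suc (Suc (Suc 0))) j y x) = cmp Y (Suc (Suc (Suc 0))) j (H y) (H x)"
        if xy: "composable B (Suc (Suc (Suc 0))) j y x" for j y x
      proof -
        from xy have "x \<in> Cells B (Suc (Suc (Suc 0)))" "y \<in> Cells B (Suc (Suc (Suc 0)))" by (simp_all add: composable_def)
        then obtain w b w' b' where x: "x = enc (b + (\<Sum>j\<in>#w. m j), w, b)" "set_mset b \<subseteq> X" "set_mset w \<subseteq> J"
          and y: "y = enc (b' + (\<Sum>j\<in>#w'. m j), w', b')" "set_mset b' \<subseteq> X" "set_mset w' \<subseteq> J"
          by (elim cells)
        show ?thesis
        proof (cases "j \<le> Suc 0")
          case True
          have "cmp B (Suc (Suc (Suc 0))) j y x = enc ((b' + b) + (\<Sum>j\<in>#w' + w. m j), w' + w, b' + b)"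
            using x y True by (simp add: B_def computad_def ac_simps)
          moreover have "F (w' + w) (b' + b) = cmp Y (Suc (Suc (Suc 0))) j (F w' b') (F w b)"
            using Fplus[OF x(2) y(2) x(3) y(3)] True
              Y.Eckmann_Hilton[OF p _ _ FL[OF x(2), of w, unfolded L_def] FL[OF y(2), of w', unfolded L_def]]
            by (auto simp: le_Suc_eq)
          ultimately show ?thesis using H[of "b' + b" "w' + w"] H x y by simp
        next
          case False
          with xy have j: "j = Suc (Suc 0)" by (auto simp: composable_def)
          then have b: "b = b' + (\<Sum>j\<in>#w'. m j)" using xy x(1) y(1) by (simp add: composable_def B_def computad_def)
          have "cmp B (Suc (Suc (Suc 0))) j y x = enc (b' + (\<Sum>j\<in>#w' + w. m j), w' + w, b')"
            using x y j b by (simp add: B_def computad_def ac_simps)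
          then show ?thesis using H[of b' "w' + w"] H x y j Fcomp[OF y(2) x(3) y(3)] b by simp
        qed
      qed
    qed
    moreover have "g (Suc (Suc (Suc 0))) x = h x" if "x \<in> gen3 m ` J" for x
    proof -
      from that obtain j where j: "x = gen3 m j" "j \<in> J" by auto
      have "F {#j#} {#} = cmp Y (Suc (Suc (Suc 0))) 0 (h (gen3 m j)) (I {#})"
        using Fadd[of "{#}" j "{#}"] j by (simp add: F0)
      also have "\<dots> = h x" unfolding I0 j
        by (rule Y.loops_unit_right[OF p]) (use hL(1)[OF j(2)] in \<open>simp_all add: L_def\<close>)
      finally show ?thesis using j H[of "{#}" "{#j#}"] by (simp add: g_def ext_map_def)
    qed
    ultimately show "\<exists>g\<in>n_functors B Y. trunc_map (Suc (Suc 0)) g = t \<and> (\<forall>x\<in>gen3 m ` J. g (Suc (Suc (Suc 0))) x = h x)"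
      using trunc_ext_map[OF t] by (intro bexI[of _ g]) (auto simp: g_def) }
  { fix Y g g' assume g: "g \<in> n_functors B Y" "g' \<in> n_functors B Y" "trunc_map (Suc (Suc 0)) g = trunc_map (Suc (Suc 0)) g'"
     and gen: "\<And>x. x \<in> gen3 m ` J \<Longrightarrow> g (Suc (Suc (Suc 0))) x = g' (Suc (Suc (Suc 0))) x"
    show "g = g'"
    proof (rule n_functors_eq_top[OF B3 g])
      fix z assume "z \<in> Cells B (Suc (Suc (Suc 0)))"
      then show "g (Suc (Suc (Suc 0))) z = g' (Suc (Suc (Suc 0))) z"
      proof (rule cells)
        fix w b assume z: "z = enc (b + (\<Sum>j\<in>#w. m j), w, b)" and b: "set_mset b \<subseteq> X" and w: "set_mset w \<subseteq> J"
        from w have "g (Suc (Suc (Suc 0))) (enc (b + (\<Sum>j\<in>#w. m j), w, b)) = g' (Suc (Suc (Suc 0))) (enc (b + (\<Sum>j\<in>#w. m j), w, b))"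
        proof (induction w)
          case empty
          have "enc (b, {#}, b) \<in> Cells B (Suc (Suc 0))" "idn B (Suc (Suc 0)) (enc (b, {#}, b)) \<in> Cells B (Suc (Suc (Suc 0)))" 
            "idn B (Suc (Suc 0)) (enc (b, {#}, b)) = enc (b, {#}, b)" using b in3[OF b, of "{#}"] by (simp_all add: B_def computad_def)
          then show ?case
            using n_functors_idn[OF g(1), of "enc (b, {#}, b)" "Suc (Suc 0)"] n_functors_idn[OF g(2), of "enc (b, {#}, b)" "Suc (Suc 0)"]
             trunc_map_eqD[OF g(3), of "Suc (Suc 0)"] by simp
        next
          case (add x w)
          then have c: "composable B (Suc (Suc (Suc 0))) 0 (gen3 m x) (enc (b + (\<Sum>j\<in>#w. m j), w, b))"
            using b by (simp add: B_def computad_def composableI)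
          have "cmp B (Suc (Suc (Suc 0))) 0 (gen3 m x) (enc (b + (\<Sum>j\<in>#w. m j), w, b)) =
              enc (b + (\<Sum>j\<in>#add_mset x w. m j), add_mset x w, b)"
            by (simp add: B_def computad_def ac_simps)
          then show ?case using add n_functors_cmp[OF g(1) c] n_functors_cmp[OF g(2) c] gen by simp
        qed
        with z show ?thesis by simp
      qed
    qed }
qed

end

section \<open>Generators of a free category\<close>

(* From here on Comp n is used through its objects and morphisms in a fixed dimension. *)
declare Comp.simps(2) [simp del] Comp.simps(1) [simp del]

lemma Hom_Comp_Suc:
  "f \<in> Hom (Comp (Suc n)) A B \<longleftrightarrow> f \<in> n_functors A B \<and>
     trunc_map n f \<in> Hom (Comp n) (trunc n A) (trunc n B) \<and>
     f (Suc n) ` top_indets n (Comp n) A \<subseteq> top_indets n (Comp n) B"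
  by (simp add: Comp.simps(2))

lemma n_functors_into_larger:
  assumes "f \<in> n_functors A B" "\<And>k. Cells B k \<subseteq> Cells D k" "dm D = dm B" "cd D = cd B" "idn D = idn B" "cmp D = cmp B"
  shows "f \<in> n_functors A D"
proof -
  have "f k \<in> Cells A k \<rightarrow>\<^sub>E Cells D k" for k
    using assms(1,2) unfolding n_functors_def PiE_iff by blast
  then show ?thesis using assms(1,3-6) unfolding n_functors_def by simp
qed

text \<open>If \<open>z\<close> can be removed from \<open>C\<close> without destroying closure under the operations, a presentation that
avoids \<open>z\<close> factors through the smaller category.  The resulting retraction is the identity on the
presentation, hence on \<open>C\<close>, although it misses \<open>z\<close>.\<close>

lemma indecomposable_in_presentation:
  assumes free: "is_free n (Comp n) R C e" and z: "z \<in> Cells C (Suc n)"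
    and C': "n_category (Suc n) (C\<lparr>Cells := (Cells C)(Suc n := Cells C (Suc n) - {z})\<rparr>)"
  shows "z \<in> snd e ` indets R"
proof (rule ccontr)
  assume nz: "z \<notin> snd e ` indets R"
  let ?C' = "C\<lparr>Cells := (Cells C)(Suc n := Cells C (Suc n) - {z})\<rparr>"
  have tr: "trunc n ?C' = trunc n C"
    by (auto simp: trunc_def fun_eq_iff)
  note C = is_free_obj[OF free] and e1 = is_free_base_map[OF free]
    and e2 = is_free_cell[OF free] is_free_dm[OF free] is_free_cd[OF free]
  have tC: "trunc n C \<in> Obj (Comp n)" "n_category (Suc n) C" using C by simp_all
  have "\<exists>g\<in>Hom (CCat n (Comp n)) C ?C'. 
        nmap_comp (base R) (trunc n C) (trunc n ?C') (trunc_map n g) (fst e) = fst e \<and>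
        (\<forall>x\<in>indets R. g (Suc n) (snd e x) = snd e x)"
    by (rule is_free_extend[OF free]) (use C' e1 e2 nz tC in \<open>auto simp: tr\<close>)
  then obtain g where g: "g \<in> n_functors C ?C'" "trunc_map n g \<in> Hom (Comp n) (trunc n C) (trunc n C)"
    "nmap_comp (base R) (trunc n C) (trunc n C) (trunc_map n g) (fst e) = fst e"
    "\<And>x. x \<in> indets R \<Longrightarrow> g (Suc n) (snd e x) = snd e x"
    by (auto simp: tr)
  have "g = nmap_id C"
  proof (rule is_free_unique[OF free tC(2,1)])
    show "g \<in> Hom (CCat n (Comp n)) C C"
      using n_functors_into_larger[OF g(1), of C] g(2) by auto
    show "nmap_id C \<in> Hom (CCat n (Comp n)) C C"
      using nmap_id_functor[OF tC(2)] Comp_id_closed[OF tC(1)] by (simp add: trunc_map_id)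
    show "nmap_comp (base R) (trunc n C) (trunc n C) (trunc_map n g) (fst e) =
        nmap_comp (base R) (trunc n C) (trunc n C) (trunc_map n (nmap_id C)) (fst e)"
      using g(3) nmap_comp_id(2)[OF Comp_n_functor[OF e1]] by (simp add: trunc_map_id)
  qed (use g(4) e2(1) in \<open>simp add: nmap_id_def\<close>)
  then show False using n_functors_cell[OF g(1) z] z by (simp add: nmap_id_def)
qed

text \<open>Suppose that \<open>G\<close> consists of indecomposable cells, and that some presentation contains a cell
\<open>z \<notin> G\<close>.  It contains \<open>G\<close> as well, so by freeness \<open>z\<close> could be sent anywhere while \<open>G\<close> is kept fixed,
in particular to a parallel cell \<open>alt z\<close> in a larger category \<open>D\<close>.  It suffices to know that a functor
fixing \<open>G\<close> cannot do this.\<close>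

lemma top_indets_subsetI:
  assumes removable: "\<And>z. z \<in> G \<Longrightarrow> z \<in> Cells C (Suc n) \<and>
      n_category (Suc n) (C\<lparr>Cells := (Cells C)(Suc n := Cells C (Suc n) - {z})\<rparr>)"
    and D: "n_category (Suc n) D" "trunc n D = trunc n C" "Cells C (Suc n) \<subseteq> Cells D (Suc n)"
    and alt: "\<And>z. z \<in> Cells C (Suc n) - G \<Longrightarrow>
      alt z \<in> Cells D (Suc n) \<and> dm C n (alt z) = dm C n z \<and> cd C n (alt z) = cd C n z"
    and alt_neq: "\<And>z \<theta>. z \<in> Cells C (Suc n) - G \<Longrightarrow> \<theta> \<in> n_functors C D \<Longrightarrow>
      (\<And>g. g \<in> G \<Longrightarrow> \<theta> (Suc n) g = g) \<Longrightarrow> \<theta> (Suc n) z \<noteq> alt z"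
  shows "top_indets n (Comp n) C \<subseteq> G"
proof (rule ccontr)
  assume "\<not> ?thesis"
  then obtain R e x where free: "is_free n (Comp n) R C e" and x: "x \<in> indets R" and nz: "snd e x \<notin> G"
    unfolding top_indets_def by (auto simp: image_iff) (metis snd_conv)
  have ops: "dm D = dm C" "cd D = cd C"
    using arg_cong[OF D(2), of dm] arg_cong[OF D(2), of cd] by auto
  note C = is_free_obj[OF free] and e1 = is_free_base_map[OF free]
    and e2 = is_free_cell[OF free] is_free_dm[OF free] is_free_cd[OF free]
  define h where "h y = (if y = x then alt (snd e x) else snd e y)" for y
  have "\<exists>g\<in>Hom (CCat n (Comp n)) C D. 
        nmap_comp (base R) (trunc n C) (trunc n D) (trunc_map n g) (fst e) = fst e \<and>
        (\<forall>y\<in>indets R. g (Suc n) (snd e y) = h y)"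
  proof (rule is_free_extend[OF free])
    fix y assume y: "y \<in> indets R"
    then show "h y \<in> Cells D (Suc n) \<and> dm D n (h y) = fst e n (fst (bdry R y)) \<and>
         cd D n (h y) = fst e n (snd (bdry R y))"
      using e2[OF y] D(3) alt[of "snd e x"] nz by (auto simp: h_def ops)
  qed (use D C e1 in auto)
  then obtain \<theta> where \<theta>: "\<theta> \<in> n_functors C D" "\<And>y. y \<in> indets R \<Longrightarrow> \<theta> (Suc n) (snd e y) = h y"
    by auto
  have "\<theta> (Suc n) g = g" if g: "g \<in> G" for g
  proof -
    obtain y where y: "y \<in> indets R" "g = snd e y"
      using indecomposable_in_presentation[OF free] removable[OF g] by blast
    with nz g show ?thesis using \<theta>(2)[of y] by (auto simp: h_def)
  qed
  then have "\<theta> (Suc n) (snd e x) \<noteq> alt (snd e x)"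
    using e2(1)[OF x] nz \<theta>(1) by (intro alt_neq) auto
  then show False using \<theta>(2)[OF x] by (simp add: h_def)
qed

section \<open>Products of computads\<close>

text \<open>For a cone \<open>(f, g)\<close> from \<open>C\<close>, with a presentation \<open>e : R \<rightarrow> U C\<close>, the product one dimension below gives
a map on \<open>base R\<close>, and \<open>lift\<close> says where each generator has to go.  The induced map out of \<open>C\<close> preserves
the generators of all presentations because the projections reflect them (\<open>reflect\<close>).\<close>

lemma product_lift:
  assumes P: "P \<in> Obj (Comp (Suc n))" and A: "A \<in> Obj (Comp (Suc n))" and B: "B \<in> Obj (Comp (Suc n))"
    and p: "p \<in> Hom (Comp (Suc n)) P A" and q: "q \<in> Hom (Comp (Suc n)) P B"
    and prod: "is_product (Comp n) (trunc n A) (trunc n B) (trunc n P) (trunc_map n p) (trunc_map n q)"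
    and reflect: "\<And>z. z \<in> Cells P (Suc n) \<Longrightarrow> p (Suc n) z \<in> top_indets n (Comp n) A \<Longrightarrow>
       q (Suc n) z \<in> top_indets n (Comp n) B \<Longrightarrow> z \<in> top_indets n (Comp n) P"
    and lift: "\<And>a b r s. a \<in> top_indets n (Comp n) A \<Longrightarrow> b \<in> top_indets n (Comp n) B \<Longrightarrow>
       r \<in> Cells P n \<Longrightarrow> s \<in> Cells P n \<Longrightarrow> p n r = dm A n a \<Longrightarrow> p n s = cd A n a \<Longrightarrow>
       q n r = dm B n b \<Longrightarrow> q n s = cd B n b \<Longrightarrow>
       \<exists>!z. z \<in> Cells P (Suc n) \<and> p (Suc n) z = a \<and> q (Suc n) z = b \<and> dm P n z = r \<and> cd P n z = s"
  shows "is_product (Comp (Suc n)) A B P p q"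
  unfolding is_product_def Comp_simps
proof (intro conjI P p q ballI)
  fix C f g
  assume C: "C \<in> Obj (Comp (Suc n))" and f: "f \<in> Hom (Comp (Suc n)) C A" and g: "g \<in> Hom (Comp (Suc n)) C B"
  note fF = Comp_n_functor[OF f] and gF = Comp_n_functor[OF g] and pF = Comp_n_functor[OF p] and qF = Comp_n_functor[OF q]
  from C obtain R e where free: "is_free n (Comp n) R C e" by (auto simp: Comp.simps(2))
  have cat: "n_category (Suc n) A" "n_category (Suc n) B" "n_category (Suc n) P" "n_category (Suc n) C"
    using A B P C by (auto intro: Comp_n_category)
  have tr: "trunc n A \<in> Obj (Comp n)" "trunc n B \<in> Obj (Comp n)" "trunc n P \<in> Obj (Comp n)" "trunc n C \<in> Obj (Comp n)"
    using A B P C by (auto intro: Comp_trunc)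
  have tm: "trunc_map n f \<in> Hom (Comp n) (trunc n C) (trunc n A)" "trunc_map n g \<in> Hom (Comp n) (trunc n C) (trunc n B)"
    "trunc_map n p \<in> Hom (Comp n) (trunc n P) (trunc n A)" "trunc_map n q \<in> Hom (Comp n) (trunc n P) (trunc n B)"
    using f g p q by (simp_all add: Hom_Comp_Suc)
  have ti: "\<And>z. z \<in> top_indets n (Comp n) C \<Longrightarrow> f (Suc n) z \<in> top_indets n (Comp n) A"
    "\<And>z. z \<in> top_indets n (Comp n) C \<Longrightarrow> g (Suc n) z \<in> top_indets n (Comp n) B"
    using f g by (auto simp: Hom_Comp_Suc)
  show "\<exists>!h. h \<in> Hom (Comp (Suc n)) C P \<and> nmap_comp C P A p h = f \<and> nmap_comp C P B q h = g"
  proof -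
    note R = is_free_base[OF free] and e1 = is_free_base_map[OF free] and e2 = is_free_cell[OF free]
      and bR = is_free_bdry[OF free] and de = is_free_dm[OF free] and ce = is_free_cd[OF free]
      and uniq = is_free_unique[OF free]
    note e1F = Comp_n_functor[OF e1]
    (* The map one dimension below is defined on base R instead of on the truncation of C. *)
    let ?f = "nmap_comp (base R) (trunc n C) (trunc n A) (trunc_map n f) (fst e)"
    let ?g = "nmap_comp (base R) (trunc n C) (trunc n B) (trunc_map n g) (fst e)"
    have "?f \<in> Hom (Comp n) (base R) (trunc n A)" "?g \<in> Hom (Comp n) (base R) (trunc n B)"
      by (rule Comp_comp_closed[OF R _ _ e1]; use tr tm in simp)+
    with prod R have "\<exists>!t. t \<in> Hom (Comp n) (base R) (trunc n P) \<and>
        nmap_comp (base R) (trunc n P) (trunc n A) (trunc_map n p) t = ?f \<and>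
        nmap_comp (base R) (trunc n P) (trunc n B) (trunc_map n q) t = ?g"
      unfolding is_product_def Comp_simps by blast
    then obtain t where t: "t \<in> Hom (Comp n) (base R) (trunc n P)"
        "nmap_comp (base R) (trunc n P) (trunc n A) (trunc_map n p) t = ?f"
        "nmap_comp (base R) (trunc n P) (trunc n B) (trunc_map n q) t = ?g"
      and t_uniq: "\<And>t'. t' \<in> Hom (Comp n) (base R) (trunc n P) \<Longrightarrow>
        nmap_comp (base R) (trunc n P) (trunc n A) (trunc_map n p) t' = ?f \<Longrightarrow>
        nmap_comp (base R) (trunc n P) (trunc n B) (trunc_map n q) t' = ?g \<Longrightarrow> t' = t"
      by (elim ex1E) (metis (no_types, lifting))
    have tp: "t n c \<in> Cells P n" "p n (t n c) = f n (fst e n c)" "q n (t n c) = g n (fst e n c)" if "c \<in> Cells (base R) n" for c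
      using n_functors_cell[OF Comp_n_functor[OF t(1)] that] fun_cong[OF fun_cong[OF t(2), of n], of c]
         fun_cong[OF fun_cong[OF t(3), of n], of c] that
      by (simp_all add: nmap_comp_apply trunc_map_def)
    let ?S = "\<lambda>x z. z \<in> Cells P (Suc n) \<and> p (Suc n) z = f (Suc n) (snd e x) \<and> q (Suc n) z = g (Suc n) (snd e x) \<and>
        dm P n z = t n (fst (bdry R x)) \<and> cd P n z = t n (snd (bdry R x))"
    have S: "\<exists>!z. ?S x z" if x: "x \<in> indets R" for x
    proof (rule lift)
      show "f (Suc n) (snd e x) \<in> top_indets n (Comp n) A" "g (Suc n) (snd e x) \<in> top_indets n (Comp n) B"
        using ti top_indetsI[OF free x] by auto
    qed (use bR[OF x] tp de[OF x] ce[OF x] n_functors_dm[OF fF e2[OF x]] n_functors_cd[OF fF e2[OF x]]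
       n_functors_dm[OF gF e2[OF x]] n_functors_cd[OF gF e2[OF x]] in simp_all)
    define l where "l x = (THE z. ?S x z)" for x
    have l: "?S x (l x)" if "x \<in> indets R" for x
      unfolding l_def by (rule theI') (rule S[OF that])
    have l_uniq: "z = l x" if "x \<in> indets R" "?S x z" for x z
      using S[OF that(1)] that(2) l[OF that(1)] by (elim ex1E) (metis (no_types, lifting))
    have "\<exists>h\<in>Hom (CCat n (Comp n)) C P. 
        nmap_comp (base R) (trunc n C) (trunc n P) (trunc_map n h) (fst e) = t \<and>
        (\<forall>x\<in>indets R. h (Suc n) (snd e x) = l x)"
      by (rule is_free_extend[OF free]) (use cat tr t l in simp_all)
    then obtain h where h: "h \<in> n_functors C P" "trunc_map n h \<in> Hom (Comp n) (trunc n C) (trunc n P)"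
      "nmap_comp (base R) (trunc n C) (trunc n P) (trunc_map n h) (fst e) = t"
      "\<And>x. x \<in> indets R \<Longrightarrow> h (Suc n) (snd e x) = l x"
      by auto
    have proj: "nmap_comp C P D r h = k"
      if D: "D \<in> Obj (Comp (Suc n))" and r: "r \<in> Hom (Comp (Suc n)) P D" and k: "k \<in> Hom (Comp (Suc n)) C D"
        and rt: "nmap_comp (base R) (trunc n P) (trunc n D) (trunc_map n r) t =
           nmap_comp (base R) (trunc n C) (trunc n D) (trunc_map n k) (fst e)"
        and rl: "\<And>x. x \<in> indets R \<Longrightarrow> r (Suc n) (l x) = k (Suc n) (snd e x)" for D r k
    proof (rule uniq)
      show "n_category (Suc n) D" "trunc n D \<in> Obj (Comp n)" using D by (auto intro: Comp_n_category Comp_trunc)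
      show "k \<in> Hom (CCat n (Comp n)) C D" using k by (simp add: Hom_Comp_Suc)
      show "nmap_comp C P D r h \<in> Hom (CCat n (Comp n)) C D"
        using r h D P cat tr
        by (simp add: Hom_Comp_Suc nmap_comp_functor[OF cat(4)] trunc_map_comp
           Comp_comp_closed[of "trunc n C" n "trunc n P"] Comp_trunc)
      have "nmap_comp (base R) (trunc n C) (trunc n D) (trunc_map n (nmap_comp C P D r h)) (fst e) =
         nmap_comp (base R) (trunc n P) (trunc n D) (trunc_map n r) t"
        unfolding trunc_map_comp using nmap_comp_assoc[OF e1F] h(3) by metis
      then show "nmap_comp (base R) (trunc n C) (trunc n D) (trunc_map n (nmap_comp C P D r h)) (fst e) =
        nmap_comp (base R) (trunc n C) (trunc n D) (trunc_map n k) (fst e)" using rt by simp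
      show "nmap_comp C P D r h (Suc n) (snd e x) = k (Suc n) (snd e x)" if "x \<in> indets R" for x
        using rl[OF that] h(4)[OF that] e2[OF that] by (simp add: nmap_comp_apply)
    qed
    have ph: "nmap_comp C P A p h = f" by (rule proj[OF A p f t(2)]) (use l in blast)
    have qh: "nmap_comp C P B q h = g" by (rule proj[OF B q g t(3)]) (use l in blast)
    have "h (Suc n) z \<in> top_indets n (Comp n) P" if z: "z \<in> top_indets n (Comp n) C" for z
    proof -
      have zC: "z \<in> Cells C (Suc n)" by (rule subsetD[OF top_indets_subset z])
      show ?thesis
        using reflect[OF n_functors_cell[OF h(1) zC]] ti[OF z] fun_cong[OF fun_cong[OF ph, of "Suc n"], of z]
          fun_cong[OF fun_cong[OF qh, of "Suc n"], of z] zC by (simp add: nmap_comp_apply)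
    qed
    then have hH: "h \<in> Hom (Comp (Suc n)) C P" using h by (auto simp: Hom_Comp_Suc)
    show ?thesis
    proof (rule ex1I[of _ h])
      show "h \<in> Hom (Comp (Suc n)) C P \<and> nmap_comp C P A p h = f \<and> nmap_comp C P B q h = g"
        using hH ph qh by simp
      fix h' assume h': "h' \<in> Hom (Comp (Suc n)) C P \<and> nmap_comp C P A p h' = f \<and> nmap_comp C P B q h' = g"
      then have h'F: "h' \<in> n_functors C P" "trunc_map n h' \<in> Hom (Comp n) (trunc n C) (trunc n P)"
        by (simp_all add: Hom_Comp_Suc)
      let ?t = "nmap_comp (base R) (trunc n C) (trunc n P) (trunc_map n h') (fst e)"
      have "?t = t"
      proof (rule t_uniq)
        show "?t \<in> Hom (Comp n) (base R) (trunc n P)"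
          by (rule Comp_comp_closed[OF R tr(4,3) e1 h'F(2)])
        show "nmap_comp (base R) (trunc n P) (trunc n A) (trunc_map n p) ?t = ?f"
          using nmap_comp_assoc[OF e1F] h' trunc_map_comp by metis
        show "nmap_comp (base R) (trunc n P) (trunc n B) (trunc_map n q) ?t = ?g"
          using nmap_comp_assoc[OF e1F] h' trunc_map_comp by metis
      qed
      moreover have "h' (Suc n) (snd e x) = l x" if x: "x \<in> indets R" for x
      proof (rule l_uniq[OF x])
        have "h' n (fst e n c) = t n c" if "c \<in> Cells (base R) n" for c
          using fun_cong[OF fun_cong[OF \<open>?t = t\<close>, of n], of c] that by (simp add: nmap_comp_apply trunc_map_def)
        then show "?S x (h' (Suc n) (snd e x))"
          using h' n_functors_cell[OF h'F(1) e2[OF x]] n_functors_dm[OF h'F(1) e2[OF x]] n_functors_cd[OF h'F(1) e2[OF x]]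
            de[OF x] ce[OF x] bR[OF x] e2[OF x] by (auto simp: nmap_comp_apply[symmetric])
      qed
      ultimately show "h' = h"
        using h h'F cat tr by - (rule uniq[of P], simp_all)
    qed
  qed
qed

section \<open>The generators of the computads of multisets\<close>

context coding begin

lemma closed_trivial:
  "{#} \<in> S \<Longrightarrow> (\<And>a b. a \<in> S \<Longrightarrow> b \<in> S \<Longrightarrow> a + b \<in> S) \<Longrightarrow> closed_cells S {(a, {#}, a) |a. a \<in> S}"
  by (auto simp: closed_cells_def)

lemma trunc2_cells_ncat: "trunc (Suc (Suc 0)) (cells_ncat S T) = trunc (Suc (Suc 0)) (cells_ncat S T')"
  by (auto simp: trunc_def cells_ncat_def fun_eq_iff)

text \<open>Singletons are indecomposable in the monoid of multisets.  A functor that fixes the singletons fixes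
every multiset \<open>a\<close>, so it cannot send \<open>a\<close> to \<open>a + {#0#}\<close>; the larger category \<open>D\<close> has all multisets
over the natural numbers as 2-cells, which makes room for the extra 0 even if \<open>0 \<notin> X\<close>.\<close>

lemma top_indets_level2:
  assumes "closed_cells {a. set_mset a \<subseteq> X} T"
  shows "top_indets (Suc 0) (Comp (Suc 0)) (trunc (Suc (Suc 0)) (cells_ncat {a. set_mset a \<subseteq> X} T)) = gen2 ` X"
    (is "top_indets _ _ ?C = _")
proof
  show "gen2 ` X \<subseteq> top_indets (Suc 0) (Comp (Suc 0)) ?C"
    using top_indetsI[OF is_free_level2[OF assms]] by (auto simp: gen_com_def gen_unit_def)
  define D where "D = trunc (Suc (Suc 0)) (cells_ncat UNIV {(a, {#}, a) |a. a \<in> UNIV})"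
  show "top_indets (Suc 0) (Comp (Suc 0)) ?C \<subseteq> gen2 ` X"
  proof (rule top_indets_subsetI)
    fix z assume "z \<in> gen2 ` X"
    then obtain x where x: "z = gen2 x" "x \<in> X" by auto
    let ?S = "{a. set_mset a \<subseteq> X} - {{#x#}}"
    have "?C\<lparr>Cells := (Cells ?C)(Suc (Suc 0) := Cells ?C (Suc (Suc 0)) - {z})\<rparr> =
       trunc (Suc (Suc 0)) (cells_ncat ?S {(a, {#}, a) |a. a \<in> ?S})"
      using x by (auto simp: trunc_def cells_ncat_def fun_eq_iff)
    moreover have "n_category (Suc (Suc 0)) (trunc (Suc (Suc 0)) (cells_ncat ?S {(a, {#}, a) |a. a \<in> ?S}))"
      by (rule n_category_trunc[OF n_category_cells_ncat[OF closed_trivial]]) (auto simp: union_is_single)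
    ultimately show "z \<in> Cells ?C (Suc (Suc 0)) \<and> 
        n_category (Suc (Suc 0)) (?C\<lparr>Cells := (Cells ?C)(Suc (Suc 0) := Cells ?C (Suc (Suc 0)) - {z})\<rparr>)"
      using x by simp
  next
    show "n_category (Suc (Suc 0)) D" unfolding D_def
      by (rule n_category_trunc[OF n_category_cells_ncat[OF closed_trivial]]) auto
    show "trunc (Suc 0) D = trunc (Suc 0) ?C" by (simp add: D_def) (rule trunc1_cells_ncat)
    show "Cells ?C (Suc (Suc 0)) \<subseteq> Cells D (Suc (Suc 0))" by (auto simp: D_def)
  next
    let ?alt = "\<lambda>z. case dec z of (a, w, b) \<Rightarrow> enc (add_mset 0 a, {#}, add_mset 0 a)"
    fix z assume "z \<in> Cells ?C (Suc (Suc 0)) - gen2 ` X"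
    then obtain a where a: "z = enc (a, {#}, a)" "set_mset a \<subseteq> X" by auto
    then show "?alt z \<in> Cells D (Suc (Suc 0)) \<and> dm ?C (Suc 0) (?alt z) = dm ?C (Suc 0) z \<and>
        cd ?C (Suc 0) (?alt z) = cd ?C (Suc 0) z"
      by (simp add: D_def)
    fix \<theta> assume \<theta>: "\<theta> \<in> n_functors ?C D" "\<And>g. g \<in> gen2 ` X \<Longrightarrow> \<theta> (Suc (Suc 0)) g = g"
    from a(2) have "\<theta> (Suc (Suc 0)) (enc (a, {#}, a)) = enc (a, {#}, a)"
    proof (induction a)
      case empty
      have "pt \<in> Cells ?C (Suc 0)" "idn ?C (Suc 0) pt \<in> Cells ?C (Suc (Suc 0))" by (simp_all add: pt_def)
      moreover from this(1) have "\<theta> (Suc 0) pt = pt" using n_functors_cell[OF \<theta>(1), of pt "Suc 0"] by (simp add: D_def)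
      ultimately show ?case using n_functors_idn[OF \<theta>(1), of pt "Suc 0"] by (simp add: D_def pt_def)
    next
      case (add x a)
      then have c: "composable ?C (Suc (Suc 0)) 0 (gen2 x) (enc (a, {#}, a))"
        by (simp add: composableI)
      have "cmp ?C (Suc (Suc 0)) 0 (gen2 x) (enc (a, {#}, a)) = enc (add_mset x a, {#}, add_mset x a)"
        by simp
      then show ?case using add n_functors_cmp[OF \<theta>(1) c] \<theta>(2) by (simp add: D_def)
    qed
    with a show "\<theta> (Suc (Suc 0)) z \<noteq> ?alt z" by simp
  qed
qed

text \<open>The larger category \<open>D\<close> has all possible triples as 3-cells.  A functor into it that fixes the
generators preserves the multiset \<open>w\<close> of every 3-cell, so it cannot insert an extra 0 there.\<close>

lemma top_indets_level3:
  assumes m: "\<And>j. j \<in> J \<Longrightarrow> set_mset (m j) \<subseteq> X"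
  shows "top_indets (Suc (Suc 0)) (Comp (Suc (Suc 0))) (computad X J m) = gen3 m ` J"
proof
  show "gen3 m ` J \<subseteq> top_indets (Suc (Suc 0)) (Comp (Suc (Suc 0))) (computad X J m)"
    using top_indetsI[OF is_free_level3[OF m]] by (auto simp: gen_com_def gen_unit_def)
  let ?C = "computad X J m"
  let ?S = "{a. set_mset a \<subseteq> X}"
  define D where "D = cells_ncat ?S {(a, w, b) |a w b. a \<in> ?S \<and> b \<in> ?S}"
  have cl: "closed_cells ?S (free_cells X J m)" using closed_free_cells[OF m] .
  show "top_indets (Suc (Suc 0)) (Comp (Suc (Suc 0))) ?C \<subseteq> gen3 m ` J"
  proof (rule top_indets_subsetI)
    fix z assume "z \<in> gen3 m ` J"
    then obtain j where j: "z = gen3 m j" "j \<in> J" by auto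
    let ?T = "free_cells X J m - {(m j, {#j#}, {#})}"
    have "?C\<lparr>Cells := (Cells ?C)(Suc (Suc (Suc 0)) := Cells ?C (Suc (Suc (Suc 0))) - {z})\<rparr> = cells_ncat ?S ?T"
      using j by (auto simp: computad_def cells_ncat_def fun_eq_iff)
    moreover have "closed_cells ?S ?T"
      using cl unfolding closed_cells_def by (auto simp: union_is_single)
    ultimately show "z \<in> Cells ?C (Suc (Suc (Suc 0))) \<and> 
        n_category (Suc (Suc (Suc 0))) (?C\<lparr>Cells := (Cells ?C)(Suc (Suc (Suc 0)) := Cells ?C (Suc (Suc (Suc 0))) - {z})\<rparr>)"
      using j n_category_cells_ncat by (simp add: computad_def)
  next
    show "n_category (Suc (Suc (Suc 0))) D" unfolding D_def
      by (rule n_category_cells_ncat) (auto simp: closed_cells_def)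
    show "trunc (Suc (Suc 0)) D = trunc (Suc (Suc 0)) ?C" unfolding D_def computad_def by (rule trunc2_cells_ncat)
    show "Cells ?C (Suc (Suc (Suc 0))) \<subseteq> Cells D (Suc (Suc (Suc 0)))"
      using cl by (auto simp: D_def computad_def closed_cells_def simp del: free_cells_iff)
  next
    let ?alt = "\<lambda>z. case dec z of (a, w, b) \<Rightarrow> enc (a, add_mset 0 w, b)"
    fix z assume "z \<in> Cells ?C (Suc (Suc (Suc 0))) - gen3 m ` J"
    then obtain w b where z: "z = enc (b + (\<Sum>j\<in>#w. m j), w, b)" "set_mset b \<subseteq> X" "set_mset w \<subseteq> J"
      by (auto simp: computad_def)
    have "set_mset (\<Sum>j\<in>#w. m j) \<subseteq> X" using z(3) by (rule set_mset_sum) (rule m)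
    with z show "?alt z \<in> Cells D (Suc (Suc (Suc 0))) \<and> dm ?C (Suc (Suc 0)) (?alt z) = dm ?C (Suc (Suc 0)) z \<and>
        cd ?C (Suc (Suc 0)) (?alt z) = cd ?C (Suc (Suc 0)) z"
      by (simp add: D_def computad_def)
    fix \<theta> assume \<theta>: "\<theta> \<in> n_functors ?C D" "\<And>g. g \<in> gen3 m ` J \<Longrightarrow> \<theta> (Suc (Suc (Suc 0))) g = g"
    from z(3) have "\<exists>a' b'. \<theta> (Suc (Suc (Suc 0))) (enc (b + (\<Sum>j\<in>#w. m j), w, b)) = enc (a', w, b')"
    proof (induction w)
      case empty
      have "enc (b, {#}, b) \<in> Cells ?C (Suc (Suc 0))" "idn ?C (Suc (Suc 0)) (enc (b, {#}, b)) \<in> Cells ?C (Suc (Suc (Suc 0)))"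
        using z(2) by (simp_all add: computad_def)
      moreover from this(1) have "\<exists>a'. \<theta> (Suc (Suc 0)) (enc (b, {#}, b)) = enc (a', {#}, a')"
        using n_functors_cell[OF \<theta>(1), of "enc (b, {#}, b)" "Suc (Suc 0)"] by (auto simp: D_def)
      ultimately show ?case using n_functors_idn[OF \<theta>(1), of "enc (b, {#}, b)" "Suc (Suc 0)"] by (auto simp: D_def computad_def)
    next
      case (add x w)
      then have c: "composable ?C (Suc (Suc (Suc 0))) 0 (gen3 m x) (enc (b + (\<Sum>j\<in>#w. m j), w, b))"
        using z(2) by (simp add: computad_def composableI)
      have "cmp ?C (Suc (Suc (Suc 0))) 0 (gen3 m x) (enc (b + (\<Sum>j\<in>#w. m j), w, b)) =
          enc (b + (\<Sum>j\<in>#add_mset x w. m j), add_mset x w, b)"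
        by (simp add: computad_def ac_simps)
      moreover obtain a' b' where "\<theta> (Suc (Suc (Suc 0))) (enc (b + (\<Sum>j\<in>#w. m j), w, b)) = enc (a', w, b')"
        using add by auto
      ultimately show ?case using add(2) n_functors_cmp[OF \<theta>(1) c] \<theta>(2) by (simp add: D_def)
    qed
    with z show "\<theta> (Suc (Suc (Suc 0))) z \<noteq> ?alt z" by auto
  qed
qed

lemma computad_in_Comp:
  assumes m: "\<And>j. j \<in> J \<Longrightarrow> set_mset (m j) \<subseteq> X"
  shows "computad X J m \<in> Obj (Comp (Suc (Suc (Suc 0))))"
  by (rule Comp_SucI[OF is_free_level3[OF m]])

section \<open>Maps and products given on generators\<close>

definition gen_map :: "'u ncat \<Rightarrow> (nat \<Rightarrow> nat) \<Rightarrow> (nat \<Rightarrow> nat) \<Rightarrow> 'u nmap" where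
  "gen_map A \<alpha> \<beta> = (\<lambda>k. \<lambda>z\<in>Cells A k. case dec z of (a, w, b) \<Rightarrow>
      enc (image_mset \<alpha> a, image_mset \<beta> w, image_mset \<alpha> b))"

lemma gen_map_enc [simp]: "enc (a, w, b) \<in> Cells A k \<Longrightarrow> gen_map A \<alpha> \<beta> k (enc (a, w, b)) = 
    enc (image_mset \<alpha> a, image_mset \<beta> w, image_mset \<alpha> b)"
  by (simp add: gen_map_def)

lemma gen_map_pt [simp]: "pt \<in> Cells A k \<Longrightarrow> gen_map A \<alpha> \<beta> k pt = pt"
  by (simp add: gen_map_def pt_def)

lemma gen_map_functor:
  assumes cl: "closed_cells S T"
    and S: "\<And>a. a \<in> S \<Longrightarrow> image_mset \<alpha> a \<in> S'"
    and T: "\<And>a w b. (a, w, b) \<in> T \<Longrightarrow> (image_mset \<alpha> a, image_mset \<beta> w, image_mset \<alpha> b) \<in> T'"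
  shows "gen_map (cells_ncat S T) \<alpha> \<beta> \<in> n_functors (cells_ncat S T) (cells_ncat S' T')"
proof -
  interpret n_category "Suc (Suc (Suc 0))" "cells_ncat S T" by (rule n_category_cells_ncat[OF cl])
  show ?thesis unfolding n_functors_def mem_Collect_eq
  proof (intro conjI allI ballI impI)
    fix k
    show "gen_map (cells_ncat S T) \<alpha> \<beta> k \<in> Cells (cells_ncat S T) k \<rightarrow>\<^sub>E Cells (cells_ncat S' T') k"
    proof (rule PiE_I)
      fix z assume z: "z \<in> Cells (cells_ncat S T) k"
      from z show "gen_map (cells_ncat S T) \<alpha> \<beta> k z \<in> Cells (cells_ncat S' T') k"
        by (cases rule: cells_cases) (use z S T in auto)
    qed (simp add: gen_map_def)
  next
    fix k z assume z: "z \<in> Cells (cells_ncat S T) (Suc k)"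
    note d = dm_in[OF z] cd_in[OF z]
    from z show "gen_map (cells_ncat S T) \<alpha> \<beta> k (dm (cells_ncat S T) k z) = dm (cells_ncat S' T') k (gen_map (cells_ncat S T) \<alpha> \<beta> (Suc k) z)"
      "gen_map (cells_ncat S T) \<alpha> \<beta> k (cd (cells_ncat S T) k z) = cd (cells_ncat S' T') k (gen_map (cells_ncat S T) \<alpha> \<beta> (Suc k) z)"
      by (cases rule: cells_cases; use z d in auto)+
  next
    fix k z assume z: "z \<in> Cells (cells_ncat S T) k" "idn (cells_ncat S T) k z \<in> Cells (cells_ncat S T) (Suc k)"
    then show "gen_map (cells_ncat S T) \<alpha> \<beta> (Suc k) (idn (cells_ncat S T) k z) = idn (cells_ncat S' T') k (gen_map (cells_ncat S T) \<alpha> \<beta> k z)"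
      by (simp add: gen_map_def)
  next
    fix k j y x assume c: "composable (cells_ncat S T) k j y x"
    then have "x \<in> Cells (cells_ncat S T) k" "y \<in> Cells (cells_ncat S T) k" by (simp_all add: composable_def)
    note * = comp_in[OF c] this
    from c show "gen_map (cells_ncat S T) \<alpha> \<beta> k (cmp (cells_ncat S T) k j y x) =
        cmp (cells_ncat S' T') k j (gen_map (cells_ncat S T) \<alpha> \<beta> k y) (gen_map (cells_ncat S T) \<alpha> \<beta> k x)"
      by (cases rule: composable_cases) (use * in auto)
  qed
qed

text \<open>Both truncations are the same category with one vertex, and the identity is its only endofunctor.\<close>

lemma Hom_level1:
  assumes "closed_cells S T" and "f \<in> n_functors (trunc (Suc 0) (cells_ncat S T)) (trunc (Suc 0) (cells_ncat S' T'))"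
  shows "f \<in> Hom (Comp (Suc 0)) (trunc (Suc 0) (cells_ncat S T)) (trunc (Suc 0) (cells_ncat S' T'))"
proof -
  have f: "f \<in> n_functors (trunc (Suc 0) (cells_ncat S T)) (trunc (Suc 0) (cells_ncat S T))"
    using assms(2) trunc1_cells_ncat by metis
  have "f = nmap_id (trunc (Suc 0) (cells_ncat S T))"
  proof (rule n_functors_eqI[OF f nmap_id_functor[OF Comp_n_category[OF trunc1_Comp[OF assms(1)]]]])
    fix k z assume z: "z \<in> Cells (trunc (Suc 0) (cells_ncat S T)) k"
    then have "k = 0 \<or> k = Suc 0" by (auto split: if_splits)
    then show "f k z = nmap_id (trunc (Suc 0) (cells_ncat S T)) k z"
      using n_functors_cell[OF f z] z by (auto simp: nmap_id_def)
  qed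
  then show ?thesis using Comp_id_closed[OF trunc1_Comp[OF assms(1)]] trunc1_cells_ncat by metis
qed

lemma gen_map_Hom:
  assumes m: "\<And>j. j \<in> J \<Longrightarrow> set_mset (m j) \<subseteq> X" and m': "\<And>j. j \<in> J' \<Longrightarrow> set_mset (m' j) \<subseteq> X'"
    and \<alpha>: "\<And>x. x \<in> X \<Longrightarrow> \<alpha> x \<in> X'" and \<beta>: "\<And>j. j \<in> J \<Longrightarrow> \<beta> j \<in> J'"
    and compat: "\<And>j. j \<in> J \<Longrightarrow> m' (\<beta> j) = image_mset \<alpha> (m j)"
  shows "gen_map (computad X J m) \<alpha> \<beta> \<in> Hom (Comp (Suc (Suc (Suc 0)))) (computad X J m) (computad X' J' m')"
proof -
  let ?S = "{a. set_mset a \<subseteq> X}" and ?S' = "{a. set_mset a \<subseteq> X'}"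
  have cl: "closed_cells ?S (free_cells X J m)" using closed_free_cells[OF m] .
  have cl': "closed_cells ?S' (free_cells X' J' m')" using closed_free_cells[OF m'] .
  have f: "gen_map (computad X J m) \<alpha> \<beta> \<in> n_functors (computad X J m) (computad X' J' m')"
    unfolding computad_def
  proof (rule gen_map_functor[OF cl])
    fix a w b assume "(a, w, b) \<in> free_cells X J m"
    then show "(image_mset \<alpha> a, image_mset \<beta> w, image_mset \<alpha> b) \<in> free_cells X' J' m'"
      using \<alpha> \<beta> image_mset_sum[of w J m' \<beta> \<alpha> m] compat by auto
  qed (use \<alpha> in auto)
  have "trunc_map (Suc 0) (gen_map (computad X J m) \<alpha> \<beta>) \<in> Hom (Comp (Suc 0)) (trunc (Suc 0) (computad X J m)) (trunc (Suc 0) (computad X' J' m'))"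
    unfolding computad_def using trunc_map_functor[OF f] by (intro Hom_level1 cl) (simp add: computad_def)
  moreover have "trunc_map (Suc (Suc 0)) (gen_map (computad X J m) \<alpha> \<beta>) (Suc (Suc 0)) ` gen2 ` X \<subseteq> gen2 ` X'"
    using \<alpha> by (auto simp: trunc_map_def computad_def)
  moreover have "gen_map (computad X J m) \<alpha> \<beta> (Suc (Suc (Suc 0))) ` gen3 m ` J \<subseteq> gen3 m' ` J'"
  proof clarify
    fix j assume j: "j \<in> J"
    have "enc (m j, {#j#}, {#}) \<in> Cells (computad X J m) (Suc (Suc (Suc 0)))" using j by (simp add: computad_def)
    then show "gen_map (computad X J m) \<alpha> \<beta> (Suc (Suc (Suc 0))) (gen3 m j) \<in> gen3 m' ` J'"
      using j compat[OF j] \<beta>[OF j] by (intro image_eqI[of _ _ "\<beta> j"]) simp_all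
  qed
  moreover have "top_indets (Suc 0) (Comp (Suc 0)) (trunc (Suc (Suc 0)) (computad X J m)) = gen2 ` X"
    "top_indets (Suc 0) (Comp (Suc 0)) (trunc (Suc (Suc 0)) (computad X' J' m')) = gen2 ` X'"
    unfolding computad_def by (rule top_indets_level2[OF cl] top_indets_level2[OF cl'])+
  ultimately show ?thesis
    using f trunc_map_functor[OF f, of "Suc (Suc 0)"] top_indets_level3[OF m] top_indets_level3[OF m']
    by (simp add: Hom_Comp_Suc)
qed

text \<open>The hypothesis on \<open>J\<close> is that the 3-generators of the product are the lifts along the projections of
the domains of pairs of 3-generators.  Their codomains, being empty, have a unique lift.\<close>

lemma product_computad:
  assumes mA: "\<And>j. j \<in> JA \<Longrightarrow> set_mset (mA j) \<subseteq> XA" and mB: "\<And>j. j \<in> JB \<Longrightarrow> set_mset (mB j) \<subseteq> XB"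
    and mP: "\<And>j. j \<in> JP \<Longrightarrow> set_mset (mP j) \<subseteq> XP"
    and p: "\<And>x. x \<in> XP \<Longrightarrow> p x \<in> XA" "\<And>j. j \<in> JP \<Longrightarrow> pJ j \<in> JA" "\<And>j. j \<in> JP \<Longrightarrow> mA (pJ j) = image_mset p (mP j)"
    and q: "\<And>x. x \<in> XP \<Longrightarrow> q x \<in> XB" "\<And>j. j \<in> JP \<Longrightarrow> qJ j \<in> JB" "\<And>j. j \<in> JP \<Longrightarrow> mB (qJ j) = image_mset q (mP j)"
    and X: "\<And>x y. x \<in> XA \<Longrightarrow> y \<in> XB \<Longrightarrow> \<exists>!i. i \<in> XP \<and> p i = x \<and> q i = y"
    and J: "\<And>i j a. i \<in> JA \<Longrightarrow> j \<in> JB \<Longrightarrow> set_mset a \<subseteq> XP \<Longrightarrow> image_mset p a = mA i \<Longrightarrow>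
       image_mset q a = mB j \<Longrightarrow> \<exists>!l. l \<in> JP \<and> pJ l = i \<and> qJ l = j \<and> mP l = a"
  shows "is_product (Comp (Suc (Suc (Suc 0)))) (computad XA JA mA) (computad XB JB mB) (computad XP JP mP)
     (gen_map (computad XP JP mP) p pJ) (gen_map (computad XP JP mP) q qJ)"
proof -
  let ?A = "computad XA JA mA" and ?B = "computad XB JB mB" and ?P = "computad XP JP mP"
  define \<pi> where "\<pi> = gen_map ?P p pJ"
  define \<rho> where "\<rho> = gen_map ?P q qJ"
  have \<pi>: "\<pi> \<in> Hom (Comp (Suc (Suc (Suc 0)))) ?P ?A" unfolding \<pi>_def using mP mA p by (rule gen_map_Hom)
  have \<rho>: "\<rho> \<in> Hom (Comp (Suc (Suc (Suc 0)))) ?P ?B" unfolding \<rho>_def using mP mB q by (rule gen_map_Hom)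
  have \<pi>2: "trunc_map (Suc (Suc 0)) \<pi> \<in> Hom (Comp (Suc (Suc 0))) (trunc (Suc (Suc 0)) ?P) (trunc (Suc (Suc 0)) ?A)"
    and \<rho>2: "trunc_map (Suc (Suc 0)) \<rho> \<in> Hom (Comp (Suc (Suc 0))) (trunc (Suc (Suc 0)) ?P) (trunc (Suc (Suc 0)) ?B)"
    using \<pi> \<rho> by (simp_all add: Hom_Comp_Suc)
  have \<pi>1: "trunc_map (Suc 0) \<pi> \<in> Hom (Comp (Suc 0)) (trunc (Suc 0) ?P) (trunc (Suc 0) ?A)"
    and \<rho>1: "trunc_map (Suc 0) \<rho> \<in> Hom (Comp (Suc 0)) (trunc (Suc 0) ?P) (trunc (Suc 0) ?B)"
    using \<pi>2 \<rho>2 by (simp_all add: Hom_Comp_Suc)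
  have O: "?A \<in> Obj (Comp (Suc (Suc (Suc 0))))" "?B \<in> Obj (Comp (Suc (Suc (Suc 0))))" "?P \<in> Obj (Comp (Suc (Suc (Suc 0))))"
    by (rule computad_in_Comp, erule mA mB mP)+
  note O2 = O[THEN Comp_trunc]
  have O1: "trunc (Suc 0) ?A \<in> Obj (Comp (Suc 0))" "trunc (Suc 0) ?B \<in> Obj (Comp (Suc 0))" "trunc (Suc 0) ?P \<in> Obj (Comp (Suc 0))"
    using O2[THEN Comp_trunc] by simp_all
  have eq: "trunc (Suc 0) ?A = trunc (Suc 0) ?P" "trunc (Suc 0) ?B = trunc (Suc 0) ?P" 
    unfolding computad_def by (rule trunc1_cells_ncat)+
  have pteq: "f = g" if "f \<in> n_functors C (trunc (Suc 0) ?P)" "g \<in> n_functors C (trunc (Suc 0) ?P)" for f g C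
  proof (rule n_functors_eqI[OF that])
    fix k x assume x: "x \<in> Cells C k"
    have "z = pt" if "z \<in> Cells (trunc (Suc 0) ?P) k" for z
      using that by (auto simp: computad_def cells_ncat_def split: if_splits)
    from this[OF n_functors_cell[OF that(1) x]] this[OF n_functors_cell[OF that(2) x]]
    show "f k x = g k x" by simp
  qed
  have prod1: "is_product (Comp (Suc 0)) (trunc (Suc 0) ?A) (trunc (Suc 0) ?B) (trunc (Suc 0) ?P)
      (trunc_map (Suc 0) \<pi>) (trunc_map (Suc 0) \<rho>)"
    unfolding is_product_def Comp_simps
  proof (intro conjI O1(3) \<pi>1 \<rho>1 ballI)
    fix C f g assume C: "C \<in> Obj (Comp (Suc 0))" and f: "f \<in> Hom (Comp (Suc 0)) C (trunc (Suc 0) ?A)"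
      and g: "g \<in> Hom (Comp (Suc 0)) C (trunc (Suc 0) ?B)"
    have fF: "f \<in> n_functors C (trunc (Suc 0) ?P)" and gF: "g \<in> n_functors C (trunc (Suc 0) ?P)"
      using Comp_n_functor[OF f] Comp_n_functor[OF g] by (simp_all add: eq)
    have comp: "nmap_comp C (trunc (Suc 0) ?P) (trunc (Suc 0) ?P) k h \<in> n_functors C (trunc (Suc 0) ?P)"
      if "h \<in> Hom (Comp (Suc 0)) C (trunc (Suc 0) ?P)" "k \<in> Hom (Comp (Suc 0)) (trunc (Suc 0) ?P) (trunc (Suc 0) ?P)" for h k
      by (rule Comp_n_functor[OF Comp_comp_closed[OF C O1(3) O1(3) that]])
    show "\<exists>!h. h \<in> Hom (Comp (Suc 0)) C (trunc (Suc 0) ?P) \<and>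
        nmap_comp C (trunc (Suc 0) ?P) (trunc (Suc 0) ?A) (trunc_map (Suc 0) \<pi>) h = f \<and>
        nmap_comp C (trunc (Suc 0) ?P) (trunc (Suc 0) ?B) (trunc_map (Suc 0) \<rho>) h = g"
      unfolding eq
    proof (rule ex1I[of _ f])
      show "f \<in> Hom (Comp (Suc 0)) C (trunc (Suc 0) ?P) \<and>
        nmap_comp C (trunc (Suc 0) ?P) (trunc (Suc 0) ?P) (trunc_map (Suc 0) \<pi>) f = f \<and>
        nmap_comp C (trunc (Suc 0) ?P) (trunc (Suc 0) ?P) (trunc_map (Suc 0) \<rho>) f = g"
        using f \<pi>1 \<rho>1 comp fF gF pteq unfolding eq by blast
    qed (use pteq fF Comp_n_functor in blast)
  qed
  have cl: "closed_cells {a. set_mset a \<subseteq> XA} (free_cells XA JA mA)" "closed_cells {a. set_mset a \<subseteq> XB} (free_cells XB JB mB)"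
    "closed_cells {a. set_mset a \<subseteq> XP} (free_cells XP JP mP)"
    using closed_free_cells mA mB mP by auto
  have top2: "top_indets (Suc 0) (Comp (Suc 0)) (trunc (Suc (Suc 0)) ?A) = gen2 ` XA"
    "top_indets (Suc 0) (Comp (Suc 0)) (trunc (Suc (Suc 0)) ?B) = gen2 ` XB"
    "top_indets (Suc 0) (Comp (Suc 0)) (trunc (Suc (Suc 0)) ?P) = gen2 ` XP"
    unfolding computad_def by (rule top_indets_level2[OF cl(1)] top_indets_level2[OF cl(2)] top_indets_level2[OF cl(3)])+
  have val2: "\<pi> (Suc (Suc 0)) (enc (c, {#}, c)) = enc (image_mset p c, {#}, image_mset p c)"
    "\<rho> (Suc (Suc 0)) (enc (c, {#}, c)) = enc (image_mset q c, {#}, image_mset q c)" if "set_mset c \<subseteq> XP" for c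
    using that by (simp_all add: \<pi>_def \<rho>_def computad_def)
  have cells2: "Cells ?P (Suc (Suc 0)) = (\<lambda>a. enc (a, {#}, a)) ` {a. set_mset a \<subseteq> XP}" by (simp add: computad_def)
  have prod2: "is_product (Comp (Suc (Suc 0))) (trunc (Suc (Suc 0)) ?A) (trunc (Suc (Suc 0)) ?B) (trunc (Suc (Suc 0)) ?P)
      (trunc_map (Suc (Suc 0)) \<pi>) (trunc_map (Suc (Suc 0)) \<rho>)"
  proof (rule product_lift[OF O2(3,1,2) \<pi>2 \<rho>2])
    show "is_product (Comp (Suc 0)) (trunc (Suc 0) (trunc (Suc (Suc 0)) ?A)) (trunc (Suc 0) (trunc (Suc (Suc 0)) ?B))
       (trunc (Suc 0) (trunc (Suc (Suc 0)) ?P)) (trunc_map (Suc 0) (trunc_map (Suc (Suc 0)) \<pi>)) (trunc_map (Suc 0) (trunc_map (Suc (Suc 0)) \<rho>))"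
      using prod1 by simp
    fix z assume "z \<in> Cells (trunc (Suc (Suc 0)) ?P) (Suc (Suc 0))"
      "trunc_map (Suc (Suc 0)) \<pi> (Suc (Suc 0)) z \<in> top_indets (Suc 0) (Comp (Suc 0)) (trunc (Suc (Suc 0)) ?A)"
    then show "z \<in> top_indets (Suc 0) (Comp (Suc 0)) (trunc (Suc (Suc 0)) ?P)"
      by (auto simp: top2 cells2 trunc_map_def val2 image_mset_eq_single)
  next
    fix a b r s
    assume a: "a \<in> top_indets (Suc 0) (Comp (Suc 0)) (trunc (Suc (Suc 0)) ?A)"
      and b: "b \<in> top_indets (Suc 0) (Comp (Suc 0)) (trunc (Suc (Suc 0)) ?B)"
      and r: "r \<in> Cells (trunc (Suc (Suc 0)) ?P) (Suc 0)" and s: "s \<in> Cells (trunc (Suc (Suc 0)) ?P) (Suc 0)"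
    from a b obtain x y where xy: "a = gen2 x" "x \<in> XA" "b = gen2 y" "y \<in> XB" by (auto simp: top2)
    from r s have rs: "r = pt" "s = pt" by (simp_all add: computad_def)
    obtain i where i: "i \<in> XP" "p i = x" "q i = y" and u: "\<And>i'. i' \<in> XP \<Longrightarrow> p i' = x \<Longrightarrow> q i' = y \<Longrightarrow> i' = i"
      using X[OF xy(2,4)] by blast
    show "\<exists>!z. z \<in> Cells (trunc (Suc (Suc 0)) ?P) (Suc (Suc 0)) \<and> trunc_map (Suc (Suc 0)) \<pi> (Suc (Suc 0)) z = a \<and>
        trunc_map (Suc (Suc 0)) \<rho> (Suc (Suc 0)) z = b \<and> dm (trunc (Suc (Suc 0)) ?P) (Suc 0) z = r \<and>
        cd (trunc (Suc (Suc 0)) ?P) (Suc 0) z = s"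
    proof (rule ex1I[of _ "gen2 i"])
      show "gen2 i \<in> Cells (trunc (Suc (Suc 0)) ?P) (Suc (Suc 0)) \<and> trunc_map (Suc (Suc 0)) \<pi> (Suc (Suc 0)) (gen2 i) = a \<and>
        trunc_map (Suc (Suc 0)) \<rho> (Suc (Suc 0)) (gen2 i) = b \<and> dm (trunc (Suc (Suc 0)) ?P) (Suc 0) (gen2 i) = r \<and>
        cd (trunc (Suc (Suc 0)) ?P) (Suc 0) (gen2 i) = s"
        using i xy rs val2[of "{#i#}"] by (simp add: trunc_map_def computad_def)
      fix z assume "z \<in> Cells (trunc (Suc (Suc 0)) ?P) (Suc (Suc 0)) \<and> trunc_map (Suc (Suc 0)) \<pi> (Suc (Suc 0)) z = a \<and>
        trunc_map (Suc (Suc 0)) \<rho> (Suc (Suc 0)) z = b \<and> dm (trunc (Suc (Suc 0)) ?P) (Suc 0) z = r \<and>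
        cd (trunc (Suc (Suc 0)) ?P) (Suc 0) z = s"
      then show "z = gen2 i" using u xy by (auto simp: cells2 trunc_map_def val2 image_mset_eq_single)
    qed
  qed
  note top3 = top_indets_level3[of JA mA XA, OF mA] top_indets_level3[of JB mB XB, OF mB] top_indets_level3[of JP mP XP, OF mP]
  have val3: "\<pi> (Suc (Suc (Suc 0))) (enc (a, w, b)) = enc (image_mset p a, image_mset pJ w, image_mset p b)"
    "\<rho> (Suc (Suc (Suc 0))) (enc (a, w, b)) = enc (image_mset q a, image_mset qJ w, image_mset q b)" if "(a, w, b) \<in> free_cells XP JP mP" for a w b
    using that by (simp_all add: \<pi>_def \<rho>_def computad_def)
  have cells3: "Cells ?P (Suc (Suc (Suc 0))) = enc ` free_cells XP JP mP" by (simp add: computad_def)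
  have "is_product (Comp (Suc (Suc (Suc 0)))) ?A ?B ?P \<pi> \<rho>"
  proof (rule product_lift[OF O(3,1,2) \<pi> \<rho> prod2])
    fix z assume z: "z \<in> Cells ?P (Suc (Suc (Suc 0)))"
      "\<pi> (Suc (Suc (Suc 0))) z \<in> top_indets (Suc (Suc 0)) (Comp (Suc (Suc 0))) ?A"
    then obtain a w b where awb: "z = enc (a, w, b)" "(a, w, b) \<in> free_cells XP JP mP" by (auto simp: cells3)
    with z val3[OF awb(2)] obtain j where "image_mset pJ w = {#j#}" "image_mset p b = {#}"
      by (auto simp: top3)
    with awb show "z \<in> top_indets (Suc (Suc 0)) (Comp (Suc (Suc 0))) ?P"
      by (auto simp: top3 image_mset_eq_single)
  next
    fix a b r s
    assume a: "a \<in> top_indets (Suc (Suc 0)) (Comp (Suc (Suc 0))) ?A"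
      and b: "b \<in> top_indets (Suc (Suc 0)) (Comp (Suc (Suc 0))) ?B"
      and r: "r \<in> Cells ?P (Suc (Suc 0))" and s: "s \<in> Cells ?P (Suc (Suc 0))"
      and bd: "\<pi> (Suc (Suc 0)) r = dm ?A (Suc (Suc 0)) a" "\<pi> (Suc (Suc 0)) s = cd ?A (Suc (Suc 0)) a"
        "\<rho> (Suc (Suc 0)) r = dm ?B (Suc (Suc 0)) b" "\<rho> (Suc (Suc 0)) s = cd ?B (Suc (Suc 0)) b"
    from a b obtain i j where ij: "a = gen3 mA i" "i \<in> JA" "b = gen3 mB j" "j \<in> JB" by (auto simp: top3)
    from r s obtain c d where cd: "r = enc (c, {#}, c)" "set_mset c \<subseteq> XP" "s = enc (d, {#}, d)" "set_mset d \<subseteq> XP"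
      by (auto simp: cells2)
    from bd(2) cd have d: "d = {#}" by (simp add: val2 ij computad_def)
    from bd(1,3) cd have c: "image_mset p c = mA i" "image_mset q c = mB j" by (simp_all add: val2 ij computad_def)
    obtain l where l: "l \<in> JP" "pJ l = i" "qJ l = j" "mP l = c"
      and u: "\<And>l'. l' \<in> JP \<Longrightarrow> pJ l' = i \<Longrightarrow> qJ l' = j \<Longrightarrow> mP l' = c \<Longrightarrow> l' = l"
      using J[OF ij(2,4) cd(2) c] by blast
    have lf: "(mP l, {#l#}, {#}) \<in> free_cells XP JP mP" using l by simp
    show "\<exists>!z. z \<in> Cells ?P (Suc (Suc (Suc 0))) \<and> \<pi> (Suc (Suc (Suc 0))) z = a \<and>
        \<rho> (Suc (Suc (Suc 0))) z = b \<and> dm ?P (Suc (Suc 0)) z = r \<and> cd ?P (Suc (Suc 0)) z = s"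
    proof (rule ex1I[of _ "gen3 mP l"])
      show "gen3 mP l \<in> Cells ?P (Suc (Suc (Suc 0))) \<and> \<pi> (Suc (Suc (Suc 0))) (gen3 mP l) = a \<and>
        \<rho> (Suc (Suc (Suc 0))) (gen3 mP l) = b \<and> dm ?P (Suc (Suc 0)) (gen3 mP l) = r \<and> cd ?P (Suc (Suc 0)) (gen3 mP l) = s"
        using l lf val3[OF lf] ij c cd(1,3) d by (simp add: cells3 computad_def del: free_cells_iff)
      fix z assume z: "z \<in> Cells ?P (Suc (Suc (Suc 0))) \<and> \<pi> (Suc (Suc (Suc 0))) z = a \<and>
        \<rho> (Suc (Suc (Suc 0))) z = b \<and> dm ?P (Suc (Suc 0)) z = r \<and> cd ?P (Suc (Suc 0)) z = s"
      then obtain a' w b' where awb: "z = enc (a', w, b')" "(a', w, b') \<in> free_cells XP JP mP" by (auto simp: cells3)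
      with z val3[OF awb(2)] ij have w: "image_mset pJ w = {#i#}" "image_mset qJ w = {#j#}" "b' = {#}" by auto
      from w(1) obtain l' where l': "w = {#l'#}" by (auto simp: image_mset_eq_single)
      from z awb cd(1) have "a' = c" by (simp add: computad_def)
      with w l' u[of l'] awb show "z = gen3 mP l" by auto
    qed
  qed
  then show ?thesis by (simp add: \<pi>_def \<rho>_def)
qed

lemma gen_map_cong:
  assumes \<alpha>: "\<And>x. x \<in> X \<Longrightarrow> \<alpha> x = \<alpha>' x" and \<beta>: "\<And>j. j \<in> J \<Longrightarrow> \<beta> j = \<beta>' j"
    and m: "\<And>j. j \<in> J \<Longrightarrow> set_mset (m j) \<subseteq> X"
  shows "gen_map (computad X J m) \<alpha> \<beta> = gen_map (computad X J m) \<alpha>' \<beta>'"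
proof (intro ext)
  fix k z
  have \<alpha>': "image_mset \<alpha> a = image_mset \<alpha>' a" if "set_mset a \<subseteq> X" for a
    using that \<alpha> by (auto intro!: image_mset_cong)
  have \<beta>': "image_mset \<beta> w = image_mset \<beta>' w" if "set_mset w \<subseteq> J" for w
    using that \<beta> by (auto intro!: image_mset_cong)
  show "gen_map (computad X J m) \<alpha> \<beta> k z = gen_map (computad X J m) \<alpha>' \<beta>' k z"
  proof (cases "z \<in> Cells (computad X J m) k")
    case True
    from True[unfolded computad_def] show ?thesis
    proof (cases rule: cells_cases)
      case (3 a w b)
      then have "set_mset b \<subseteq> X" "set_mset w \<subseteq> J" "set_mset a \<subseteq> X"
        using set_mset_sum[of w J m X] m by auto
      then show ?thesis using \<alpha>' \<beta>' True 3 by (simp add: gen_map_def computad_def)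
    qed (use True \<alpha>' in \<open>auto simp: computad_def\<close>)
  qed (simp add: gen_map_def)
qed

lemma gen_map_comp:
  assumes "gen_map A \<alpha> \<beta> \<in> n_functors A B"
  shows "nmap_comp A B C (gen_map B \<alpha>' \<beta>') (gen_map A \<alpha> \<beta>) = gen_map A (\<alpha>' \<circ> \<alpha>) (\<beta>' \<circ> \<beta>)"
proof (intro ext)
  fix k z
  show "nmap_comp A B C (gen_map B \<alpha>' \<beta>') (gen_map A \<alpha> \<beta>) k z = gen_map A (\<alpha>' \<circ> \<alpha>) (\<beta>' \<circ> \<beta>) k z"
    using n_functors_cell[OF assms, of z k]
    by (cases "z \<in> Cells A k") (auto simp: nmap_comp_def compose_def gen_map_def image_mset.compositionality split: prod.splits)
qed

lemma computad_maps_eqI: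
  assumes m: "\<And>j. j \<in> J \<Longrightarrow> set_mset (m j) \<subseteq> X" and E: "E \<in> Obj (Comp (Suc (Suc (Suc 0))))"
    and g: "g \<in> Hom (Comp (Suc (Suc (Suc 0)))) (computad X J m) E" and g': "g' \<in> Hom (Comp (Suc (Suc (Suc 0)))) (computad X J m) E"
    and low: "trunc_map (Suc (Suc 0)) g = trunc_map (Suc (Suc 0)) g'"
    and gen: "\<And>j. j \<in> J \<Longrightarrow> g (Suc (Suc (Suc 0))) (gen3 m j) = g' (Suc (Suc (Suc 0))) (gen3 m j)"
  shows "g = g'"
proof (rule is_free_unique[OF is_free_level3[OF m]])
  show "n_category (Suc (Suc (Suc 0))) E" "trunc (Suc (Suc 0)) E \<in> Obj (Comp (Suc (Suc 0)))"
    using E by (auto intro: Comp_n_category Comp_trunc)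
qed (use g g' low gen in \<open>auto simp: Hom_Comp_Suc gen_com_def gen_unit_def\<close>)

section \<open>Two computads without an exponential\<close>

text \<open>The 2-generator \<open>(x\<^sub>i, x\<^sub>j)\<close> of \<open>ZZ\<close>, the product of \<open>Z\<close> with itself, is numbered \<open>2 * i + j\<close>, so that the
projections are \<open>div 2\<close> and \<open>mod 2\<close>.  The computads \<open>Z\<^sub>0\<close> and \<open>ZZ\<^sub>0\<close> are \<open>Z\<close> and \<open>ZZ\<close> without their
3-generators.\<close>

definition Z :: "'u ncat" where "Z = computad {0, 1} {0} (\<lambda>_. {#0, 1#})"
definition Z\<^sub>0 :: "'u ncat" where "Z\<^sub>0 = computad {0, 1} {} (\<lambda>_. {#0, 1#})"
definition B :: "'u ncat" where "B = computad {0} {0, 1} (\<lambda>_. {#0, 0#})"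
definition mZZ :: "nat \<Rightarrow> nat multiset" where "mZZ j = (if j = 0 then {#0, 3#} else {#1, 2#})"
definition ZZ :: "'u ncat" where "ZZ = computad {0, 1, 2, 3} {0, 1} mZZ"
definition ZZ\<^sub>0 :: "'u ncat" where "ZZ\<^sub>0 = computad {0, 1, 2, 3} {} mZZ"

lemmas the_computads = Z_def Z\<^sub>0_def B_def ZZ_def ZZ\<^sub>0_def

text \<open>The two matchings between the elements of \<open>{#0, 1#}\<close> and those of a second copy of it.\<close>

lemma lifts_of_generator:
  assumes "image_mset (\<lambda>i. i div 2) a = {#0, 1#}" "image_mset (\<lambda>i. i mod 2) a = {#0, 1 :: nat#}"
  shows "a = {#0, 3#} \<or> a = {#1, 2#}"
proof -
  have "size a = 2" using assms(1) by (metis size_image_mset size_add_mset size_empty numeral_2_eq_2)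
  then obtain x b where "a = add_mset x b" "size b = 1"
    using size_eq_Suc_imp_eq_union[of a 1] by auto
  then obtain y where a: "a = {#x, y#}" using size_1_singleton_mset[of b] by auto
  have "x div 2 = 0 \<and> y div 2 = 1 \<or> x div 2 = 1 \<and> y div 2 = 0"
    using assms(1) unfolding a by (auto simp: add_eq_conv_ex)
  moreover have "x mod 2 = 0 \<and> y mod 2 = 1 \<or> x mod 2 = 1 \<and> y mod 2 = 0"
    using assms(2) unfolding a by (auto simp: add_eq_conv_ex)
  moreover have "x = 2 * (x div 2) + x mod 2" "y = 2 * (y div 2) + y mod 2" by simp_all
  ultimately have "x = 0 \<and> y = 3 \<or> x = 3 \<and> y = 0 \<or> x = 1 \<and> y = 2 \<or> x = 2 \<and> y = 1" by linarith
  then show ?thesis unfolding a by (auto simp: add_mset_commute)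
qed

lemma pair_index:
  fixes x y :: nat
  assumes "x \<in> {0, 1}" "y \<in> {0, 1}"
  shows "\<exists>!i. i \<in> {0, 1, 2, 3} \<and> i div 2 = x \<and> i mod 2 = y"
proof (rule ex1I[of _ "2 * x + y"])
  show "2 * x + y \<in> {0, 1, 2, 3} \<and> (2 * x + y) div 2 = x \<and> (2 * x + y) mod 2 = y" using assms by auto
  fix i assume "i \<in> {0, 1, 2, 3} \<and> i div 2 = x \<and> i mod 2 = y"
  then show "i = 2 * x + y" using div_mult_mod_eq[of i 2] by (simp add: mult.commute)
qed

lemma product_ZZ:
  "is_product (Comp (Suc (Suc (Suc 0)))) Z Z ZZ (gen_map ZZ (\<lambda>i. i div 2) (\<lambda>_. 0)) (gen_map ZZ (\<lambda>i. i mod 2) (\<lambda>_. 0))"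
  unfolding ZZ_def Z_def
proof (rule product_computad)
  show "\<exists>!i. i \<in> {0, 1, 2, 3} \<and> i div 2 = x \<and> i mod 2 = y" if "x \<in> {0, 1}" "y \<in> {0, 1}" for x y :: nat
    using that by (rule pair_index)
  fix i j :: nat and a :: "nat multiset" assume "set_mset a \<subseteq> {0, 1, 2, 3}"
    "image_mset (\<lambda>i. i div 2) a = {#0, 1#}" "image_mset (\<lambda>i. i mod 2) a = {#0, 1#}" "i \<in> {0}" "j \<in> {0}"
  with lifts_of_generator[of a] show "\<exists>!l. l \<in> {0, 1} \<and> 0 = i \<and> 0 = j \<and> mZZ l = a"
    by (auto simp: mZZ_def add_eq_conv_ex)
qed (auto simp: mZZ_def)

lemma product_ZZ\<^sub>0:
  "is_product (Comp (Suc (Suc (Suc 0)))) Z\<^sub>0 Z ZZ\<^sub>0 (gen_map ZZ\<^sub>0 (\<lambda>i. i div 2) (\<lambda>_. 0)) (gen_map ZZ\<^sub>0 (\<lambda>i. i mod 2) (\<lambda>_. 0))"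
  unfolding ZZ\<^sub>0_def Z\<^sub>0_def Z_def
proof (rule product_computad)
  show "\<exists>!i. i \<in> {0, 1, 2, 3} \<and> i div 2 = x \<and> i mod 2 = y" if "x \<in> {0, 1}" "y \<in> {0, 1}" for x y :: nat
    using that by (rule pair_index)
qed auto

text \<open>The transpose of a map that separates the two 3-generators of \<open>ZZ\<close> would be invariant under the swap
of the 2-generators of \<open>Z\<close>, but the map itself is not.\<close>

lemma no_exponential:
  assumes "\<And>A. A \<in> {Z, Z\<^sub>0, B, ZZ, ZZ\<^sub>0} \<Longrightarrow> A \<in> S"
  shows "\<not> is_exponential (full_subcat (Comp (Suc (Suc (Suc 0)))) S) Z B E P p q ev"
proof
  define C where "C = full_subcat (Comp (Suc (Suc (Suc 0)))) S"
  have Cs: "Obj C = Obj (Comp (Suc (Suc (Suc 0)))) \<inter> S" "Hom C = Hom (Comp (Suc (Suc (Suc 0))))" "Cmp C = nmap_comp"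
    by (simp_all add: C_def full_subcat_def)
  assume "is_exponential (full_subcat (Comp (Suc (Suc (Suc 0)))) S) Z B E P p q ev"
  then have exp: "is_exponential C Z B E P p q ev" by (simp add: C_def)
  have prod_sub: "is_product C X Y Q r s" if "is_product (Comp (Suc (Suc (Suc 0)))) X Y Q r s" "Q \<in> S" for X Y Q r s
    using that unfolding is_product_def Cs by auto
  have Obj: "Z \<in> Obj C" "Z\<^sub>0 \<in> Obj C" "B \<in> Obj C" "ZZ \<in> Obj C" "ZZ\<^sub>0 \<in> Obj C"
  proof -
    have "Z \<in> Obj (Comp (Suc (Suc (Suc 0))))" "Z\<^sub>0 \<in> Obj (Comp (Suc (Suc (Suc 0))))" "B \<in> Obj (Comp (Suc (Suc (Suc 0))))"
      "ZZ \<in> Obj (Comp (Suc (Suc (Suc 0))))" "ZZ\<^sub>0 \<in> Obj (Comp (Suc (Suc (Suc 0))))"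
      unfolding the_computads by (rule computad_in_Comp; simp add: mZZ_def)+
    then show "Z \<in> Obj C" "Z\<^sub>0 \<in> Obj C" "B \<in> Obj C" "ZZ \<in> Obj C" "ZZ\<^sub>0 \<in> Obj C"
      using assms unfolding Cs by simp_all
  qed
  define \<pi> \<rho> \<pi>\<^sub>0 \<rho>\<^sub>0 where "\<pi> = gen_map ZZ (\<lambda>i. i div 2) (\<lambda>_. 0)" and "\<rho> = gen_map ZZ (\<lambda>i. i mod 2) (\<lambda>_. 0)"
    and "\<pi>\<^sub>0 = gen_map ZZ\<^sub>0 (\<lambda>i. i div 2) (\<lambda>_. 0)" and "\<rho>\<^sub>0 = gen_map ZZ\<^sub>0 (\<lambda>i. i mod 2) (\<lambda>_. 0)"
  define jZ jZZ where "jZ = gen_map Z\<^sub>0 id id" and "jZZ = gen_map ZZ\<^sub>0 id id"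
  (* s swaps the 2-generators of Z; t swaps the first coordinates of those of ZZ.
     The effect of t on the 3-generators of ZZ is again given by s. *)
  define s :: "nat \<Rightarrow> nat" where "s i = 1 - i" for i
  define t :: "nat \<Rightarrow> nat" where "t i = (i + 2) mod 4" for i
  define \<sigma> \<sigma>\<^sub>0 \<tau> \<tau>\<^sub>0 where "\<sigma> = gen_map Z s id" and "\<sigma>\<^sub>0 = gen_map Z\<^sub>0 s id" and "\<tau> = gen_map ZZ t s" and "\<tau>\<^sub>0 = gen_map ZZ\<^sub>0 t s"
  define f f\<^sub>0 where "f = gen_map ZZ (\<lambda>_. 0) id" and "f\<^sub>0 = gen_map ZZ\<^sub>0 (\<lambda>_. 0) id"
  note map_defs = \<pi>_def \<rho>_def \<pi>\<^sub>0_def \<rho>\<^sub>0_def jZ_def jZZ_def \<sigma>_def \<sigma>\<^sub>0_def \<tau>_def \<tau>\<^sub>0_def f_def f\<^sub>0_def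
  have mHom: "\<alpha> ` X \<subseteq> X' \<Longrightarrow> \<beta> ` J \<subseteq> J' \<Longrightarrow> (\<forall>j\<in>J. m' (\<beta> j) = image_mset \<alpha> (m j)) \<Longrightarrow>
      (\<forall>j\<in>J. set_mset (m j) \<subseteq> X) \<Longrightarrow> (\<forall>j\<in>J'. set_mset (m' j) \<subseteq> X') \<Longrightarrow>
      gen_map (computad X J m) \<alpha> \<beta> \<in> Hom C (computad X J m) (computad X' J' m')" for X X' J J' m m' \<alpha> \<beta>
    unfolding Cs by (rule gen_map_Hom) auto
  note sm = s_def t_def mZZ_def add_mset_commute
  have H1: "\<pi> \<in> Hom C ZZ Z"
    unfolding map_defs the_computads by (rule mHom; simp add: sm)
  have H2: "\<rho> \<in> Hom C ZZ Z"
    unfolding map_defs the_computads by (rule mHom; simp add: sm)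
  have H3: "\<pi>\<^sub>0 \<in> Hom C ZZ\<^sub>0 Z\<^sub>0"
    unfolding map_defs the_computads by (rule mHom; simp add: sm)
  have H4: "\<rho>\<^sub>0 \<in> Hom C ZZ\<^sub>0 Z"
    unfolding map_defs the_computads by (rule mHom; simp add: sm)
  have H5: "jZ \<in> Hom C Z\<^sub>0 Z"
    unfolding map_defs the_computads by (rule mHom; simp add: sm)
  have H6: "jZZ \<in> Hom C ZZ\<^sub>0 ZZ"
    unfolding map_defs the_computads by (rule mHom; simp add: sm)
  have H7: "\<sigma> \<in> Hom C Z Z"
    unfolding map_defs the_computads by (rule mHom; simp add: sm)
  have H8: "\<sigma>\<^sub>0 \<in> Hom C Z\<^sub>0 Z\<^sub>0"
    unfolding map_defs the_computads by (rule mHom; simp add: sm)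
  have H9: "\<tau> \<in> Hom C ZZ ZZ"
    unfolding map_defs the_computads by (rule mHom; simp add: sm)
  have H10: "\<tau>\<^sub>0 \<in> Hom C ZZ\<^sub>0 ZZ\<^sub>0"
    unfolding map_defs the_computads by (rule mHom; simp add: sm)
  have H11: "f \<in> Hom C ZZ B"
    unfolding map_defs the_computads by (rule mHom; simp add: sm)
  have H12: "f\<^sub>0 \<in> Hom C ZZ\<^sub>0 B"
    unfolding map_defs the_computads by (rule mHom; simp add: sm)
  note H = H1 H2 H3 H4 H5 H6 H7 H8 H9 H10 H11 H12
  have F: "h \<in> n_functors X Y" if "h \<in> Hom C X Y" for h X Y
    using that unfolding Cs by (rule Comp_n_functor)
  have assoc: "nmap_comp W X V (nmap_comp X Y V h g) k = nmap_comp W Y V h (nmap_comp W X Y g k)"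
    if "k \<in> Hom C W X" for W X Y V h g k
    by (rule nmap_comp_assoc[OF F[OF that]])
  have cc: "nmap_comp X Y V g k \<in> Hom C X V" if "X \<in> Obj C" "Y \<in> Obj C" "V \<in> Obj C" "k \<in> Hom C X Y" "g \<in> Hom C Y V" for X Y V k g
    using that Comp_comp_closed by (auto simp: Cs)
  have mmc: "nmap_comp X Y V (gen_map Y \<alpha>' \<beta>') (gen_map X \<alpha> \<beta>) = gen_map X (\<alpha>' \<circ> \<alpha>) (\<beta>' \<circ> \<beta>)"
    if "gen_map X \<alpha> \<beta> \<in> Hom C X Y" for X Y V \<alpha> \<beta> \<alpha>' \<beta>' by (rule gen_map_comp[OF F[OF that]])
  note c = mmc[OF H(1)[unfolded \<pi>_def]] mmc[OF H(3)[unfolded \<pi>\<^sub>0_def]] mmc[OF H(6)[unfolded jZZ_def]]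
    mmc[OF H(9)[unfolded \<tau>_def]] mmc[OF H(10)[unfolded \<tau>\<^sub>0_def]]
  have e: "nmap_comp ZZ\<^sub>0 ZZ Z \<pi> jZZ = nmap_comp ZZ\<^sub>0 Z\<^sub>0 Z jZ \<pi>\<^sub>0"
    "nmap_comp ZZ\<^sub>0 ZZ Z \<rho> jZZ = \<rho>\<^sub>0" "nmap_comp ZZ\<^sub>0 ZZ B f jZZ = f\<^sub>0"
    "nmap_comp ZZ\<^sub>0 ZZ\<^sub>0 Z\<^sub>0 \<pi>\<^sub>0 \<tau>\<^sub>0 = nmap_comp ZZ\<^sub>0 Z\<^sub>0 Z\<^sub>0 \<sigma>\<^sub>0 \<pi>\<^sub>0"
    "nmap_comp ZZ\<^sub>0 ZZ\<^sub>0 Z \<rho>\<^sub>0 \<tau>\<^sub>0 = \<rho>\<^sub>0" "nmap_comp ZZ\<^sub>0 ZZ\<^sub>0 B f\<^sub>0 \<tau>\<^sub>0 = f\<^sub>0"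
    "nmap_comp ZZ ZZ Z \<pi> \<tau> = nmap_comp ZZ Z Z \<sigma> \<pi>" "nmap_comp ZZ ZZ Z \<rho> \<tau> = \<rho>"
    unfolding map_defs c unfolding the_computads
    by (rule gen_map_cong; auto simp: s_def t_def mZZ_def; fail)+
  from exp have E: "E \<in> Obj C" and prodP: "is_product C E Z P p q" and ev: "ev \<in> Hom C P B"
    and transpose: "\<And>Y Q r s k. Y \<in> Obj C \<Longrightarrow> is_product C Y Z Q r s \<Longrightarrow> k \<in> Hom C Q B \<Longrightarrow>
      \<exists>!g. g \<in> Hom C Y E \<and> (\<exists>h\<in>Hom C Q P. nmap_comp Q P E p h = nmap_comp Q Y E g r \<and>
         nmap_comp Q P Z q h = s \<and> nmap_comp Q P B ev h = k)"
    unfolding is_exponential_def Cs(3) by blast+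
  have P: "P \<in> Obj C" "p \<in> Hom C P E" "q \<in> Hom C P Z" using prodP by (auto simp: is_product_def)
  obtain g h where g: "g \<in> Hom C Z E" and h: "h \<in> Hom C ZZ P" and ph: "nmap_comp ZZ P E p h = nmap_comp ZZ Z E g \<pi>"
    and qh: "nmap_comp ZZ P Z q h = \<rho>" and evh: "nmap_comp ZZ P B ev h = f"
    using transpose[OF Obj(1) prod_sub[OF product_ZZ, folded \<pi>_def \<rho>_def] H(11)] Obj(4) by (auto simp: Cs(1))
  have prod0: "is_product C Z\<^sub>0 Z ZZ\<^sub>0 \<pi>\<^sub>0 \<rho>\<^sub>0"
    using prod_sub[OF product_ZZ\<^sub>0, folded \<pi>\<^sub>0_def \<rho>\<^sub>0_def] Obj(5) by (simp add: Cs(1))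
  (* The restriction of g to Z without its 3-generator is invariant under the swap, because
     it and its composite with the swap are transposes of the same map. *)
  note t0 = transpose[OF Obj(2) prod0 H(12)]
  define g\<^sub>0 where "g\<^sub>0 = nmap_comp Z\<^sub>0 Z E g jZ"
  define h\<^sub>0 where "h\<^sub>0 = nmap_comp ZZ\<^sub>0 ZZ P h jZZ"
  have g0: "g\<^sub>0 \<in> Hom C Z\<^sub>0 E" and h0: "h\<^sub>0 \<in> Hom C ZZ\<^sub>0 P"
    unfolding g\<^sub>0_def h\<^sub>0_def using cc Obj H E P g h by blast+
  have ph0: "nmap_comp ZZ\<^sub>0 P E p h\<^sub>0 = nmap_comp ZZ\<^sub>0 Z\<^sub>0 E g\<^sub>0 \<pi>\<^sub>0"
  proof -
    have "nmap_comp ZZ\<^sub>0 P E p h\<^sub>0 = nmap_comp ZZ\<^sub>0 ZZ E (nmap_comp ZZ P E p h) jZZ"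
      unfolding h\<^sub>0_def using assoc[OF H(6)] by simp
    also have "\<dots> = nmap_comp ZZ\<^sub>0 Z E g (nmap_comp ZZ\<^sub>0 Z\<^sub>0 Z jZ \<pi>\<^sub>0)"
      unfolding ph assoc[OF H(6)] e ..
    also have "\<dots> = nmap_comp ZZ\<^sub>0 Z\<^sub>0 E g\<^sub>0 \<pi>\<^sub>0" unfolding g\<^sub>0_def assoc[OF H(3)] ..
    finally show ?thesis .
  qed
  have qh0: "nmap_comp ZZ\<^sub>0 P Z q h\<^sub>0 = \<rho>\<^sub>0" and evh0: "nmap_comp ZZ\<^sub>0 P B ev h\<^sub>0 = f\<^sub>0"
    unfolding h\<^sub>0_def assoc[OF H(6), symmetric] qh evh e by (rule refl)+
  have "nmap_comp Z\<^sub>0 Z\<^sub>0 E g\<^sub>0 \<sigma>\<^sub>0 = g\<^sub>0"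
  proof -
    define h\<^sub>1 where "h\<^sub>1 = nmap_comp ZZ\<^sub>0 ZZ\<^sub>0 P h\<^sub>0 \<tau>\<^sub>0"
    have "nmap_comp ZZ\<^sub>0 P E p h\<^sub>1 = nmap_comp ZZ\<^sub>0 Z\<^sub>0 E g\<^sub>0 (nmap_comp ZZ\<^sub>0 Z\<^sub>0 Z\<^sub>0 \<sigma>\<^sub>0 \<pi>\<^sub>0)"
      unfolding h\<^sub>1_def assoc[OF H(10), symmetric] ph0 unfolding assoc[OF H(10)] e ..
    then have "nmap_comp ZZ\<^sub>0 P E p h\<^sub>1 = nmap_comp ZZ\<^sub>0 Z\<^sub>0 E (nmap_comp Z\<^sub>0 Z\<^sub>0 E g\<^sub>0 \<sigma>\<^sub>0) \<pi>\<^sub>0"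
      unfolding assoc[OF H(3)] .
    moreover have "nmap_comp ZZ\<^sub>0 P Z q h\<^sub>1 = \<rho>\<^sub>0" "nmap_comp ZZ\<^sub>0 P B ev h\<^sub>1 = f\<^sub>0"
      unfolding h\<^sub>1_def assoc[OF H(10), symmetric] qh0 evh0 e by (rule refl)+
    moreover have "h\<^sub>1 \<in> Hom C ZZ\<^sub>0 P" "nmap_comp Z\<^sub>0 Z\<^sub>0 E g\<^sub>0 \<sigma>\<^sub>0 \<in> Hom C Z\<^sub>0 E"
      unfolding h\<^sub>1_def using cc Obj H E P h0 g0 by blast+
    ultimately show ?thesis using t0 g0 h0 ph0 qh0 evh0 by (elim ex1E) blast
  qed
  moreover have "nmap_comp Z\<^sub>0 Z E (nmap_comp Z Z E g \<sigma>) jZ = nmap_comp Z\<^sub>0 Z\<^sub>0 E g\<^sub>0 \<sigma>\<^sub>0"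
  proof -
    have "nmap_comp Z\<^sub>0 Z Z \<sigma> jZ = nmap_comp Z\<^sub>0 Z\<^sub>0 Z jZ \<sigma>\<^sub>0"
      unfolding map_defs mmc[OF H(5)[unfolded jZ_def]] mmc[OF H(8)[unfolded \<sigma>\<^sub>0_def]] by simp
    then show ?thesis unfolding g\<^sub>0_def assoc[OF H(5)] assoc[OF H(8)] by simp
  qed
  ultimately have restr: "nmap_comp Z\<^sub>0 Z E (nmap_comp Z Z E g \<sigma>) jZ = nmap_comp Z\<^sub>0 Z E g jZ"
    by (simp add: g\<^sub>0_def)
  (* The swap fixes the 3-generator of Z, so the invariance extends to all of Z. *)
  have gs: "nmap_comp Z Z E g \<sigma> \<in> Hom C Z E" using cc Obj H E g by blast
  have "nmap_comp Z Z E g \<sigma> = g"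
  proof (rule computad_maps_eqI[of "{0}" "\<lambda>_. {#0, 1#}" "{0, 1}" E, folded Z_def])
    show "E \<in> Obj (Comp (Suc (Suc (Suc 0))))" "nmap_comp Z Z E g \<sigma> \<in> Hom (Comp (Suc (Suc (Suc 0)))) Z E"
      "g \<in> Hom (Comp (Suc (Suc (Suc 0)))) Z E" using E gs g by (simp_all add: Cs)
    have low: "nmap_comp Z Z E g \<sigma> k z = g k z" if k: "k \<le> Suc (Suc 0)" and z: "z \<in> Cells Z k" for k z
    proof -
      from k z have z0: "z \<in> Cells Z\<^sub>0 k" by (auto simp: Z_def Z\<^sub>0_def computad_def cells_ncat_def split: if_splits)
      have "jZ k z = z" using z0 by (auto simp: jZ_def gen_map_def Z\<^sub>0_def computad_def pt_def elim!: cells_cases)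
      then show ?thesis using fun_cong[OF fun_cong[OF restr, of k], of z] z0 by (simp add: nmap_comp_apply)
    qed
    show "trunc_map (Suc (Suc 0)) (nmap_comp Z Z E g \<sigma>) = trunc_map (Suc (Suc 0)) g"
    proof (rule n_functors_eqI[OF trunc_map_functor[OF F[OF gs]] trunc_map_functor[OF F[OF g]]])
      fix k z assume "z \<in> Cells (trunc (Suc (Suc 0)) Z) k"
      then show "trunc_map (Suc (Suc 0)) (nmap_comp Z Z E g \<sigma>) k z = trunc_map (Suc (Suc 0)) g k z"
        using low[of k z] by (auto simp: trunc_map_def split: if_splits)
    qed
    fix j :: nat assume j: "j \<in> {0}"
    have "gen3 (\<lambda>_. {#0, 1#}) 0 \<in> Cells Z (Suc (Suc (Suc 0)))" by (simp add: Z_def computad_def)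
    then show "nmap_comp Z Z E g \<sigma> (Suc (Suc (Suc 0))) (gen3 (\<lambda>_. {#0, 1#}) j) = g (Suc (Suc (Suc 0))) (gen3 (\<lambda>_. {#0, 1#}) j)"
      using j by (simp add: nmap_comp_apply \<sigma>_def s_def add_mset_commute)
  qed auto
  have "nmap_comp ZZ ZZ P h \<tau> = h"
  proof -
    have "\<exists>!k. k \<in> Hom C ZZ P \<and> nmap_comp ZZ P E p k = nmap_comp ZZ Z E g \<pi> \<and> nmap_comp ZZ P Z q k = \<rho>"
      using prodP Obj(4) cc[OF Obj(4,1) E H(1) g] H(2) unfolding is_product_def Cs(3) by blast
    moreover have "nmap_comp ZZ P E p (nmap_comp ZZ ZZ P h \<tau>) = nmap_comp ZZ Z E g \<pi>"
    proof -
      have "nmap_comp ZZ P E p (nmap_comp ZZ ZZ P h \<tau>) = nmap_comp ZZ Z E g (nmap_comp ZZ Z Z \<sigma> \<pi>)"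
        unfolding assoc[OF H(9), symmetric] ph unfolding assoc[OF H(9)] e ..
      also have "\<dots> = nmap_comp ZZ Z E (nmap_comp Z Z E g \<sigma>) \<pi>" unfolding assoc[OF H(1)] ..
      finally show ?thesis using \<open>nmap_comp Z Z E g \<sigma> = g\<close> by simp
    qed
    moreover have "nmap_comp ZZ P Z q (nmap_comp ZZ ZZ P h \<tau>) = \<rho>"
      unfolding assoc[OF H(9), symmetric] qh e ..
    moreover have "nmap_comp ZZ ZZ P h \<tau> \<in> Hom C ZZ P" using cc Obj H P h by blast
    ultimately show ?thesis using h ph qh by (elim ex1E) blast
  qed
  then have f\<tau>: "nmap_comp ZZ ZZ B f \<tau> = f"
    unfolding evh[symmetric] assoc[OF H(9)] by simp
  (* The map \<tau> interchanges the two 3-generators of ZZ, which f keeps apart. *)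
  have z: "gen3 mZZ 0 \<in> Cells ZZ (Suc (Suc (Suc 0)))" "gen3 mZZ 1 \<in> Cells ZZ (Suc (Suc (Suc 0)))"
    by (auto simp: ZZ_def computad_def mZZ_def)
  have "f (Suc (Suc (Suc 0))) (\<tau> (Suc (Suc (Suc 0))) (gen3 mZZ 0)) = f (Suc (Suc (Suc 0))) (gen3 mZZ 0)"
    using nmap_comp_apply[OF z(1), of ZZ B f \<tau>] by (simp only: f\<tau>)
  moreover have "\<tau> (Suc (Suc (Suc 0))) (gen3 mZZ 0) = gen3 mZZ 1"
    using z by (simp add: \<tau>_def t_def s_def mZZ_def add_mset_commute)
  ultimately show False using z by (simp add: f_def)
qed

end

text \<open>Cells can be coded inside any infinite set, which puts the computads of multisets into every size family.\<close>

lemma ex_coding: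
  assumes "infinite (X :: 'u set)"
  shows "\<exists>enc :: cell \<Rightarrow> 'u. inj enc \<and> range enc \<subseteq> X"
proof -
  obtain f :: "nat \<Rightarrow> 'u" where f: "inj f" "range f \<subseteq> X" using assms infinite_iff_countable_subset[of X] by auto
  define c :: "cell \<Rightarrow> nat" where
    "c = (\<lambda>(a, w, b). to_nat (sorted_list_of_multiset a, sorted_list_of_multiset w, sorted_list_of_multiset b))"
  have "inj c"
    unfolding c_def inj_def by (auto dest!: arg_cong[where f=mset])
  with f have "inj (f \<circ> c)" "range (f \<circ> c) \<subseteq> X" by (auto intro: inj_compose)
  then show ?thesis by blast
qed

theorem lemma3p1:
  fixes \<U> \<V> :: "'u set set"
  assumes "size_family \<U>" and "size_family \<V>" and "\<V> \<subseteq> \<U>"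
  shows "\<not> cartesian_closed_on (Computads 3 \<U>) (Obj (Computads 3 \<V>))"
proof -
  obtain X where X: "X \<in> \<V>" "infinite X" and down: "\<And>Y. lepoll Y X \<Longrightarrow> Y \<in> \<V>"
    using assms(2) unfolding size_family_def by blast
  obtain enc :: "cell \<Rightarrow> 'u" where enc: "inj enc" "range enc \<subseteq> X" using ex_coding[OF X(2)] by blast
  interpret coding enc by unfold_locales (rule enc)
  have cells: "Cells (computad J K m) k \<in> \<V>" for J K m k
  proof (rule down[OF subset_imp_lepoll])
    show "Cells (computad J K m) k \<subseteq> X" using enc(2) by (auto simp: computad_def cells_ncat_def pt_def)
  qed
  have "Z \<in> Obj (Comp 3)" "B \<in> Obj (Comp 3)"
    unfolding numeral_3_eq_3 Z_def B_def by (rule computad_in_Comp; simp)+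
  then have ZB: "Z \<in> Obj (Computads 3 \<V>)" "B \<in> Obj (Computads 3 \<V>)"
    using cells by (simp_all add: Computads_def full_subcat_def Z_def B_def)
  show ?thesis
  proof
    assume "cartesian_closed_on (Computads 3 \<U>) (Obj (Computads 3 \<V>))"
    with ZB obtain E P p q ev where "is_exponential (Computads 3 \<U>) Z B E P p q ev"
      unfolding cartesian_closed_on_def by blast
    moreover have "\<not> is_exponential (Computads 3 \<U>) Z B E P p q ev"
      unfolding Computads_def numeral_3_eq_3
      by (rule no_exponential) (use cells assms(3) in \<open>auto simp: the_computads\<close>)
    ultimately show False by blast
  qed
qed

end
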